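(* If $\lambda^\varepsilon\in\sigma(A_\varepsilon)$, $\varepsilon\in[0,\varepsilon_0]$, and $\lambda^\varepsilon\to\lambda^0$ as $\varepsilon\to0$, then $$|\lambda^\varepsilon-\lambda^0|\le C\big(\|p_\varepsilon-p_0\|_{L^\infty(\Omega_1)}+\varepsilon\big)^{1/2},$$ where $C$ is a positive constant independent of $\varepsilon$. Moreover, if we denote $\sigma(A_\varepsilon)=\{\lambda_i^\varepsilon\}_{i=0}^\infty$ (ordered and counting multiplicity), we have the following gap condition: $$\lambda_{i+1}^\varepsilon-\lambda_i^\varepsilon\longrightarrow\infty\quad\text{as } i\to\infty.$$
   Context: Setting. Fix $0<\varepsilon_0\le 1$, $\lambda>0$, $m_0>0$ and a partition $0=x_0<x_1<x_2<x_3=1$. Put $\Omega_0=(x_1,x_2)$ and $\Omega_1=[0,x_1]\cup[x_2,1]$. For $\varepsilon\in(0,\varepsilon_0]$ let $p_\varepsilon\in C^2([0,1])$, and let $p_0\in C^2(\Omega_1)$, be such that: $p_\varepsilon\to p_0$ uniformly in $\Omega_1$ as $\varepsilon\to0$; $p_\varepsilon(x)\ge 1/\varepsilon$ for $x\in[x_1+\varepsilon,x_2-\varepsilon]$; $p_\varepsilon\ge m_0$ in $(0,1)$ (hence $p_0\ge m_0$ in $\Omega_1$). Spaces. $L^2_{\Omega_0}(0,1)=\{u\in L^2(0,1): u \text{ is constant a.e. in }\Omega_0\}$ and $H^1_{\Omega_0}(0,1)=\{u\in H^1(0,1): u_x=0 \text{ in }\Omega_0\}$. Operators. For $\varepsilon\in(0,\varepsilon_0]$,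 $A_\varepsilon$ is the operator in $L^2(0,1)$ with domain $\{u\in H^2(0,1):u_x(0)=u_x(1)=0\}$ and $A_\varepsilon u=-(p_\varepsilon u_x)_x+\lambda u$. $A_0$ is the operator in $L^2_{\Omega_0}(0,1)$ with domain $\{u\in H^1_{\Omega_0}(0,1): -(p_0u_x)_x\in L^2(\Omega_1),\ u_x(0)=u_x(1)=0\}$ and $A_0u=\big[-(p_0u_x)_x+\lambda u\big]\chi_{\Omega_1}+\big[\lambda u_{\Omega_0}\big]\chi_{\Omega_0}$, where $u_{\Omega_0}$ is the constant value of $u$ in $\Omega_0$ and $\chi$ denotes the characteristic function. $\sigma(A_\varepsilon)$ denotes the spectrum of $A_\varepsilon$.
   Formalization: The estimate is stated for all sufficiently small ε (a family unbounded away from ε=0 violates it on all of (0,ε_0]), and the gap condition for ε in (0,ε_0] only: at ε=0 it fails, e.g. for p_0=1, x_1=1-x_2, where A_0 has infinitely many double eigenvalues. *)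

theory Defs
  imports "HOL-Analysis.Analysis" "HOL-Probability.Essential_Supremum"
begin

section \<open>Square integrable functions\<close>

text \<open>Elements of the complex space \<open>L\<^sup>2(S)\<close> are represented by functions; the passage to
  classes modulo equality almost everywhere is made explicit through \<open>ae_eq\<close>.
  All the predicates below are invariant under \<open>ae_eq\<close>. The operators have real coefficients;
  complex scalars are used so that the spectrum is the usual subset of the complex plane.\<close>

definition ae_eq :: "real set \<Rightarrow> (real \<Rightarrow> complex) \<Rightarrow> (real \<Rightarrow> complex) \<Rightarrow> bool" where
  "ae_eq S u v \<longleftrightarrow> (AE x in lebesgue_on S. u x = v x)"

definition L2 :: "real set \<Rightarrow> (real \<Rightarrow> complex) set" where
  "L2 S = {u \<in> borel_measurable (lebesgue_on S). integrable (lebesgue_on S) (\<lambda>x. (cmod (u x))\<^sup>2)}"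

definition L2norm :: "real set \<Rightarrow> (real \<Rightarrow> complex) \<Rightarrow> real" where
  "L2norm S u = sqrt (\<integral>x. (cmod (u x))\<^sup>2 \<partial>lebesgue_on S)"

text \<open>Essential supremum of \<open>\<bar>f\<bar>\<close>; \<open>real_of_ereal\<close> would send an infinite value to 0, but
  the norm is only applied to functions that are continuous on a compact set.\<close>

definition Linf_norm :: "real set \<Rightarrow> (real \<Rightarrow> real) \<Rightarrow> real" where
  "Linf_norm S f = real_of_ereal (esssup (lebesgue_on S) (\<lambda>x. ereal \<bar>f x\<bar>))"

section \<open>Weak derivatives and Sobolev spaces\<close>

definition test_function :: "real set \<Rightarrow> (real \<Rightarrow> real) \<Rightarrow> bool" where
  "test_function S \<phi> \<longleftrightarrow>
     (\<forall>n x. ((deriv ^^ n) \<phi>) field_differentiable (at x)) \<and>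
     (\<exists>K. compact K \<and> K \<subseteq> S \<and> (\<forall>x. x \<notin> K \<longrightarrow> \<phi> x = 0))"

definition weak_deriv :: "real set \<Rightarrow> (real \<Rightarrow> complex) \<Rightarrow> (real \<Rightarrow> complex) \<Rightarrow> bool" where
  "weak_deriv S u g \<longleftrightarrow>
     (\<forall>\<phi>. test_function S \<phi> \<longrightarrow>
        (\<integral>x. u x * of_real (deriv \<phi> x) \<partial>lebesgue_on S) =
        - (\<integral>x. g x * of_real (\<phi> x) \<partial>lebesgue_on S))"

definition H1 :: "real set \<Rightarrow> (real \<Rightarrow> complex) set" where
  "H1 S = {u \<in> L2 S. \<exists>g\<in>L2 S. weak_deriv S u g}"

definition H2 :: "real set \<Rightarrow> (real \<Rightarrow> complex) set" where
  "H2 S = {u \<in> L2 S. \<exists>g\<in>H1 S. weak_deriv S u g}"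

text \<open>\<open>bdry_value a b g x c\<close>: the class of \<open>g\<close> on \<open>(a,b)\<close> has a continuous representative on
  \<open>[a,b]\<close> whose value at \<open>x \<in> [a,b]\<close> is \<open>c\<close>. This is how the Neumann conditions on
  \<open>u\<^sub>x\<close>, a priori a class of functions, are understood.\<close>

definition bdry_value :: "real \<Rightarrow> real \<Rightarrow> (real \<Rightarrow> complex) \<Rightarrow> real \<Rightarrow> complex \<Rightarrow> bool" where
  "bdry_value a b g x c \<longleftrightarrow>
     (\<exists>h. continuous_on {a..b} h \<and> ae_eq {a<..<b} g h \<and> h x = c)"

text \<open>Used for \<open>C\<^sup>2\<close> on a finite union of nondegenerate closed intervals, with one-sided
  derivatives at the end points.\<close>

definition C2_on :: "real set \<Rightarrow> (real \<Rightarrow> real) \<Rightarrow> bool" where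
  "C2_on S f \<longleftrightarrow>
     (\<exists>f' f''. (\<forall>x\<in>S. (f has_real_derivative f' x) (at x within S)) \<and>
               (\<forall>x\<in>S. (f' has_real_derivative f'' x) (at x within S)) \<and>
               continuous_on S f'')"

section \<open>Unbounded operators and their spectrum\<close>

text \<open>An operator in a closed subspace \<open>H\<close> of \<open>L\<^sup>2(S)\<close> is given by its graph \<open>G\<close>: a pair
  \<open>(u, w)\<close> in \<open>G\<close> means that \<open>u\<close> lies in the domain and that the operator maps \<open>u\<close> to \<open>w\<close>.
  A number \<open>z\<close> is in the resolvent set iff the operator minus \<open>z\<close> is a bijection from the domain
  onto \<open>H\<close> with bounded inverse; the estimate contains injectivity.\<close>

definition resolvent_set ::
  "real set \<Rightarrow> (real \<Rightarrow> complex) set \<Rightarrow> ((real \<Rightarrow> complex) \<times> (real \<Rightarrow> complex)) set \<Rightarrow> complex set"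
where
  "resolvent_set S H G =
     {z. (\<forall>f\<in>H. \<exists>(u, w)\<in>G. ae_eq S (\<lambda>x. w x - z * u x) f) \<and>
         (\<exists>C. \<forall>(u, w)\<in>G. L2norm S u \<le> C * L2norm S (\<lambda>x. w x - z * u x))}"

definition op_spectrum ::
  "real set \<Rightarrow> (real \<Rightarrow> complex) set \<Rightarrow> ((real \<Rightarrow> complex) \<times> (real \<Rightarrow> complex)) set \<Rightarrow> complex set"
where
  "op_spectrum S H G = - resolvent_set S H G"

definition eigenspace ::
  "real set \<Rightarrow> ((real \<Rightarrow> complex) \<times> (real \<Rightarrow> complex)) set \<Rightarrow> complex \<Rightarrow> (real \<Rightarrow> complex) set"
where
  "eigenspace S G z = {u. \<exists>w. (u, w) \<in> G \<and> ae_eq S w (\<lambda>x. z * u x)}"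

text \<open>Dimension as a subspace of \<open>L\<^sup>2(S)\<close>, i.e. modulo equality almost everywhere.\<close>

definition has_dimension :: "real set \<Rightarrow> (real \<Rightarrow> complex) set \<Rightarrow> nat \<Rightarrow> bool" where
  "has_dimension S E n \<longleftrightarrow>
     (\<exists>e. (\<forall>j<n. e j \<in> E) \<and>
          (\<forall>c. ae_eq S (\<lambda>x. \<Sum>j<n. c j * e j x) (\<lambda>x. 0) \<longrightarrow> (\<forall>j<n. c j = 0)) \<and>
          (\<forall>u\<in>E. \<exists>c. ae_eq S u (\<lambda>x. \<Sum>j<n. c j * e j x)))"

text \<open>\<open>\<mu>\<close> lists the spectrum in nondecreasing order, each point being repeated as often as its
  multiplicity, the dimension of its eigenspace. This is only used for self-adjoint operators,
  for which geometric and algebraic multiplicities agree.\<close>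

definition enumerates_spectrum ::
  "real set \<Rightarrow> (real \<Rightarrow> complex) set \<Rightarrow> ((real \<Rightarrow> complex) \<times> (real \<Rightarrow> complex)) set
     \<Rightarrow> (nat \<Rightarrow> real) \<Rightarrow> bool"
where
  "enumerates_spectrum S H G \<mu> \<longleftrightarrow>
     mono \<mu> \<and>
     op_spectrum S H G = range (\<lambda>i. complex_of_real (\<mu> i)) \<and>
     (\<forall>z \<in> op_spectrum S H G.
        finite {i. complex_of_real (\<mu> i) = z} \<and>
        has_dimension S (eigenspace S G z) (card {i. complex_of_real (\<mu> i) = z}))"

section \<open>The operators\<close>

abbreviation I01 :: "real set" where
  "I01 \<equiv> {0<..<1}"

definition Omega0 :: "real \<Rightarrow> real \<Rightarrow> real set" where
  "Omega0 x1 x2 = {x1<..<x2}"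

definition Omega1 :: "real \<Rightarrow> real \<Rightarrow> real set" where
  "Omega1 x1 x2 = {0..x1} \<union> {x2..1}"

definition L2_Omega0 :: "real \<Rightarrow> real \<Rightarrow> (real \<Rightarrow> complex) set" where
  "L2_Omega0 x1 x2 = {u \<in> L2 I01. \<exists>c. ae_eq (Omega0 x1 x2) u (\<lambda>x. c)}"

definition H1_Omega0 :: "real \<Rightarrow> real \<Rightarrow> (real \<Rightarrow> complex) set" where
  "H1_Omega0 x1 x2 =
     {u \<in> H1 I01. \<exists>g\<in>L2 I01. weak_deriv I01 u g \<and> ae_eq (Omega0 x1 x2) g (\<lambda>x. 0)}"

text \<open>In the next two definitions \<open>g\<close> is \<open>u\<^sub>x\<close> and \<open>w\<close> is \<open>(p u\<^sub>x)\<^sub>x\<close>.\<close>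

definition graph_A ::
  "(real \<Rightarrow> real) \<Rightarrow> real \<Rightarrow> ((real \<Rightarrow> complex) \<times> (real \<Rightarrow> complex)) set" where
  "graph_A p lam =
     {(u, f). u \<in> H2 I01 \<and> f \<in> L2 I01 \<and>
        (\<exists>g\<in>L2 I01. weak_deriv I01 u g \<and> bdry_value 0 1 g 0 0 \<and> bdry_value 0 1 g 1 0 \<and>
           (\<exists>w\<in>L2 I01. weak_deriv I01 (\<lambda>x. of_real (p x) * g x) w \<and>
              ae_eq I01 f (\<lambda>x. - w x + of_real lam * u x)))}"

text \<open>In the limit operator, \<open>(p\<^sub>0 u\<^sub>x)\<^sub>x\<close> is the weak derivative in the interior of \<open>\<Omega>\<^sub>1\<close>,
  so that no transmission condition at \<open>x\<^sub>1\<close>, \<open>x\<^sub>2\<close> is imposed on the flux \<open>p\<^sub>0 u\<^sub>x\<close>;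
  \<open>c\<close> is the constant value of \<open>u\<close> in \<open>\<Omega>\<^sub>0\<close>.\<close>

definition graph_A0 ::
  "real \<Rightarrow> real \<Rightarrow> (real \<Rightarrow> real) \<Rightarrow> real \<Rightarrow> ((real \<Rightarrow> complex) \<times> (real \<Rightarrow> complex)) set" where
  "graph_A0 x1 x2 p0 lam =
     {(u, f). u \<in> H1_Omega0 x1 x2 \<and> f \<in> L2_Omega0 x1 x2 \<and>
        (\<exists>g\<in>L2 I01. weak_deriv I01 u g \<and> bdry_value 0 x1 g 0 0 \<and> bdry_value x2 1 g 1 0 \<and>
           (\<exists>w\<in>L2 (Omega1 x1 x2).
              weak_deriv (interior (Omega1 x1 x2)) (\<lambda>x. of_real (p0 x) * g x) w \<and>
              (\<exists>c. ae_eq (Omega0 x1 x2) u (\<lambda>x. c) \<and>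
                 ae_eq I01 f
                   (\<lambda>x. (- w x + of_real lam * u x) * indicator (Omega1 x1 x2) x
                        + of_real lam * c * indicator (Omega0 x1 x2) x))))}"

text \<open>The spectrum of the operator with parameter \<open>\<epsilon>\<close>, for a family \<open>p\<close> of coefficients
  whose member \<open>p 0\<close> is the limit coefficient.\<close>

definition sigma_A ::
  "real \<Rightarrow> real \<Rightarrow> (real \<Rightarrow> real \<Rightarrow> real) \<Rightarrow> real \<Rightarrow> real \<Rightarrow> complex set" where
  "sigma_A x1 x2 p lam \<epsilon> =
     (if \<epsilon> = 0 then op_spectrum I01 (L2_Omega0 x1 x2) (graph_A0 x1 x2 (p 0) lam)
      else op_spectrum I01 (L2 I01) (graph_A (p \<epsilon>) lam))"

end

theory Submission
  imports Defs "HOL-Probability.Sinc_Integral"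
begin

text \<open>Put \<open>a = 1 / p\<close> and \<open>\<kappa> = z - lam\<close>. In one dimension the eigenvalue equation is the system
  \<open>u' = a v\<close>, \<open>v' = - \<kappa> u\<close> for \<open>u\<close> and its flux \<open>v = p u'\<close>, and the Neumann condition at 0
  leaves one solution up to a factor, the shooting solution with \<open>u 0 = 1\<close>, \<open>v 0 = 0\<close>. A number
  \<open>z\<close> lies in the spectrum iff the flux of the shooting solution vanishes at 1
  (\<open>spectrum_iff_shoots\<close>): otherwise a multiple of the shooting solution corrects any solution of
  the inhomogeneous equation, with a bound from Gronwall's inequality. Since an eigenfunction
  is a multiple of the shooting solution, eigenvalues are simple, and Green's formula gives \<open>\<kappa> \<ge> 0\<close>. Passing between this classical system and the weak
  formulation of the operator needs two facts about weak derivatives on \<open>(0, 1)\<close>: a function with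
  an integrable weak derivative is a primitive of it (\<open>weak_deriv_imp_primitive\<close>), and a primitive
  times a \<open>C\<^sup>1\<close> function obeys the product rule (\<open>weak_deriv_mult_primitive\<close>).

  For the gap, write \<open>\<kappa> = k\<^sup>2\<close>, \<open>u = R cos \<theta>\<close>, \<open>v = - k sqrt p R sin \<theta>\<close>. The angle \<open>\<theta>\<close> solves a
  first order equation in which \<open>k\<close> enters only through the forcing term \<open>k / sqrt p\<close>, so that its
  final value is a bi-Lipschitz function of \<open>k \<ge> 0\<close> onto \<open>[0, \<infinity>)\<close> (\<open>angle_bi_lipschitz\<close>). The
  eigenvalues are the \<open>lam + k\<^sub>n\<^sup>2\<close> at which the final angle is \<open>n pi\<close>. Consecutive \<open>k\<^sub>n\<close> are at
  least a fixed distance apart, and squaring makes the gaps tend to infinity.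

  For the rate, take eigenvalues \<open>lam + \<kappa>\<close> and \<open>lam + \<mu>\<close> of two of the operators, with shooting
  solutions \<open>(u, v)\<close> and \<open>(U, V)\<close> and with \<open>a\<close>, \<open>b\<close> the reciprocals of the coefficients. Green's
  formula gives \<open>(\<kappa> - \<mu>) \<integral> u cnj U = \<integral> (b - a) v cnj V\<close>. Since \<open>a\<close> and \<open>b\<close> are bounded by
  \<open>1 / m0\<close>, the fluxes are bounded, and the integral on the left stays away from zero as long as
  the two problems are close. So \<open>\<bar>\<kappa> - \<mu>\<bar>\<close> is at most a constant times the \<open>L\<^sup>1\<close> norm of \<open>a - b\<close>
  (\<open>eigenvalue_stability\<close>). For the parameters \<open>\<epsilon>\<close> and \<open>\<epsilon>'\<close> this norm is bounded by a constant
  times the sum of the distances of \<open>p \<epsilon>\<close> and \<open>p \<epsilon>'\<close> to \<open>p 0\<close> on \<open>\<Omega>\<^sub>1\<close> and of \<open>\<epsilon> + \<epsilon>'\<close>, because the reciprocals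
  are small in the mean on \<open>\<Omega>\<^sub>0\<close> (\<open>integral_reciprocal_difference\<close>). Letting \<open>\<epsilon>'\<close> tend to 0
  compares \<open>l \<epsilon>\<close> with the limit \<open>l 0\<close>. The estimate obtained has exponent 1, which for small
  arguments is stronger than the exponent \<open>1/2\<close>.\<close>

section \<open>Ordinary differential equations on the unit interval\<close>

text \<open>Picard iteration contracts by the factor \<open>1/2\<close> for the weighted norm
  \<open>sup \<bar>exp (- 2 L x) y x\<bar>\<close>, so a single fixed point step covers the whole interval.
  Working with \<open>w x = exp (- 2 L x) y x\<close> turns the weighted norm into the plain one.\<close>

lemma lipschitz_ode_exists:
  fixes f :: "real \<Rightarrow> 'a::banach \<Rightarrow> 'a"
  assumes cont: "continuous_on ({0..1} \<times> UNIV) (\<lambda>(t, y). f t y)"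
    and lip: "\<And>t y z. t \<in> {0..1} \<Longrightarrow> norm (f t y - f t z) \<le> L * norm (y - z)"
    and L: "0 < L"
  obtains y where "y 0 = y0"
    and "\<And>t. t \<in> {0..1} \<Longrightarrow> (y has_vector_derivative f t (y t)) (at t within {0..1})"
proof -
  define h where "h w t = f t (exp (2 * L * t) *\<^sub>R w t)" for w t
  define S where "S w x = exp (- 2 * L * x) *\<^sub>R (y0 + integral {0..x} (h w))" for w x
  have hc: "continuous_on {0..1} (h w)" if "continuous_on {0..1} w" for w :: "real \<Rightarrow> 'a"
    unfolding h_def
    by (rule continuous_on_compose2[OF cont, of _ "\<lambda>t. (t, exp (2 * L * t) *\<^sub>R w t)", simplified])
      (auto intro!: continuous_intros that)
  have Sc: "continuous_on {0..1} (S w)" if "continuous_on {0..1} w" for w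
    unfolding S_def
    by (intro continuous_intros indefinite_integral_continuous_1 integrable_continuous_real hc that)
  have "\<exists>g::real \<Rightarrow>\<^sub>C 'a. \<forall>x. apply_bcontfun g x = S (apply_bcontfun w) (clamp 0 1 x)" for w
    using continuous_on_cbox_bcontfunE[of 0 1 "S (apply_bcontfun w)"] Sc[of "apply_bcontfun w"]
    by (metis box_real(2) continuous_on_apply_bcontfun)
  then obtain T :: "(real \<Rightarrow>\<^sub>C 'a) \<Rightarrow> (real \<Rightarrow>\<^sub>C 'a)"
    where T: "\<And>w x. apply_bcontfun (T w) x = S (apply_bcontfun w) (clamp 0 1 x)"
    by metis
  have contr: "dist (S (apply_bcontfun v) x) (S (apply_bcontfun w) x) \<le> 1/2 * dist v w"
    if x: "x \<in> {0..1}" for v w x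
  proof -
    let ?d = "dist v w"
    have i: "h (apply_bcontfun u) integrable_on {0..x}" for u
      by (rule integrable_continuous_real, rule continuous_on_subset[OF hc]) (use x in auto)
    have e: "((\<lambda>t. L * exp (2 * L * t) * ?d) has_integral
          (exp (2*L*x) / 2 * ?d - exp (2*L*0) / 2 * ?d)) {0..x}"
      using x L
      by (intro fundamental_theorem_of_calculus)
        (auto simp: has_real_derivative_iff_has_vector_derivative[symmetric]
          intro!: derivative_eq_intros)
    have "norm (integral {0..x} (\<lambda>t. h (apply_bcontfun v) t - h (apply_bcontfun w) t))
        \<le> integral {0..x} (\<lambda>t. L * exp (2 * L * t) * ?d)"
    proof (rule integral_norm_bound_integral)
      fix t assume t: "t \<in> {0..x}"
      have "norm (h (apply_bcontfun v) t - h (apply_bcontfun w) t)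
          \<le> L * norm (exp (2*L*t) *\<^sub>R apply_bcontfun v t - exp (2*L*t) *\<^sub>R apply_bcontfun w t)"
        unfolding h_def by (rule lip) (use t x in auto)
      also have "\<dots> = L * (exp (2*L*t) * dist (apply_bcontfun v t) (apply_bcontfun w t))"
        by (simp add: dist_norm flip: scaleR_diff_right)
      also have "\<dots> \<le> L * (exp (2*L*t) * ?d)"
        using L dist_bounded[of v t w] by (intro mult_left_mono) auto
      finally show "norm (h (apply_bcontfun v) t - h (apply_bcontfun w) t)
          \<le> L * exp (2 * L * t) * ?d" by simp
    qed (use i e in \<open>auto intro: integrable_diff\<close>)
    also have "\<dots> = exp (2*L*x) / 2 * ?d - 1 / 2 * ?d"
      using integral_unique[OF e] by (simp only: mult_zero_right exp_zero)
    also have "\<dots> \<le> exp (2*L*x) / 2 * ?d" by simp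
    finally have le: "norm (integral {0..x} (h (apply_bcontfun v)) - integral {0..x} (h (apply_bcontfun w)))
        \<le> exp (2*L*x) / 2 * ?d"
      by (subst (asm) integral_diff) (use i in auto)
    have "dist (S (apply_bcontfun v) x) (S (apply_bcontfun w) x) = exp (- 2 * L * x) *
       norm (integral {0..x} (h (apply_bcontfun v)) - integral {0..x} (h (apply_bcontfun w)))"
      by (simp add: S_def dist_norm flip: scaleR_diff_right)
    also have "\<dots> \<le> exp (- 2 * L * x) * (exp (2*L*x) / 2 * ?d)"
      by (intro mult_left_mono le) auto
    also have "\<dots> = 1/2 * ?d" by (simp add: exp_minus field_simps)
    finally show ?thesis .
  qed
  have "\<exists>!w. T w = w"
  proof (rule banach_fix_type[of "1/2"])
    show "\<forall>v w. dist (T v) (T w) \<le> 1/2 * dist v w"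
    proof (intro allI dist_bound)
      fix v w x
      have "clamp 0 1 x \<in> cbox 0 (1::real)" by (rule clamp_in_interval) auto
      then show "dist (apply_bcontfun (T v) x) (apply_bcontfun (T w) x) \<le> 1/2 * dist v w"
        unfolding T by (intro contr) auto
    qed
  qed auto
  then obtain w where w: "T w = w" by blast
  define y where "y x = exp (2 * L * x) *\<^sub>R apply_bcontfun w x" for x
  have y: "y x = y0 + integral {0..x} (\<lambda>t. f t (y t))" if "x \<in> {0..1}" for x
  proof -
    have "apply_bcontfun w x = S (apply_bcontfun w) x"
      using T[of w x] w that by simp
    then have "y x = exp (2*L*x) *\<^sub>R (exp (- 2*L*x) *\<^sub>R (y0 + integral {0..x} (h (apply_bcontfun w))))"
      by (simp add: y_def S_def)
    then show ?thesis
      by (simp add: h_def[abs_def] y_def[abs_def] exp_minus)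
  qed
  have yc: "continuous_on {0..1} (\<lambda>t. f t (y t))"
    using hc[of "apply_bcontfun w"] by (simp add: h_def[abs_def] y_def[abs_def])
  show thesis
  proof (rule that[of y])
    show "y 0 = y0" using y[of 0] by simp
    fix t :: real assume t: "t \<in> {0..1}"
    have "((\<lambda>x. y0 + integral {0..x} (\<lambda>t. f t (y t))) has_vector_derivative f t (y t))
        (at t within {0..1})"
      by (auto intro!: derivative_eq_intros integral_has_vector_derivative[OF yc t])
    then show "(y has_vector_derivative f t (y t)) (at t within {0..1})"
      by (rule has_vector_derivative_transform[OF t, rotated]) (simp add: y)
  qed
qed

lemma norm_increment_le_integral:
  fixes d :: "real \<Rightarrow> 'a::banach"
  assumes d: "\<And>t. t \<in> {0..1} \<Longrightarrow> (d has_vector_derivative d' t) (at t within {0..1})"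
    and b: "\<And>t. t \<in> {0..1} \<Longrightarrow> norm (d' t) \<le> g t" and g: "g integrable_on {0..1}"
    and x: "x \<in> {0..1}"
  shows "norm (d x - d 0) \<le> integral {0..x} g"
proof -
  have i: "(d' has_integral (d x - d 0)) {0..x}"
    using x by (intro fundamental_theorem_of_calculus)
      (auto intro: has_vector_derivative_within_subset[OF d])
  have "norm (integral {0..x} d') \<le> integral {0..x} g"
    using x b i by (intro integral_norm_bound_integral integrable_subinterval_real[OF g]) auto
  then show ?thesis using i by (simp add: integral_unique)
qed

text \<open>Gronwall's inequality, stated for the derivative so that it applies directly to a solution or
  to the difference of two solutions. It is the source of uniqueness, of the bound on the
  resolvent and of the dependence of solutions on the coefficient.\<close>

lemma gronwall:
  fixes d :: "real \<Rightarrow> 'a::banach"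
  assumes d: "\<And>t. t \<in> {0..1} \<Longrightarrow> (d has_vector_derivative d' t) (at t within {0..1})"
    and b: "\<And>t. t \<in> {0..1} \<Longrightarrow> norm (d' t) \<le> L * norm (d t) + r t"
    and r: "r integrable_on {0..1}" "\<And>t. t \<in> {0..1} \<Longrightarrow> 0 \<le> r t"
    and L: "0 \<le> L" and x: "x \<in> {0..1}"
  shows "norm (d x) \<le> (norm (d 0) + integral {0..1} r) * exp L"
proof -
  define c where "c = norm (d 0) + integral {0..1} r"
  define I where "I x = integral {0..x} (\<lambda>t. norm (d t))" for x
  have c0: "0 \<le> c" unfolding c_def by (intro add_nonneg_nonneg integral_nonneg r) auto
  have dc: "continuous_on {0..1} d"
    by (rule continuous_on_vector_derivative[OF d])
  have ndc: "continuous_on {0..1} (\<lambda>t. norm (d t))"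
    by (intro continuous_intros dc)
  have le: "norm (d x) \<le> c + L * I x" if x: "x \<in> {0..1}" for x
  proof -
    have i1: "(\<lambda>t. norm (d t)) integrable_on {0..x}"
      using x by (intro integrable_continuous_real continuous_on_subset[OF ndc]) auto
    have i2: "r integrable_on {0..x}"
      using x by (intro integrable_subinterval_real[OF r(1)]) auto
    have "norm (d x) \<le> norm (d 0) + norm (d x - d 0)"
      by (metis add.commute norm_triangle_sub)
    also have "norm (d x - d 0) \<le> integral {0..x} (\<lambda>t. L * norm (d t) + r t)"
      by (rule norm_increment_le_integral[OF d b _ x])
        (assumption | intro integrable_add integrable_on_mult_right r(1) integrable_continuous_real[OF ndc])+
    also have "integral {0..x} (\<lambda>t. L * norm (d t) + r t) = L * I x + integral {0..x} r"
      unfolding I_def using i1 i2 by (subst integral_add) (auto intro: integrable_on_mult_right)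
    also have "integral {0..x} r \<le> integral {0..1} r"
      using x r(2) by (intro integral_subset_le i2 r(1)) auto
    finally show ?thesis by (simp add: c_def)
  qed
  have I': "(I has_real_derivative norm (d t)) (at t within {0..1})" if "t \<in> {0..1}" for t
    unfolding I_def has_real_derivative_iff_has_vector_derivative
    by (rule integral_has_vector_derivative[OF ndc that])
  \<comment> \<open>the bound for \<open>norm (d t)\<close> times the integrating factor; it decreases by \<open>le\<close>\<close>
  define P where "P t = exp (- L * t) * (c + L * I t)" for t
  have P': "(P has_real_derivative exp (- L * t) * L * (norm (d t) - (c + L * I t))) (at t within {0..1})"
    if "t \<in> {0..1}" for t
    unfolding P_def by (rule derivative_eq_intros I' that refl | (simp add: algebra_simps))+
  have "P x \<le> P 0"
  proof (rule DERIV_nonpos_imp_decreasing_open[where a=0 and b=x and f=P])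
    fix t assume t: "0 < t" "t < x"
    then have "(P has_real_derivative exp (- L * t) * L * (norm (d t) - (c + L * I t))) (at t)"
      using P'[of t] x at_within_Icc_at[of 0 t 1] by simp
    moreover have "exp (- L * t) * L * (norm (d t) - (c + L * I t)) \<le> 0"
      using le[of t] t x L by (intro mult_nonneg_nonpos) auto
    ultimately show "\<exists>y. (P has_real_derivative y) (at t) \<and> y \<le> 0" by blast
  next
    show "continuous_on {0..x} P"
      by (rule continuous_on_subset[OF DERIV_continuous_on[OF P']]) (use x in auto)
  qed (use x in auto)
  then have "c + L * I x \<le> c * exp (L * x)"
    by (simp add: P_def I_def exp_minus field_simps)
  also have "\<dots> \<le> c * exp L"
    using x L c0 mult_left_mono[of x 1 L] by (intro mult_left_mono) auto
  finally show ?thesis using le[OF x] by (simp add: c_def)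
qed

section \<open>Smooth bump functions\<close>

text \<open>The derivatives of \<open>exp (- c / ((x - a) (b - x)))\<close>, cut off outside \<open>(a, b)\<close>, are all of this
  form, which is what makes the induction on the order of the derivative work.\<close>

definition bump_term :: "real \<Rightarrow> real \<Rightarrow> real \<Rightarrow> real poly \<Rightarrow> nat \<Rightarrow> real \<Rightarrow> real" where
  "bump_term c a b P m x =
     (if a < x \<and> x < b
      then poly P x / ((x - a) * (b - x)) ^ m * exp (- c / ((x - a) * (b - x))) else 0)"

abbreviation bump :: "real \<Rightarrow> real \<Rightarrow> real \<Rightarrow> real \<Rightarrow> real" where
  "bump c a b \<equiv> bump_term c a b 1 0"

lemma power_le_fact_exp: "t ^ n \<le> fact n * exp (t::real)" if "0 \<le> t"
proof -
  have "sum (\<lambda>k. t ^ k /\<^sub>R fact k) {n} \<le> (\<Sum>k. t ^ k /\<^sub>R fact k)"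
    by (rule sum_le_suminf[OF summable_exp_generic]) (use that in auto)
  then show ?thesis
    by (simp add: exp_def field_simps)
qed

lemma has_derivative_0_of_quadratic_bound:
  fixes f :: "real \<Rightarrow> real"
  assumes "f x = 0" and b: "\<And>y. \<bar>f y\<bar> \<le> C * (y - x)\<^sup>2"
  shows "(f has_real_derivative 0) (at x)"
proof -
  have "((\<lambda>y. f y / (y - x)) \<longlongrightarrow> 0) (at x)"
  proof (rule Lim_null_comparison)
    have "norm (f y / (y - x)) \<le> C * \<bar>y - x\<bar>" if "y \<noteq> x" for y
      using b[of y] that by (simp add: divide_le_eq power2_eq_square abs_mult_self_eq mult.assoc)
    then show "\<forall>\<^sub>F y in at x. norm (f y / (y - x)) \<le> C * \<bar>y - x\<bar>"
      by (simp add: eventually_at_filter)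
    show "((\<lambda>y. C * \<bar>y - x\<bar>) \<longlongrightarrow> 0) (at x)"
      by (auto intro!: tendsto_eq_intros)
  qed
  then show ?thesis
    using assms(1) by (simp add: has_field_derivative_iff)
qed

text \<open>The exponential beats every negative power of \<open>q = (y - a) (b - y)\<close>: estimating it by
  \<open>q ^ (m + 2)\<close> cancels the denominator \<open>q ^ m\<close> and leaves a factor \<open>q\<^sup>2\<close>, hence quadratic
  vanishing at the end points.\<close>

lemma bump_term_flat_outside:
  assumes c: "0 < c" and x: "\<not> (a < x \<and> x < b)"
  shows "(bump_term c a b P m has_real_derivative 0) (at x)"
proof -
  have "bounded (poly P ` {a..b})"
    by (intro compact_imp_bounded compact_continuous_image continuous_intros) auto
  then obtain B where B: "\<And>y. y \<in> {a..b} \<Longrightarrow> \<bar>poly P y\<bar> \<le> B"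
    unfolding bounded_iff by (metis image_eqI real_norm_def)
  define C where "C = B * fact (m + 2) / c ^ (m + 2) * (b - a)\<^sup>2"
  show ?thesis
  proof (rule has_derivative_0_of_quadratic_bound[where C = "\<bar>C\<bar>"])
    show "bump_term c a b P m x = 0" using x by (auto simp: bump_term_def)
    fix y
    show "\<bar>bump_term c a b P m y\<bar> \<le> \<bar>C\<bar> * (y - x)\<^sup>2"
    proof (cases "a < y \<and> y < b")
      case False
      then show ?thesis by (auto simp: bump_term_def)
    next
      case y: True
      define q where "q = (y - a) * (b - y)"
      have q: "0 < q" using y by (simp add: q_def)
      have B0: "0 \<le> B" using B[of y] y by auto
      have "(c / q) ^ (m + 2) \<le> fact (m + 2) * exp (c / q)"
        by (rule power_le_fact_exp) (use c q in auto)
      then have e: "exp (- (c / q)) \<le> fact (m + 2) * q ^ (m + 2) / c ^ (m + 2)"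
        using c q by (simp add: exp_minus field_simps)
      have "\<bar>bump_term c a b P m y\<bar> = \<bar>poly P y\<bar> / q ^ m * exp (- (c / q))"
        using y q by (simp add: bump_term_def q_def abs_mult)
      also have "\<dots> \<le> B / q ^ m * (fact (m + 2) * q ^ (m + 2) / c ^ (m + 2))"
        using B[of y] y q B0 by (intro mult_mono divide_right_mono e) auto
      also have "\<dots> = B * fact (m + 2) / c ^ (m + 2) * q\<^sup>2"
        using q by (simp add: power_add power2_eq_square)
      also have "q \<le> (b - a) * \<bar>y - x\<bar>"
      proof (cases "x \<le> a")
        case True
        have "(y - a) * (b - y) \<le> \<bar>y - x\<bar> * (b - a)"
          using True y by (intro mult_mono) auto
        then show ?thesis by (simp add: q_def mult.commute)
      next
        case False
        have "(y - a) * (b - y) \<le> (b - a) * \<bar>y - x\<bar>"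
          using False x y by (intro mult_mono) auto
        then show ?thesis by (simp add: q_def)
      qed
      then have "q\<^sup>2 \<le> (b - a)\<^sup>2 * (y - x)\<^sup>2"
        using q power_mono[of q "(b - a) * \<bar>y - x\<bar>" 2] by (simp add: power_mult_distrib)
      then have "B * fact (m + 2) / c ^ (m + 2) * q\<^sup>2 \<le> C * (y - x)\<^sup>2"
        unfolding C_def mult.assoc using B0 c
        by (intro mult_left_mono) (auto simp: mult.assoc)
      also have "\<dots> \<le> \<bar>C\<bar> * (y - x)\<^sup>2" by (intro mult_right_mono) auto
      finally show ?thesis by simp
    qed
  qed
qed

lemma bump_term_deriv:
  assumes c: "0 < c"
  obtains P' where
    "\<And>x. (bump_term c a b P m has_real_derivative bump_term c a b P' (m + 2) x) (at x)"
proof -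
  define Q :: "real poly" where "Q = [:- a, 1:] * [:b, - 1:]"
  have Q: "poly Q x = (x - a) * (b - x)" for x
    by (simp add: Q_def algebra_simps)
  define P' where "P' = pderiv P * Q\<^sup>2 - smult (of_nat m) (P * pderiv Q * Q) + smult c (P * pderiv Q)"
  have "(bump_term c a b P m has_real_derivative bump_term c a b P' (m + 2) x) (at x)" for x
  proof (cases "a < x \<and> x < b")
    case x: True
    have q: "poly Q x > 0" using x by (simp add: Q)
    have "((\<lambda>x. poly P x * inverse (poly Q x) ^ m * exp (- c * inverse (poly Q x))) has_real_derivative
       poly P' x * inverse (poly Q x) ^ (m + 2) * exp (- c * inverse (poly Q x))) (at x)"
    proof (rule DERIV_cong)
      have r: "((\<lambda>x. inverse (poly Q x)) has_real_derivative
          - (poly (pderiv Q) x * (inverse (poly Q x))\<^sup>2)) (at x)"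
        using DERIV_inverse_fun[OF poly_DERIV[of Q x]] q by (simp add: power2_eq_square)
      show "((\<lambda>x. poly P x * inverse (poly Q x) ^ m * exp (- c * inverse (poly Q x))) has_real_derivative
          (poly P x * inverse (poly Q x) ^ m) *
            (exp (- c * inverse (poly Q x)) * (- c * - (poly (pderiv Q) x * (inverse (poly Q x))\<^sup>2))) +
          (poly P x * (of_nat m * inverse (poly Q x) ^ (m - 1) * - (poly (pderiv Q) x * (inverse (poly Q x))\<^sup>2)) +
           poly (pderiv P) x * inverse (poly Q x) ^ m) * exp (- c * inverse (poly Q x))) (at x)"
        by (rule DERIV_mult'[OF DERIV_mult'[OF poly_DERIV DERIV_power[OF r, THEN DERIV_cong]]
              DERIV_fun_exp[OF DERIV_cmult[OF r]]])
          (simp add: algebra_simps)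
      show "(poly P x * inverse (poly Q x) ^ m) *
            (exp (- c * inverse (poly Q x)) * (- c * - (poly (pderiv Q) x * (inverse (poly Q x))\<^sup>2))) +
          (poly P x * (of_nat m * inverse (poly Q x) ^ (m - 1) * - (poly (pderiv Q) x * (inverse (poly Q x))\<^sup>2)) +
           poly (pderiv P) x * inverse (poly Q x) ^ m) * exp (- c * inverse (poly Q x)) =
          poly P' x * inverse (poly Q x) ^ (m + 2) * exp (- c * inverse (poly Q x))"
      proof -
        define r where "r = inverse (poly Q x)"
        define q where "q = poly Q x"
        have qr: "q * r = 1" using q by (simp add: r_def q_def)
        have 1: "q\<^sup>2 * r ^ (m + 2) = r ^ m"
          using qr by (metis mult.left_commute mult.right_neutral power_add power_mult_distrib power_one)
        have 2: "of_nat m * (q * r ^ (m + 2)) = of_nat m * (r ^ (m - 1) * r\<^sup>2)"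
        proof (cases m)
          case (Suc k)
          have "q * r ^ (m + 2) = (q * r) * (r ^ (m - 1) * r\<^sup>2)"
            by (simp add: Suc power2_eq_square)
          then show ?thesis using qr by simp
        qed auto
        have eq: "poly P' x * r ^ (m + 2) = poly (pderiv P) x * (q\<^sup>2 * r ^ (m + 2))
            - poly P x * poly (pderiv Q) x * (of_nat m * (q * r ^ (m + 2)))
            + c * poly P x * poly (pderiv Q) x * (r ^ m * r\<^sup>2)"
          by (simp add: P'_def q_def algebra_simps power_add power2_eq_square)
        show ?thesis
          unfolding r_def[symmetric] eq 1 2 by (simp add: algebra_simps)
      qed
    qed
    moreover have "bump_term c a b P m y = poly P y * inverse (poly Q y) ^ m * exp (- c * inverse (poly Q y))"
      if "y \<in> {a<..<b}" for P m y
      using that by (simp add: bump_term_def Q field_simps power_inverse)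
    ultimately show ?thesis
      using x by (subst DERIV_cong_ev[OF refl _ refl]) 
        (auto intro!: eventually_nhds_in_open[THEN eventually_mono, of "{a<..<b}"])
  next
    case False
    then show ?thesis
      using bump_term_flat_outside[OF c False, of P m] by (auto simp: bump_term_def)
  qed
  then show thesis by (rule that)
qed

lemma bump_term_higher_deriv:
  assumes "0 < c"
  shows "\<exists>P' m'. (deriv ^^ n) (bump_term c a b P m) = bump_term c a b P' m'"
proof (induction n)
  case 0
  then show ?case by auto
next
  case (Suc n)
  then obtain P' m' where *: "(deriv ^^ n) (bump_term c a b P m) = bump_term c a b P' m'" by blast
  obtain P'' where
    "\<And>x. (bump_term c a b P' m' has_real_derivative bump_term c a b P'' (m' + 2) x) (at x)"
    using bump_term_deriv[OF assms] by blast
  then have "deriv (bump_term c a b P' m') = bump_term c a b P'' (m' + 2)"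
    by (auto intro!: DERIV_imp_deriv)
  then show ?case using * by auto
qed

lemma bump_smooth:
  assumes "0 < c"
  shows "(deriv ^^ n) (bump c a b) field_differentiable (at x)"
  by (metis bump_term_higher_deriv[OF assms] bump_term_deriv[OF assms] field_differentiable_def)

lemma bump_bounds: "0 < c \<Longrightarrow> 0 \<le> bump c a b x" "0 < c \<Longrightarrow> bump c a b x \<le> 1"
  by (auto simp: bump_term_def)

lemma bump_continuous: "0 < c \<Longrightarrow> continuous_on S (bump c a b)"
  using bump_smooth[of c 0 a b] 
  by (auto intro!: continuous_at_imp_continuous_on field_differentiable_imp_continuous_at)

lemma bump_tendsto_indicator:
  "(\<lambda>n. bump (1 / Suc n) a b x) \<longlonglongrightarrow> indicator {a<..<b} x"
proof (cases "a < x \<and> x < b")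
  case True
  have "(\<lambda>n. exp (- (1 / real (Suc n)) / ((x - a) * (b - x)))) \<longlonglongrightarrow> exp (- 0 / ((x - a) * (b - x)))"
    by (intro tendsto_intros LIMSEQ_Suc[OF lim_1_over_n]) (use True in auto)
  then show ?thesis using True by (simp add: bump_term_def)
qed (auto simp: bump_term_def)

lemma higher_deriv_linear_combination:
  fixes f g :: "real \<Rightarrow> real"
  assumes "\<And>n x. (deriv ^^ n) f field_differentiable (at x)"
    and "\<And>n x. (deriv ^^ n) g field_differentiable (at x)"
  shows "(deriv ^^ n) (\<lambda>x. r * f x + s * g x) = (\<lambda>x. r * (deriv ^^ n) f x + s * (deriv ^^ n) g x)"
proof (induction n)
  case (Suc n)
  have "((\<lambda>x. r * (deriv ^^ n) f x + s * (deriv ^^ n) g x) has_real_derivative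
      r * deriv ((deriv ^^ n) f) x + s * deriv ((deriv ^^ n) g) x) (at x)" for x
    by (rule derivative_eq_intros refl assms[of n x, THEN field_differentiable_derivI])+ simp
  then show ?case using Suc by (auto intro!: DERIV_imp_deriv)
qed auto

text \<open>A test function whose derivative is a combination of two bumps: the weights make the total
  integral vanish, which is what gives the primitive a compact support.\<close>

lemma test_function_with_bump_derivative:
  assumes c: "0 < c" and ab: "0 < a" "a < b" "b < 1" and ab': "0 < a'" "a' < b'" "b' < 1"
  obtains \<phi> where "test_function I01 \<phi>"
    "deriv \<phi> = (\<lambda>x. integral {0..1} (bump c a' b') * bump c a b x
                   - integral {0..1} (bump c a b) * bump c a' b' x)"
proof -
  define r s where "r = integral {0..1} (bump c a' b')" and "s = integral {0..1} (bump c a b)"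
  define \<psi> where "\<psi> x = r * bump c a b x + (- s) * bump c a' b' x" for x
  define \<phi> where "\<phi> x = integral {0..x} \<psi>" for x
  have \<psi>c: "continuous_on S \<psi>" for S
    unfolding \<psi>_def by (intro continuous_intros bump_continuous c)
  have \<psi>0: "\<psi> x = 0" if "x \<le> min a a' \<or> max b b' \<le> x" for x
    using that by (auto simp: \<psi>_def bump_term_def)
  have \<phi>0: "\<phi> x = 0" if x: "x \<le> min a a'" for x
  proof -
    have "\<phi> x = integral {0..x} (\<lambda>_. 0)"
      unfolding \<phi>_def by (rule integral_cong) (use \<psi>0 x in auto)
    then show ?thesis by simp
  qed
  have \<phi>1: "\<phi> x = 0" if x: "max b b' \<le> x" for x
  proof -
    have bi: "bump c u v integrable_on {0..1}" for u v
      by (intro integrable_continuous_real bump_continuous c)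
    have 1: "integral {0..1} \<psi> = 0"
      using has_integral_add[OF has_integral_mult_right[OF integrable_integral[OF bi[of a b]], of r]
          has_integral_mult_right[OF integrable_integral[OF bi[of a' b']], of "- s"]]
      by (simp add: \<psi>_def[abs_def] integral_unique r_def s_def)
    have *: "integral {0..y} \<psi> = integral {0..max b b'} \<psi>" if "max b b' \<le> y" for y
    proof -
      have "integral {max b b'..y} \<psi> = integral {max b b'..y} (\<lambda>_. 0)"
        by (rule integral_cong) (use \<psi>0 in auto)
      moreover have "integral {0..max b b'} \<psi> + integral {max b b'..y} \<psi> = integral {0..y} \<psi>"
        by (rule Henstock_Kurzweil_Integration.integral_combine)
           (use that ab ab' \<psi>c in \<open>auto intro: integrable_continuous_real\<close>)
      ultimately show ?thesis by simp
    qed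
    show ?thesis unfolding \<phi>_def using *[OF x] *[of 1] 1 ab ab' by simp
  qed
  have D: "(\<phi> has_real_derivative \<psi> x) (at x)" for x
  proof (cases "x < min a a'")
    case True
    have "((\<lambda>_. 0) has_real_derivative \<psi> x) (at x)"
      using \<psi>0[of x] True by simp
    then show ?thesis
      by (rule has_field_derivative_transform_within_open[where S="{..<min a a'}"])
        (use True \<phi>0 in auto)
  next
    case False
    then have x: "x \<in> {0<..<x+1}" using ab ab' by auto
    have "(\<phi> has_real_derivative \<psi> x) (at x within {0..x+1})"
      unfolding \<phi>_def has_real_derivative_iff_has_vector_derivative
      by (rule integral_has_vector_derivative[OF \<psi>c]) (use x in auto)
    then show ?thesis using x at_within_Icc_at[of 0 x "x+1"] by simp
  qed
  have d: "deriv \<phi> = \<psi>" using D by (auto intro!: DERIV_imp_deriv)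
  show thesis
  proof (rule that[of \<phi>])
    show "test_function I01 \<phi>"
      unfolding test_function_def
    proof (intro conjI exI[of _ "{min a a'..max b b'}"] allI)
      fix n x
      show "(deriv ^^ n) \<phi> field_differentiable (at x)"
      proof (cases n)
        case 0
        then show ?thesis using D by (auto simp: field_differentiable_def)
      next
        case (Suc k)
        have "(deriv ^^ n) \<phi> = (deriv ^^ k) \<psi>"
          using d by (simp add: Suc funpow_swap1)
        moreover have "(deriv ^^ k) \<psi> =
            (\<lambda>x. r * (deriv ^^ k) (bump c a b) x + (- s) * (deriv ^^ k) (bump c a' b') x)"
          unfolding \<psi>_def[abs_def] by (rule higher_deriv_linear_combination) (intro bump_smooth c)+
        moreover have "(\<lambda>x. r * (deriv ^^ k) (bump c a b) x + (- s) * (deriv ^^ k) (bump c a' b') x)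
            field_differentiable (at x)"
          by (intro field_differentiable_add field_differentiable_mult
              field_differentiable_const bump_smooth c)
        ultimately show ?thesis by simp
      qed
    qed (use ab ab' \<phi>0 \<phi>1 in \<open>force simp: not_le\<close>)+
    show "deriv \<phi> = (\<lambda>x. integral {0..1} (bump c a' b') * bump c a b x
                   - integral {0..1} (bump c a b) * bump c a' b' x)"
      by (simp add: d \<psi>_def r_def s_def fun_eq_iff)
  qed
qed

section \<open>Weak derivatives on the unit interval and primitives\<close>

lemma I01_lmeasurable: "I01 \<in> lmeasurable"
  by simp

interpretation I01: finite_measure "lebesgue_on I01"
  by (rule finite_measure_lebesgue_on[OF I01_lmeasurable])

lemma integrable_I01_continuous:
  fixes f :: "real \<Rightarrow> 'b::euclidean_space"
  assumes "continuous_on {0..1} f"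
  shows "integrable (lebesgue_on I01) f"
proof -
  have "f absolutely_integrable_on {0<..<1}"
    using absolutely_integrable_continuous_real[OF assms] absolutely_integrable_on_Icc_iff_Ioo by blast
  then show ?thesis
    by (rule absolutely_integrable_imp_integrable) auto
qed

lemma measurable_I01_continuous:
  fixes f :: "real \<Rightarrow> 'b::euclidean_space"
  assumes "continuous_on {0..1} f"
  shows "f \<in> borel_measurable (lebesgue_on I01)"
  using integrable_I01_continuous[OF assms] by auto

lemma integrable_I01_mult_continuous:
  fixes q h :: "real \<Rightarrow> complex"
  assumes q: "continuous_on {0..1} q" and h: "integrable (lebesgue_on I01) h"
  shows "integrable (lebesgue_on I01) (\<lambda>x. q x * h x)"
proof -
  have "bounded (q ` {0..1})"
    by (intro compact_imp_bounded compact_continuous_image q) auto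
  then obtain B where B: "\<And>x. x \<in> {0..1} \<Longrightarrow> norm (q x) \<le> B"
    unfolding bounded_iff by blast
  show ?thesis
  proof (rule Bochner_Integration.integrable_bound[where f = "\<lambda>x. B * norm (h x)"])
    show "AE x in lebesgue_on I01. norm (q x * h x) \<le> norm (B * norm (h x))"
    proof (rule AE_I2)
      fix x assume "x \<in> space (lebesgue_on I01)"
      then have "norm (q x) * norm (h x) \<le> B * norm (h x)"
        using B[of x] by (intro mult_right_mono) auto
      then show "norm (q x * h x) \<le> norm (B * norm (h x))"
        by (simp add: norm_mult)
    qed
    show "(\<lambda>x. q x * h x) \<in> borel_measurable (lebesgue_on I01)"
      using h measurable_I01_continuous[OF q] by measurable
  qed (use h in auto)
qed

lemma L2_I01_integrable:
  assumes "u \<in> L2 I01" shows "integrable (lebesgue_on I01) u"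
proof (rule Bochner_Integration.integrable_bound[where f = "\<lambda>x. 1 + (cmod (u x))\<^sup>2"])
  have "cmod (u x) \<le> 1 + (cmod (u x))\<^sup>2" for x
    using zero_le_power2[of "cmod (u x) - 1/2"] by (simp add: power2_eq_square algebra_simps)
  then show "AE x in lebesgue_on I01. norm (u x) \<le> norm (1 + (cmod (u x))\<^sup>2)"
    by (intro AE_I2) simp
qed (use assms in \<open>auto simp: L2_def\<close>)

lemma L2_I01_continuous: "continuous_on {0..1} u \<Longrightarrow> u \<in> L2 I01"
  by (auto simp: L2_def measurable_I01_continuous intro!: integrable_I01_continuous continuous_intros)

lemma L2_I01_mult_continuous:
  assumes q: "continuous_on {0..1} q" and h: "h \<in> L2 I01"
  shows "(\<lambda>x. q x * h x) \<in> L2 I01"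
proof -
  have "integrable (lebesgue_on I01)
      (\<lambda>x. complex_of_real ((cmod (q x))\<^sup>2) * complex_of_real ((cmod (h x))\<^sup>2))"
    by (rule integrable_I01_mult_continuous)
      (use h in \<open>auto simp: L2_def complex_of_real_integrable_eq simp del: of_real_power
        intro!: continuous_intros q\<close>)
  then have "integrable (lebesgue_on I01) (\<lambda>x. complex_of_real ((cmod (q x * h x))\<^sup>2))"
    by (simp add: norm_mult power_mult_distrib)
  then have "integrable (lebesgue_on I01) (\<lambda>x. (cmod (q x * h x))\<^sup>2)"
    by (rule complex_of_real_integrable_eq[THEN iffD1])
  then show ?thesis
    using h measurable_I01_continuous[OF q] by (auto simp: L2_def)
qed

lemma L2_add:
  assumes "u \<in> L2 S" "v \<in> L2 S" shows "(\<lambda>x. u x + v x) \<in> L2 S"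
proof -
  have m: "u \<in> borel_measurable (lebesgue_on S)" "v \<in> borel_measurable (lebesgue_on S)"
    using assms by (auto simp: L2_def)
  have "integrable (lebesgue_on S) (\<lambda>x. (cmod (u x + v x))\<^sup>2)"
  proof (rule Bochner_Integration.integrable_bound[where f = "\<lambda>x. 2 * (cmod (u x))\<^sup>2 + 2 * (cmod (v x))\<^sup>2"])
    have "(cmod (u x + v x))\<^sup>2 \<le> 2 * (cmod (u x))\<^sup>2 + 2 * (cmod (v x))\<^sup>2" for x
    proof -
      have "(cmod (u x + v x))\<^sup>2 \<le> (cmod (u x) + cmod (v x))\<^sup>2"
        by (intro power_mono norm_triangle_ineq) auto
      also have "\<dots> \<le> 2 * (cmod (u x))\<^sup>2 + 2 * (cmod (v x))\<^sup>2"
        using zero_le_power2[of "cmod (u x) - cmod (v x)"]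
        by (simp add: power2_eq_square algebra_simps)
      finally show ?thesis .
    qed
    then show "AE x in lebesgue_on S. norm ((cmod (u x + v x))\<^sup>2) \<le>
        norm (2 * (cmod (u x))\<^sup>2 + 2 * (cmod (v x))\<^sup>2)"
      by (intro AE_I2) simp
  qed (use assms m in \<open>auto simp: L2_def\<close>)
  then show ?thesis using m by (auto simp: L2_def)
qed

lemma integrable_I01_imp_integrable_on:
  fixes h :: "real \<Rightarrow> 'b::euclidean_space"
  assumes "integrable (lebesgue_on I01) h"
  shows "h integrable_on {0..1}"
  using integrable_on_lebesgue_on[OF assms] by (simp add: integrable_on_Icc_iff_Ioo)

lemma integral_I01_eq:
  fixes h :: "real \<Rightarrow> 'b::euclidean_space"
  assumes "integrable (lebesgue_on I01) h"
  shows "integral\<^sup>L (lebesgue_on I01) h = integral {0..1} h"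
  using lebesgue_integral_eq_integral[OF assms] by (simp add: integral_open_interval_real)

lemma integrable_I01_indicator:
  fixes h :: "real \<Rightarrow> 'b::euclidean_space"
  assumes "integrable (lebesgue_on I01) h" and A: "A \<in> sets borel"
  shows "integrable (lebesgue_on I01) (\<lambda>t. indicator A t *\<^sub>R h t)"
proof -
  have "A \<inter> I01 \<in> sets (lebesgue_on I01)"
    using A by (auto simp: sets_restrict_space)
  from integrable_mult_indicator[OF this assms(1)] show ?thesis
    by (rule Bochner_Integration.integrable_cong[THEN iffD1, rotated 2]) (auto simp: indicator_def)
qed

lemma primitive_eq_lebesgue:
  fixes h :: "real \<Rightarrow> 'b::euclidean_space"
  assumes h: "integrable (lebesgue_on I01) h" and x: "x \<in> {0..1}"
  shows "integral {0..x} h = (\<integral>t. indicator {..x} t *\<^sub>R h t \<partial>lebesgue_on I01)"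
proof -
  have "integrable (lebesgue_on I01) (\<lambda>t. indicator {..x} t *\<^sub>R h t)"
    by (intro integrable_I01_indicator h) auto
  then have "(\<integral>t. indicator {..x} t *\<^sub>R h t \<partial>lebesgue_on I01) = integral {0..1} (\<lambda>t. indicator {..x} t *\<^sub>R h t)"
    by (rule integral_I01_eq)
  also have "\<dots> = integral {0..1} (\<lambda>t. if t \<in> {0..x} then h t else 0)"
    by (rule integral_cong) auto
  also have "\<dots> = integral {0..x} h"
    using x by (subst Henstock_Kurzweil_Integration.integral_restrict_Int) (simp add: Int_absorb2 min_absorb2)
  finally show ?thesis ..
qed

lemma primitive_continuous:
  fixes h :: "real \<Rightarrow> 'b::euclidean_space"
  assumes "integrable (lebesgue_on I01) h"
  shows "continuous_on {0..1} (\<lambda>x. integral {0..x} h)"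
  by (intro indefinite_integral_continuous_1 integrable_I01_imp_integrable_on assms)

text \<open>A primitive of a merely integrable function is not differentiable everywhere, so integration
  by parts is replaced by Fubini's theorem on the triangle \<open>t \<le> x\<close>.\<close>

lemma primitive_by_parts:
  fixes h \<psi> \<psi>' :: "real \<Rightarrow> complex"
  assumes h: "integrable (lebesgue_on I01) h" and c: "continuous_on {0..1} \<psi>'"
    and d: "\<And>t. t \<in> {0..1} \<Longrightarrow> (\<psi> has_vector_derivative \<psi>' t) (at t within {0..1})"
  shows "(\<integral>x. integral {0..x} h * \<psi>' x \<partial>lebesgue_on I01) = (\<integral>t. h t * (\<psi> 1 - \<psi> t) \<partial>lebesgue_on I01)"
proof -
  let ?M = "lebesgue_on I01"
  interpret P: pair_sigma_finite ?M ?M ..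
  have c': "integrable ?M \<psi>'" by (rule integrable_I01_continuous[OF c])
  have [measurable]: "h \<in> borel_measurable ?M" "\<psi>' \<in> borel_measurable ?M"
    using h c' by auto
  have [measurable]: "(\<lambda>x. x) \<in> ?M \<rightarrow>\<^sub>M borel"
    by (rule measurable_I01_continuous) (rule continuous_on_id)
  define f where "f t x = indicator {t..} x *\<^sub>R (h t * \<psi>' x)" for t x
  have "integrable (?M \<Otimes>\<^sub>M ?M) (\<lambda>z. h (fst z) * \<psi>' (snd z))"
  proof (rule P.Fubini_integrable)
    show "integrable ?M (\<lambda>x. \<integral>y. norm (h (fst (x, y)) * \<psi>' (snd (x, y))) \<partial>?M)"
      using h by (simp add: norm_mult)
    show "AE x in ?M. integrable ?M (\<lambda>y. h (fst (x, y)) * \<psi>' (snd (x, y)))"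
      using c' by simp
  qed measurable
  then have "integrable (?M \<Otimes>\<^sub>M ?M) (case_prod f)"
  proof (rule Bochner_Integration.integrable_bound)
    have "case_prod f = (\<lambda>z. if fst z \<le> snd z then h (fst z) * \<psi>' (snd z) else 0)"
      by (auto simp: f_def fun_eq_iff)
    then show "case_prod f \<in> borel_measurable (?M \<Otimes>\<^sub>M ?M)"
      by simp
  qed (auto simp: f_def indicator_def)
  from P.Fubini_integral[OF this]
  have "(\<integral>x. (\<integral>t. f t x \<partial>?M) \<partial>?M) = (\<integral>t. (\<integral>x. f t x \<partial>?M) \<partial>?M)" .
  note swap = this
  have 1: "(\<integral>t. f t x \<partial>?M) = integral {0..x} h * \<psi>' x" if "x \<in> space ?M" for x
  proof -
    have "(\<integral>t. f t x \<partial>?M) = (\<integral>t. (indicator {..x} t *\<^sub>R h t) * \<psi>' x \<partial>?M)"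
      by (rule Bochner_Integration.integral_cong) (auto simp: f_def indicator_def)
    also have "\<dots> = (\<integral>t. indicator {..x} t *\<^sub>R h t \<partial>?M) * \<psi>' x"
      by (rule integral_mult_left_zero)
    finally show ?thesis using that primitive_eq_lebesgue[OF h, of x] by simp
  qed
  have 2: "(\<integral>x. f t x \<partial>?M) = h t * (\<psi> 1 - \<psi> t)" if t: "t \<in> space ?M" for t
  proof -
    have i: "(\<psi>' has_integral (\<psi> 1 - \<psi> t)) {t..1}"
      using t by (intro fundamental_theorem_of_calculus)
        (auto intro: has_vector_derivative_within_subset[OF d])
    have "integrable ?M (\<lambda>x. indicator {t..} x *\<^sub>R \<psi>' x)"
      by (intro integrable_I01_indicator c') auto
    then have "(\<integral>x. indicator {t..} x *\<^sub>R \<psi>' x \<partial>?M) = integral {0..1} (\<lambda>x. indicator {t..} x *\<^sub>R \<psi>' x)"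
      by (rule integral_I01_eq)
    also have "\<dots> = integral {0..1} (\<lambda>x. if x \<in> {t..1} then \<psi>' x else 0)"
      by (rule integral_cong) auto
    also have "\<dots> = integral {t..1} \<psi>'"
      using t by (subst Henstock_Kurzweil_Integration.integral_restrict_Int) (simp add: Int_absorb2 max_absorb2)
    also have "\<dots> = \<psi> 1 - \<psi> t" using i by (rule integral_unique)
    finally have *: "(\<integral>x. indicator {t..} x *\<^sub>R \<psi>' x \<partial>?M) = \<psi> 1 - \<psi> t" .
    have "(\<integral>x. f t x \<partial>?M) = (\<integral>x. h t * (indicator {t..} x *\<^sub>R \<psi>' x) \<partial>?M)"
      by (rule Bochner_Integration.integral_cong) (auto simp: f_def)
    also have "\<dots> = h t * (\<integral>x. indicator {t..} x *\<^sub>R \<psi>' x \<partial>?M)"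
      by (rule integral_mult_right_zero)
    also note *
    finally show ?thesis .
  qed
  have "(\<integral>x. integral {0..x} h * \<psi>' x \<partial>?M) = (\<integral>x. (\<integral>t. f t x \<partial>?M) \<partial>?M)"
    by (rule Bochner_Integration.integral_cong) (simp_all only: 1)
  also note swap
  also have "(\<integral>t. (\<integral>x. f t x \<partial>?M) \<partial>?M) = (\<integral>t. h t * (\<psi> 1 - \<psi> t) \<partial>?M)"
    by (rule Bochner_Integration.integral_cong) (simp_all only: 2)
  finally show ?thesis .
qed

lemma test_function_smooth:
  assumes "test_function S \<phi>"
  shows "(\<phi> has_real_derivative deriv \<phi> x) (at x)" "continuous_on A (deriv \<phi>)" "continuous_on A \<phi>"
proof -
  have 0: "\<phi> field_differentiable at x" for x
    using assms spec[of _ 0] unfolding test_function_def by (metis funpow_0)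
  have 1: "deriv \<phi> field_differentiable at x" for x
    using assms unfolding test_function_def by (metis funpow_0 funpow.simps(2) o_apply)
  show "(\<phi> has_real_derivative deriv \<phi> x) (at x)"
    using 0 field_differentiable_derivI by blast
  show "continuous_on A (deriv \<phi>)" "continuous_on A \<phi>"
    using 0 1 by (auto intro!: continuous_at_imp_continuous_on field_differentiable_imp_continuous_at)
qed

lemma test_function_outside: "test_function S \<phi> \<Longrightarrow> x \<notin> S \<Longrightarrow> \<phi> x = 0"
  by (auto simp: test_function_def)

text \<open>The product rule for an absolutely continuous function and a \<open>C\<^sup>1\<close> function:
  the factor \<open>q\<close> is moved to the test function.\<close>

lemma weak_deriv_mult_primitive:
  fixes q q' :: "real \<Rightarrow> real" and h :: "real \<Rightarrow> complex" and c :: complex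
  assumes h: "integrable (lebesgue_on I01) h" and q'c: "continuous_on {0..1} q'"
    and q: "\<And>t. t \<in> {0..1} \<Longrightarrow> (q has_real_derivative q' t) (at t within {0..1})"
  defines "G \<equiv> \<lambda>x. c + integral {0..x} h"
  shows "weak_deriv I01 (\<lambda>x. of_real (q x) * G x) (\<lambda>x. of_real (q x) * h x + of_real (q' x) * G x)"
  unfolding weak_deriv_def
proof (intro allI impI)
  fix \<phi> assume \<phi>: "test_function I01 \<phi>"
  let ?M = "lebesgue_on I01"
  note \<phi>s = test_function_smooth[OF \<phi>]
  have \<phi>01: "\<phi> 0 = 0" "\<phi> 1 = 0" using test_function_outside[OF \<phi>] by auto
  have qc: "continuous_on {0..1} q" by (rule DERIV_continuous_on[OF q])
  have Gc: "continuous_on {0..1} G"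
    unfolding G_def by (intro continuous_intros primitive_continuous h)
  define \<psi> :: "real \<Rightarrow> complex" where "\<psi> x = of_real (q x * \<phi> x)" for x
  define \<psi>' :: "real \<Rightarrow> complex" where "\<psi>' x = of_real (q x * deriv \<phi> x + q' x * \<phi> x)" for x
  have \<psi>': "(\<psi> has_vector_derivative \<psi>' t) (at t within {0..1})" if "t \<in> {0..1}" for t
    unfolding \<psi>_def \<psi>'_def
    by (intro has_vector_derivative_of_real)
      (use DERIV_mult'[OF q[OF that] DERIV_subset[OF \<phi>s(1)[of t] subset_UNIV]]
        in \<open>simp add: has_real_derivative_iff_has_vector_derivative algebra_simps\<close>)
  have \<psi>'c: "continuous_on {0..1} \<psi>'"
    unfolding \<psi>'_def by (intro continuous_intros qc q'c \<phi>s)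
  have "(\<psi>' has_integral (\<psi> 1 - \<psi> 0)) {0..1}"
    by (intro fundamental_theorem_of_calculus \<psi>') auto
  then have \<psi>'0: "(\<integral>x. c * \<psi>' x \<partial>?M) = 0"
    using integral_I01_eq[OF integrable_I01_continuous[OF \<psi>'c]]
    by (simp add: integral_unique \<psi>_def \<phi>01)
  have i1: "integrable ?M (\<lambda>x. integral {0..x} h * \<psi>' x)"
    by (intro integrable_I01_continuous continuous_intros primitive_continuous h \<psi>'c)
  have "(\<integral>x. G x * \<psi>' x \<partial>?M) = (\<integral>x. c * \<psi>' x \<partial>?M) + (\<integral>x. integral {0..x} h * \<psi>' x \<partial>?M)"
    unfolding G_def distrib_right
    by (intro Bochner_Integration.integral_add i1 integrable_I01_continuous continuous_intros \<psi>'c)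
  also have "\<dots> = (\<integral>t. h t * (\<psi> 1 - \<psi> t) \<partial>?M)"
    unfolding \<psi>'0 using primitive_by_parts[OF h \<psi>'c \<psi>'] by simp
  also have "\<dots> = - (\<integral>x. of_real (q x) * h x * of_real (\<phi> x) \<partial>?M)"
    by (simp add: \<psi>_def \<phi>01 mult_ac flip: Bochner_Integration.integral_minus)
  finally have 1: "(\<integral>x. G x * \<psi>' x \<partial>?M) = - (\<integral>x. of_real (q x) * h x * of_real (\<phi> x) \<partial>?M)" .
  have i2: "integrable ?M (\<lambda>x. of_real (q x * deriv \<phi> x) * G x)"
    by (intro integrable_I01_continuous continuous_intros Gc qc \<phi>s)
  have i3: "integrable ?M (\<lambda>x. of_real (q' x * \<phi> x) * G x)"
    by (intro integrable_I01_continuous continuous_intros Gc q'c \<phi>s)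
  have i4: "integrable ?M (\<lambda>x. of_real (q x * \<phi> x) * h x)"
    by (intro integrable_I01_mult_continuous h continuous_intros qc \<phi>s)
  have "(\<integral>x. of_real (q x) * G x * of_real (deriv \<phi> x) \<partial>?M) + (\<integral>x. of_real (q' x * \<phi> x) * G x \<partial>?M)
      = (\<integral>x. of_real (q x * deriv \<phi> x) * G x + of_real (q' x * \<phi> x) * G x \<partial>?M)"
    by (subst Bochner_Integration.integral_add[OF i2 i3]) (simp add: mult_ac)
  also have "\<dots> = (\<integral>x. G x * \<psi>' x \<partial>?M)"
    by (simp add: \<psi>'_def algebra_simps)
  finally have 2: "(\<integral>x. of_real (q x) * G x * of_real (deriv \<phi> x) \<partial>?M)
      = (\<integral>x. G x * \<psi>' x \<partial>?M) - (\<integral>x. of_real (q' x * \<phi> x) * G x \<partial>?M)"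
    by (simp only: eq_diff_eq)
  have "(\<integral>x. (of_real (q x) * h x + of_real (q' x) * G x) * of_real (\<phi> x) \<partial>?M)
      = (\<integral>x. of_real (q x * \<phi> x) * h x + of_real (q' x * \<phi> x) * G x \<partial>?M)"
    by (simp add: algebra_simps)
  also have "\<dots> = (\<integral>x. of_real (q x * \<phi> x) * h x \<partial>?M) + (\<integral>x. of_real (q' x * \<phi> x) * G x \<partial>?M)"
    by (rule Bochner_Integration.integral_add[OF i4 i3])
  finally show "(\<integral>x. of_real (q x) * G x * of_real (deriv \<phi> x) \<partial>?M) =
      - (\<integral>x. (of_real (q x) * h x + of_real (q' x) * G x) * of_real (\<phi> x) \<partial>?M)"
    using 1 2 by (simp add: mult_ac)
qed


text \<open>Letting the two bumps of a test function grow to indicators shows that all mean values of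
  \<open>d\<close> over subintervals agree; by Lebesgue's differentiation theorem \<open>d\<close> equals their common
  value.\<close>

lemma weak_deriv_zero_imp_const:
  fixes d :: "real \<Rightarrow> complex"
  assumes d: "integrable (lebesgue_on I01) d"
    and w: "\<And>\<phi>. test_function I01 \<phi> \<Longrightarrow> (\<integral>x. d x * of_real (deriv \<phi> x) \<partial>lebesgue_on I01) = 0"
  shows "\<exists>c. AE x in lebesgue_on I01. d x = c"
proof -
  let ?M = "lebesgue_on I01"
  let ?B = "\<lambda>n. bump (1 / Suc n)"
  have dm: "d \<in> borel_measurable ?M" using d by auto
  have ind: "(\<lambda>x. indicator {a<..<b} x :: real) \<in> borel_measurable ?M" for a b
    by (rule borel_measurable_integrable)
      (use integrable_I01_indicator[of "\<lambda>_. 1::real" "{a<..<b}"] in simp)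
  have bm: "(\<lambda>x. ?B n a b x) \<in> borel_measurable ?M" for n a b
    by (intro measurable_I01_continuous bump_continuous) auto
  have lim1: "(\<lambda>n. integral {0..1} (?B n a b)) \<longlonglongrightarrow> b - a" if ab: "0 < a" "a < b" "b < 1" for a b
  proof -
    have "(\<lambda>n. \<integral>x. ?B n a b x \<partial>?M) \<longlonglongrightarrow> (\<integral>x. indicator {a<..<b} x \<partial>?M)"
    proof (rule integral_dominated_convergence[where w = "\<lambda>_. 1"])
      show "AE x in ?M. norm (?B n a b x) \<le> 1" for n
        using bump_bounds[of "1 / Suc n" a b] by (intro AE_I2) (auto simp: abs_le_iff)
      show "AE x in ?M. (\<lambda>n. ?B n a b x) \<longlonglongrightarrow> indicator {a<..<b} x"
        by (intro AE_I2 bump_tendsto_indicator)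
    qed (use bm ind in simp_all)
    moreover have "(\<integral>x. ?B n a b x \<partial>?M) = integral {0..1} (?B n a b)" for n
      by (intro integral_I01_eq integrable_I01_continuous bump_continuous) auto
    moreover have "(\<integral>x. indicator {a<..<b} x \<partial>?M) = b - a"
    proof -
      have "integrable ?M (\<lambda>x. indicator {a<..<b} x :: real)"
        using integrable_I01_indicator[of "\<lambda>_. 1::real" "{a<..<b}"] by simp
      then have "(\<integral>x. indicator {a<..<b} x \<partial>?M) = integral {0..1} (\<lambda>x. indicator {a<..<b} x :: real)"
        by (rule integral_I01_eq)
      also have "\<dots> = integral {0..1} (\<lambda>x. if x \<in> {a<..<b} then 1 else 0)"
        by (rule integral_cong) (auto simp: indicator_def)
      also have "\<dots> = integral {a<..<b} (\<lambda>_. 1)"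
        using ab by (subst Henstock_Kurzweil_Integration.integral_restrict_Int)
          (auto intro!: arg_cong2[where f = integral])
      also have "\<dots> = integral {a..b} (\<lambda>_. 1)"
        by (simp only: integral_open_interval_real)
      also have "\<dots> = b - a" using ab by simp
      finally show ?thesis .
    qed
    ultimately show ?thesis by simp
  qed
  have lim2: "(\<lambda>n. \<integral>x. d x * of_real (?B n a b x) \<partial>?M) \<longlonglongrightarrow> integral {a..b} d"
    if ab: "0 < a" "a < b" "b < 1" for a b
  proof -
    have "(\<lambda>n. \<integral>x. d x * of_real (?B n a b x) \<partial>?M) \<longlonglongrightarrow> (\<integral>x. d x * of_real (indicator {a<..<b} x) \<partial>?M)"
    proof (rule integral_dominated_convergence[where w = "\<lambda>x. norm (d x)"])
      show "AE x in ?M. norm (d x * of_real (?B n a b x)) \<le> norm (d x)" for n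
        using bump_bounds[of "1 / Suc n" a b]
        by (intro AE_I2) (auto simp: norm_mult abs_le_iff intro!: mult_left_le)
      show "AE x in ?M. (\<lambda>n. d x * of_real (?B n a b x)) \<longlonglongrightarrow> d x * of_real (indicator {a<..<b} x)"
        by (intro AE_I2 tendsto_intros bump_tendsto_indicator)
      show "(\<lambda>x. d x * of_real (indicator {a<..<b} x)) \<in> borel_measurable ?M"
        by (intro borel_measurable_times dm measurable_compose[OF ind borel_measurable_of_real])
      show "(\<lambda>x. d x * of_real (?B n a b x)) \<in> borel_measurable ?M" for n
        by (intro borel_measurable_times dm measurable_compose[OF bm borel_measurable_of_real])
    qed (use d in auto)
    moreover have "(\<integral>x. d x * of_real (indicator {a<..<b} x) \<partial>?M) = integral {a..b} d"
    proof -
      have "(\<integral>x. d x * of_real (indicator {a<..<b} x) \<partial>?M) = (\<integral>x. indicator {a<..<b} x *\<^sub>R d x \<partial>?M)"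
        by (rule Bochner_Integration.integral_cong) (auto simp: indicator_def)
      also have "\<dots> = integral {0..1} (\<lambda>x. indicator {a<..<b} x *\<^sub>R d x)"
        by (intro integral_I01_eq integrable_I01_indicator d) auto
      also have "\<dots> = integral {0..1} (\<lambda>x. if x \<in> {a<..<b} then d x else 0)"
        by (rule integral_cong) (auto simp: indicator_def)
      also have "\<dots> = integral {a<..<b} d"
        using ab by (subst Henstock_Kurzweil_Integration.integral_restrict_Int)
          (auto intro!: arg_cong2[where f = integral])
      finally show ?thesis by (simp add: integral_open_interval_real)
    qed
    ultimately show ?thesis by simp
  qed
  have bi: "integrable ?M (\<lambda>x. d x * of_real (?B n a b x))" for n a b
    using integrable_I01_mult_continuous[OF _ d, of "\<lambda>x. of_real (?B n a b x)"]
    by (simp add: mult.commute bump_continuous continuous_on_of_real)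
  have mean: "(b' - a') * integral {a..b} d = (b - a) * integral {a'..b'} d"
    if ab: "0 < a" "a < b" "b < 1" and ab': "0 < a'" "a' < b'" "b' < 1" for a b a' b'
  proof -
    have "of_real (integral {0..1} (?B n a' b')) * (\<integral>x. d x * of_real (?B n a b x) \<partial>?M)
        = of_real (integral {0..1} (?B n a b)) * (\<integral>x. d x * of_real (?B n a' b' x) \<partial>?M)" for n
    proof -
      obtain \<phi> where \<phi>: "test_function I01 \<phi>"
        "deriv \<phi> = (\<lambda>x. integral {0..1} (?B n a' b') * ?B n a b x
                   - integral {0..1} (?B n a b) * ?B n a' b' x)"
        using test_function_with_bump_derivative[OF _ ab ab', of "1 / Suc n"] by auto
      define r s where "r = complex_of_real (integral {0..1} (?B n a' b'))"
        and "s = complex_of_real (integral {0..1} (?B n a b))"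
      have "(\<integral>x. r * (d x * of_real (?B n a b x)) - s * (d x * of_real (?B n a' b' x)) \<partial>?M) = 0"
        using w[OF \<phi>(1)] by (simp add: \<phi>(2) r_def s_def algebra_simps)
      then show ?thesis
        by (subst (asm) Bochner_Integration.integral_diff[OF integrable_mult_right[OF bi]
              integrable_mult_right[OF bi]]) (simp add: r_def s_def)
    qed
    moreover have "(\<lambda>n. of_real (integral {0..1} (?B n a' b')) * (\<integral>x. d x * of_real (?B n a b x) \<partial>?M))
        \<longlonglongrightarrow> of_real (b' - a') * integral {a..b} d"
      by (intro tendsto_intros lim1 lim2 ab ab')
    moreover have "(\<lambda>n. of_real (integral {0..1} (?B n a b)) * (\<integral>x. d x * of_real (?B n a' b' x) \<partial>?M))
        \<longlonglongrightarrow> of_real (b - a) * integral {a'..b'} d"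
      by (intro tendsto_intros lim1 lim2 ab ab')
    ultimately show ?thesis using LIMSEQ_unique by force
  qed
  define K where "K = 4 * integral {1/4..1/2} d"
  have K: "integral {a..b} d = (b - a) *\<^sub>R K" if "0 < a" "a < b" "b < 1" for a b
    using mean[OF that, of "1/4" "1/2"] by (simp add: K_def scaleR_conv_of_real field_simps)
  define d0 where "d0 x = (if x \<in> I01 then d x else 0)" for x
  have "d0 integrable_on UNIV"
    using integrable_I01_imp_integrable_on[OF d] unfolding d0_def[abs_def]
    by (simp only: Henstock_Kurzweil_Integration.integrable_restrict_UNIV integrable_on_Icc_iff_Ioo)
  then have "d0 integrable_on cbox a b" for a b
    by (rule integrable_on_subcbox) auto
  then obtain N where N: "negligible N"
    and lim: "\<And>x e. x \<notin> N \<Longrightarrow> 0 < e \<Longrightarrow> \<exists>\<delta>>0. \<forall>h. 0 < h \<and> h < \<delta> \<longrightarrow>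
        norm (integral (cbox x (x + h *\<^sub>R One)) d0 /\<^sub>R h ^ DIM(real) - d0 x) < e"
    using integrable_ccontinuous_explicit by blast
  have "d x = K" if x: "x \<in> I01" "x \<notin> N" for x
  proof (rule ccontr)
    assume "d x \<noteq> K"
    then obtain \<delta> where \<delta>: "0 < \<delta>" and *: "\<And>h. 0 < h \<Longrightarrow> h < \<delta> \<Longrightarrow>
        norm (integral {x..x + h} d0 /\<^sub>R h - d0 x) < norm (K - d x)"
      using lim[OF x(2), of "norm (K - d x)"] by auto
    define h where "h = min (\<delta> / 2) ((1 - x) / 2)"
    have h: "0 < h" "h < \<delta>" "x + h < 1" using \<delta> x by (auto simp: h_def min_def field_simps)
    have "integral {x..x + h} d0 = integral {x..x + h} d"
      by (rule integral_cong) (use h x in \<open>auto simp: d0_def\<close>)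
    also have "\<dots> = h *\<^sub>R K" using K[of x "x + h"] h x by simp
    finally show False using *[of h] h x by (simp add: d0_def)
  qed
  then have "AE x in ?M. d x = K"
    using negligible_Int[of N I01] N
    by (intro AE_I'[of "N \<inter> I01"]) (auto simp: null_sets_restrict_space negligible_iff_null_sets)
  then show ?thesis by blast
qed

lemma weak_deriv_imp_primitive:
  assumes u: "integrable (lebesgue_on I01) u" and g: "integrable (lebesgue_on I01) g"
    and w: "weak_deriv I01 u g"
  shows "\<exists>c. AE x in lebesgue_on I01. u x = c + integral {0..x} g"
proof -
  let ?M = "lebesgue_on I01"
  have pi: "integrable ?M (\<lambda>x. integral {0..x} g)"
    by (intro integrable_I01_continuous primitive_continuous g)
  have w': "weak_deriv I01 (\<lambda>x. integral {0..x} g) g"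
    using weak_deriv_mult_primitive[OF g, of "\<lambda>_. 0" "\<lambda>_. 1" 0] by simp
  have "\<exists>c. AE x in ?M. u x - integral {0..x} g = c"
  proof (rule weak_deriv_zero_imp_const)
    fix \<phi> assume \<phi>: "test_function I01 \<phi>"
    have "integrable ?M (\<lambda>x. of_real (deriv \<phi> x) * u x)"
      "integrable ?M (\<lambda>x. of_real (deriv \<phi> x) * integral {0..x} g)"
      by (intro integrable_I01_mult_continuous u pi continuous_intros test_function_smooth[OF \<phi>])+
    then show "(\<integral>x. (u x - integral {0..x} g) * of_real (deriv \<phi> x) \<partial>?M) = 0"
      using w w' \<phi> unfolding weak_deriv_def left_diff_distrib
      by (subst Bochner_Integration.integral_diff) (auto simp: mult.commute)
  qed (use u pi in auto)
  then show ?thesis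
    by (auto simp: algebra_simps)
qed

text \<open>Sets of full measure are dense, so closed conditions on continuous functions propagate.\<close>

lemma continuous_AE_closed:
  fixes f :: "real \<Rightarrow> 'b::topological_space"
  assumes f: "continuous_on {a..b} f" and C: "closed C" and ab: "a < b"
    and ae: "AE x in lebesgue_on {a<..<b}. f x \<in> C" and x: "x \<in> {a..b}"
  shows "f x \<in> C"
proof (rule ccontr)
  assume "f x \<notin> C"
  have "openin (top_of_set {a..b}) ({a..b} \<inter> f -` (- C))"
    using f C continuous_openin_preimage_gen by (metis open_Compl)
  then obtain T where T: "open T" "{a..b} \<inter> f -` (- C) = {a..b} \<inter> T"
    by (auto simp: openin_open)
  have "x \<in> closure {a<..<b}" using x ab by simp
  moreover have "x \<in> T" using T x \<open>f x \<notin> C\<close> by blast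
  ultimately have ne: "T \<inter> {a<..<b} \<noteq> {}"
    using T(1) by (metis closure_iff_nhds_not_empty subset_refl Int_commute open_Int_closure_eq_empty disjoint_iff)
  obtain N where N: "N \<in> null_sets (lebesgue_on {a<..<b})" "{y \<in> {a<..<b}. f y \<notin> C} \<subseteq> N"
    using ae by (auto elim!: AE_E simp: null_sets_def)
  have "T \<inter> {a<..<b} \<subseteq> N"
  proof
    fix y assume y: "y \<in> T \<inter> {a<..<b}"
    then have "y \<in> {a..b} \<inter> T" by auto
    then have "f y \<notin> C" unfolding T(2)[symmetric] by blast
    then show "y \<in> N" using N(2) y by blast
  qed
  then have "negligible (T \<inter> {a<..<b})"
    using N(1) negligible_subset by (auto simp: null_sets_restrict_space negligible_iff_null_sets)
  then show False
    using open_not_negligible[OF open_Int[OF T(1) open_greaterThanLessThan] ne] by blast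
qed

section \<open>The first order system\<close>

text \<open>The equation \<open>- (p u')' + lam u - z u = h\<close> with \<open>h\<close> merely square integrable becomes a
  system with continuous coefficients in \<open>u\<close> and \<open>w = p u' + F\<close>, where \<open>F\<close> is the primitive of
  \<open>h\<close>; here \<open>a = 1 / p\<close> and \<open>\<kappa> = z - lam\<close>.\<close>

definition solves ::
  "(real \<Rightarrow> real) \<Rightarrow> complex \<Rightarrow> (real \<Rightarrow> complex) \<Rightarrow> (real \<Rightarrow> complex) \<Rightarrow> (real \<Rightarrow> complex) \<Rightarrow> bool" where
  "solves a \<kappa> F u w \<longleftrightarrow> (\<forall>t\<in>{0..1}.
     (u has_vector_derivative of_real (a t) * (w t - F t)) (at t within {0..1}) \<and>
     (w has_vector_derivative - \<kappa> * u t) (at t within {0..1}))"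

lemma solvesD:
  assumes "solves a \<kappa> F u w" "t \<in> {0..1}"
  shows "(u has_vector_derivative of_real (a t) * (w t - F t)) (at t within {0..1})"
    "(w has_vector_derivative - \<kappa> * u t) (at t within {0..1})"
  using assms by (auto simp: solves_def)

lemma solves_continuous:
  assumes "solves a \<kappa> F u w"
  shows "continuous_on {0..1} u" "continuous_on {0..1} w"
  by (rule continuous_on_vector_derivative, erule solvesD[OF assms])+

lemma norm_system_le:
  fixes u w :: complex
  assumes a: "0 \<le> a" "a \<le> A" and K: "norm \<kappa> \<le> K"
  shows "norm (of_real a * w, - \<kappa> * u) \<le> (A + K) * norm (u, w)"
proof -
  have "norm (of_real a * w, - \<kappa> * u) \<le> norm (of_real a * w) + norm (- \<kappa> * u)"
    by (rule norm_Pair_le)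
  also have "\<dots> \<le> A * norm (u, w) + K * norm (u, w)"
    using a K norm_fst_le[of u w] norm_snd_le[of w u]
    by (auto simp: norm_mult intro!: add_mono mult_mono order_trans[OF norm_ge_zero K])
  finally show ?thesis by (simp add: algebra_simps)
qed

lemma solves_exists:
  assumes a: "continuous_on {0..1} a" and F: "continuous_on {0..1} F"
  obtains u w where "u 0 = u0" "w 0 = w0" "solves a \<kappa> F u w"
proof -
  have "bounded (a ` {0..1})"
    by (intro compact_imp_bounded compact_continuous_image a) auto
  then obtain A where A: "\<And>t. t \<in> {0..1} \<Longrightarrow> \<bar>a t\<bar> \<le> A"
    unfolding bounded_iff by (metis image_eqI real_norm_def)
  define f where "f t y = (of_real (a t) * (snd y - F t), - \<kappa> * fst y)"
    for t and y :: "complex \<times> complex"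
  have c: "continuous_on ({0..1} \<times> UNIV) (\<lambda>(t, y). f t y)"
    unfolding f_def split_def
    by (intro continuous_intros continuous_on_compose2[OF a] continuous_on_compose2[OF F]) auto
  have l: "norm (f t y - f t z) \<le> (A + norm \<kappa> + 1) * norm (y - z)" if "t \<in> {0..1}" for t y z
  proof -
    have "norm (f t y - f t z) =
        norm (of_real (a t) * (snd y - snd z), - \<kappa> * (fst y - fst z))"
      by (simp add: f_def algebra_simps)
    also have "\<dots> = norm (of_real \<bar>a t\<bar> * (snd y - snd z), - \<kappa> * (fst y - fst z))"
      by (simp add: norm_prod_def norm_mult)
    also have "\<dots> \<le> (A + norm \<kappa>) * norm (y - z)"
      using norm_system_le[of "\<bar>a t\<bar>" A \<kappa> "norm \<kappa>" "snd y - snd z" "fst y - fst z"] A[OF that]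
      by (simp add: minus_prod_def)
    also have "\<dots> \<le> (A + norm \<kappa> + 1) * norm (y - z)"
      by (intro mult_right_mono) auto
    finally show ?thesis .
  qed
  have A0: "0 < A + norm \<kappa> + 1"
    using A[of 0] by (simp add: add_nonneg_pos)
  show thesis
  proof (rule lipschitz_ode_exists[OF c l A0, of "(u0, w0)"])
    fix y :: "real \<Rightarrow> complex \<times> complex"
    assume y: "y 0 = (u0, w0)"
      "\<And>t. t \<in> {0..1} \<Longrightarrow> (y has_vector_derivative f t (y t)) (at t within {0..1})"
    have "solves a \<kappa> F (\<lambda>t. fst (y t)) (\<lambda>t. snd (y t))"
      unfolding solves_def
      using bounded_linear.has_vector_derivative[OF bounded_linear_fst y(2)]
        bounded_linear.has_vector_derivative[OF bounded_linear_snd y(2)]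
      by (simp add: f_def)
    then show thesis
      by (intro that[of "\<lambda>t. fst (y t)" "\<lambda>t. snd (y t)"]) (simp_all add: y(1))
  qed
qed

lemma solves_bound:
  assumes s: "solves a \<kappa> F u w"
    and a: "\<And>t. t \<in> {0..1} \<Longrightarrow> 0 \<le> a t" "\<And>t. t \<in> {0..1} \<Longrightarrow> a t \<le> A"
    and K: "norm \<kappa> \<le> K" and F: "\<And>t. t \<in> {0..1} \<Longrightarrow> norm (F t) \<le> B" and x: "x \<in> {0..1}"
  shows "norm (u x) \<le> (norm (u 0) + norm (w 0) + A * B) * exp (A + K)"
    "norm (w x) \<le> (norm (u 0) + norm (w 0) + A * B) * exp (A + K)"
proof -
  have A0: "0 \<le> A" using a[of 0] by simp
  have B0: "0 \<le> B" by (rule order_trans[OF norm_ge_zero F[of 0]]) simp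
  have K0: "0 \<le> K" using K norm_ge_zero[of \<kappa>] by linarith
  have "norm (u x, w x) \<le> (norm (u 0, w 0) + integral {0..1::real} (\<lambda>_. A * B)) * exp (A + K)"
  proof (rule gronwall[where d = "\<lambda>t. (u t, w t)"])
    fix t :: real assume t: "t \<in> {0..1}"
    show "((\<lambda>t. (u t, w t)) has_vector_derivative (of_real (a t) * (w t - F t), - \<kappa> * u t))
        (at t within {0..1})"
      by (intro has_vector_derivative_Pair solvesD[OF s t])
    have "norm (of_real (a t) * (w t - F t), - \<kappa> * u t)
        \<le> norm (of_real (a t) * w t, - \<kappa> * u t) + norm (- of_real (a t) * F t, 0 :: complex)"
      by (rule order_trans[OF _ norm_triangle_ineq]) (simp add: algebra_simps)
    also have "\<dots> \<le> (A + K) * norm (u t, w t) + A * B"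
      using norm_system_le[OF a[OF t] K] a[OF t] F[OF t] A0
      by (intro add_mono) (auto simp: norm_mult intro!: mult_mono)
    finally show "norm (of_real (a t) * (w t - F t), - \<kappa> * u t) \<le> (A + K) * norm (u t, w t) + A * B" .
  qed (use x A0 B0 K0 in auto)
  also have "\<dots> \<le> (norm (u 0) + norm (w 0) + A * B) * exp (A + K)"
    using norm_Pair_le[of "u 0" "w 0"] by (intro mult_right_mono) auto
  finally have "norm (u x, w x) \<le> (norm (u 0) + norm (w 0) + A * B) * exp (A + K)" .
  then show "norm (u x) \<le> (norm (u 0) + norm (w 0) + A * B) * exp (A + K)"
    "norm (w x) \<le> (norm (u 0) + norm (w 0) + A * B) * exp (A + K)"
    using norm_fst_le[of "u x" "w x"] norm_snd_le[of "w x" "u x"] by linarith+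
qed

lemma solves_linear:
  assumes "solves a \<kappa> F u w" "solves a \<kappa> F2 u2 w2"
  shows "solves a \<kappa> (\<lambda>x. F x + c * F2 x) (\<lambda>x. u x + c * u2 x) (\<lambda>x. w x + c * w2 x)"
  unfolding solves_def
proof (intro ballI conjI)
  fix t :: real assume t: "t \<in> {0..1}"
  note 1 = solvesD[OF assms(1) t] and 2 = solvesD[OF assms(2) t]
  show "((\<lambda>x. u x + c * u2 x) has_vector_derivative
      of_real (a t) * (w t + c * w2 t - (F t + c * F2 t))) (at t within {0..1})"
    using has_vector_derivative_add[OF 1(1) has_vector_derivative_mult_right[OF 2(1), of c]]
    by (simp add: algebra_simps)
  show "((\<lambda>x. w x + c * w2 x) has_vector_derivative - \<kappa> * (u t + c * u2 t)) (at t within {0..1})"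
    using has_vector_derivative_add[OF 1(2) has_vector_derivative_mult_right[OF 2(2), of c]]
    by (simp add: algebra_simps)
qed

lemma solves_cong:
  assumes "solves a \<kappa> F u w" "\<And>t. t \<in> {0..1} \<Longrightarrow> F t = F2 t"
  shows "solves a \<kappa> F2 u w"
  using assms by (auto simp: solves_def)

section \<open>The operator and its shooting solutions\<close>

lemma weak_deriv_cong:
  assumes "weak_deriv I01 u g" "\<And>x. x \<in> I01 \<Longrightarrow> u x = u2 x" "\<And>x. x \<in> I01 \<Longrightarrow> g x = g2 x"
  shows "weak_deriv I01 u2 g2"
  unfolding weak_deriv_def
proof (intro allI impI)
  fix \<phi> assume "test_function I01 \<phi>"
  then have "(\<integral>x. u x * of_real (deriv \<phi> x) \<partial>lebesgue_on I01) =
        - (\<integral>x. g x * of_real (\<phi> x) \<partial>lebesgue_on I01)"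
    using assms(1) by (auto simp: weak_deriv_def)
  moreover have "(\<integral>x. u x * of_real (deriv \<phi> x) \<partial>lebesgue_on I01) =
      (\<integral>x. u2 x * of_real (deriv \<phi> x) \<partial>lebesgue_on I01)"
    by (rule Bochner_Integration.integral_cong) (use assms(2) in auto)
  moreover have "(\<integral>x. g x * of_real (\<phi> x) \<partial>lebesgue_on I01) =
      (\<integral>x. g2 x * of_real (\<phi> x) \<partial>lebesgue_on I01)"
    by (rule Bochner_Integration.integral_cong) (use assms(3) in auto)
  ultimately show "(\<integral>x. u2 x * of_real (deriv \<phi> x) \<partial>lebesgue_on I01) =
        - (\<integral>x. g2 x * of_real (\<phi> x) \<partial>lebesgue_on I01)" by simp
qed

lemma primitive_weak_deriv:
  assumes "integrable (lebesgue_on I01) h"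
  shows "weak_deriv I01 (\<lambda>x. c + integral {0..x} h) h"
  using weak_deriv_mult_primitive[OF assms, of "\<lambda>_. 0" "\<lambda>_. 1" c] by simp

lemma primitive_cong_AE:
  fixes f g :: "real \<Rightarrow> complex"
  assumes "integrable (lebesgue_on I01) f" "integrable (lebesgue_on I01) g"
    and ae: "AE x in lebesgue_on I01. f x = g x" and x: "x \<in> {0..1}"
  shows "integral {0..x} f = integral {0..x} g"
proof -
  have "(\<integral>t. indicator {..x} t *\<^sub>R f t \<partial>lebesgue_on I01) = (\<integral>t. indicator {..x} t *\<^sub>R g t \<partial>lebesgue_on I01)"
  proof (rule integral_cong_AE)
    show "(\<lambda>t. indicator {..x} t *\<^sub>R f t) \<in> borel_measurable (lebesgue_on I01)"
      "(\<lambda>t. indicator {..x} t *\<^sub>R g t) \<in> borel_measurable (lebesgue_on I01)"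
      by (intro borel_measurable_integrable integrable_I01_indicator assms; simp)+
  qed (use ae in auto)
  then show ?thesis using primitive_eq_lebesgue assms x by metis
qed

lemma norm_primitive_le_L2norm:
  assumes h: "h \<in> L2 I01" and x: "x \<in> {0..1}"
  shows "norm (integral {0..x} h) \<le> L2norm I01 h"
proof -
  let ?M = "lebesgue_on I01"
  define m where "m = (\<integral>x. norm (h x) \<partial>?M)"
  have hi: "integrable ?M h" by (rule L2_I01_integrable[OF h])
  have h2: "integrable ?M (\<lambda>x. (norm (h x))\<^sup>2)" using h by (simp add: L2_def)
  have M1: "measure ?M (space ?M) = 1"
    by (simp add: measure_restrict_space)
  have "norm (integral {0..x} h) \<le> (\<integral>t. norm (indicator {..x} t *\<^sub>R h t) \<partial>?M)"
    unfolding primitive_eq_lebesgue[OF hi x] by (rule integral_norm_bound)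
  also have "\<dots> \<le> m"
    unfolding m_def
    by (intro integral_mono integrable_norm integrable_I01_indicator hi) (auto simp: indicator_def)
  also have "m \<le> L2norm I01 h"
  proof -
    \<comment> \<open>the variance of \<open>norm \<circ> h\<close> under the uniform distribution is nonnegative\<close>
    have "0 \<le> (\<integral>x. (norm (h x) - m)\<^sup>2 \<partial>?M)" by simp
    also have "\<dots> = (\<integral>x. (norm (h x))\<^sup>2 - 2 * m * norm (h x) + m\<^sup>2 \<partial>?M)"
      by (simp add: power2_diff algebra_simps)
    also have "\<dots> = (\<integral>x. (norm (h x))\<^sup>2 \<partial>?M) - 2 * m * m + m\<^sup>2"
      using h2 hi M1 by (simp add: m_def)
    finally have "m\<^sup>2 \<le> (\<integral>x. (norm (h x))\<^sup>2 \<partial>?M)"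
      by (simp add: power2_eq_square)
    then show ?thesis unfolding L2norm_def by (rule real_le_rsqrt)
  qed
  finally show ?thesis .
qed

lemma L2norm_le_of_bound:
  assumes u: "u \<in> L2 I01" and b: "AE x in lebesgue_on I01. norm (u x) \<le> B" and B: "0 \<le> B"
  shows "L2norm I01 u \<le> B"
proof -
  have "(\<integral>x. (cmod (u x))\<^sup>2 \<partial>lebesgue_on I01) \<le> (\<integral>x. B\<^sup>2 \<partial>lebesgue_on I01)"
  proof (rule integral_mono_AE)
    show "AE x in lebesgue_on I01. (cmod (u x))\<^sup>2 \<le> B\<^sup>2"
      using b by eventually_elim (intro power_mono, auto)
  qed (use u in \<open>auto simp: L2_def\<close>)
  also have "\<dots> = B\<^sup>2" by (simp add: measure_restrict_space)
  finally show ?thesis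
    unfolding L2norm_def using B by (simp add: real_le_lsqrt)
qed

locale diffusion_coefficient =
  fixes p p' :: "real \<Rightarrow> real" and m0 lam :: real
  assumes p': "\<And>t. t \<in> {0..1} \<Longrightarrow> (p has_real_derivative p' t) (at t within {0..1})"
    and p'_continuous: "continuous_on {0..1} p'"
    and m0: "0 < m0" and p_ge: "\<And>t. t \<in> {0..1} \<Longrightarrow> m0 \<le> p t"
begin

definition a where "a t = 1 / p t"

lemma p_pos: "t \<in> {0..1} \<Longrightarrow> 0 < p t" and p_nz: "t \<in> {0..1} \<Longrightarrow> p t \<noteq> 0"
  using p_ge[of t] m0 by auto

lemma p_continuous: "continuous_on {0..1} p"
  by (rule DERIV_continuous_on[OF p'])

lemma a_continuous: "continuous_on {0..1} a"
  unfolding a_def by (intro continuous_intros p_continuous) (auto simp: p_nz)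

lemma a_bounds: "t \<in> {0..1} \<Longrightarrow> 0 \<le> a t" "t \<in> {0..1} \<Longrightarrow> a t \<le> 1 / m0"
  using p_ge[of t] p_pos[of t] m0 by (auto simp: a_def frac_le)

text \<open>The flux \<open>p u\<^sub>x\<close> has a square integrable weak derivative, so it agrees almost everywhere with
  the continuous function \<open>v\<close> below. As \<open>p\<close> is positive and continuous, the continuous
  representative of \<open>u\<^sub>x\<close> vanishes exactly where \<open>v\<close> does, and the Neumann conditions become
  \<open>v 0 = v 1 = 0\<close>, that is \<open>wc 0 = 0\<close> and \<open>wc 1 = F 1\<close>. The point \<open>z\<close> is arbitrary: it only fixes how
  the equation is split into the homogeneous part and the right-hand side \<open>f - z u\<close>.\<close>

lemma graph_imp_solves:
  assumes uf: "(u, f) \<in> graph_A p lam"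
  obtains uc wc where "AE x in lebesgue_on I01. u x = uc x"
    "solves a (z - of_real lam) (\<lambda>x. integral {0..x} (\<lambda>t. f t - z * u t)) uc wc"
    "wc 0 = 0" "wc 1 = integral {0..1} (\<lambda>t. f t - z * u t)"
proof -
  let ?M = "lebesgue_on I01"
  obtain g w where uL: "u \<in> L2 I01" and fL: "f \<in> L2 I01" and gL: "g \<in> L2 I01" and wL: "w \<in> L2 I01"
    and ug: "weak_deriv I01 u g" and pgw: "weak_deriv I01 (\<lambda>x. of_real (p x) * g x) w"
    and b0: "bdry_value 0 1 g 0 0" and b1: "bdry_value 0 1 g 1 0"
    and fw: "AE x in ?M. f x = - w x + of_real lam * u x"
    using uf by (auto simp: graph_A_def H2_def ae_eq_def)
  note ui = L2_I01_integrable[OF uL] and fi = L2_I01_integrable[OF fL]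
    and gi = L2_I01_integrable[OF gL] and wi = L2_I01_integrable[OF wL]
  have pgi: "integrable ?M (\<lambda>x. of_real (p x) * g x)"
    by (intro integrable_I01_mult_continuous gi continuous_intros p_continuous)
  obtain c1 where c1: "AE x in ?M. u x = c1 + integral {0..x} g"
    using weak_deriv_imp_primitive[OF ui gi ug] by blast
  obtain c2 where c2: "AE x in ?M. of_real (p x) * g x = c2 + integral {0..x} w"
    using weak_deriv_imp_primitive[OF pgi wi pgw] by blast
  define v where "v x = c2 + integral {0..x} w" for x
  have vc: "continuous_on {0..1} v"
    unfolding v_def by (intro continuous_intros primitive_continuous wi)
  have v_bdry: "v x = 0" if b: "bdry_value 0 1 g x 0" and x: "x \<in> {0..1}" for x
  proof -
    obtain h where h: "continuous_on {0..1} h" "AE x in ?M. g x = h x" "h x = 0"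
      using b by (auto simp: bdry_value_def ae_eq_def)
    have "of_real (p x) * h x - v x \<in> {0}"
    proof (rule continuous_AE_closed[where a = 0 and b = 1 and f = "\<lambda>x. of_real (p x) * h x - v x"])
      show "AE x in ?M. of_real (p x) * h x - v x \<in> {0}"
        using h(2) c2 by eventually_elim (simp add: v_def)
    qed (use x in \<open>auto intro!: continuous_intros p_continuous h vc\<close>)
    then show ?thesis using h(3) by simp
  qed
  have v0: "v 0 = 0" and v1: "v 1 = 0"
    using v_bdry[OF b0] v_bdry[OF b1] by auto
  then have c20: "c2 = 0" by (simp add: v_def)
  define uc where "uc x = c1 + integral {0..x} g" for x
  have uuc: "AE x in ?M. u x = uc x" using c1 by (simp add: uc_def)
  have ucc: "continuous_on {0..1} uc"
    unfolding uc_def by (intro continuous_intros primitive_continuous gi)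
  have avc: "continuous_on {0..1} (\<lambda>x. of_real (a x) * v x)"
    by (intro continuous_intros a_continuous vc)
  have "AE x in ?M. g x = of_real (a x) * v x"
    using c2 AE_space
  proof eventually_elim
    case (elim x)
    then show ?case using p_nz[of x] by (auto simp: a_def v_def[symmetric] field_simps)
  qed
  then have uc_eq: "uc x = c1 + integral {0..x} (\<lambda>x. of_real (a x) * v x)" if "x \<in> {0..1}" for x
    unfolding uc_def using primitive_cong_AE[OF gi integrable_I01_continuous[OF avc] _ that] by simp
  have uc': "(uc has_vector_derivative of_real (a t) * v t) (at t within {0..1})" if t: "t \<in> {0..1}" for t
  proof (rule has_vector_derivative_transform[OF t uc_eq])
    show "((\<lambda>x. c1 + integral {0..x} (\<lambda>x. of_real (a x) * v x)) has_vector_derivative of_real (a t) * v t)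
        (at t within {0..1})"
      by (auto intro!: derivative_eq_intros integral_has_vector_derivative[OF avc t])
  qed
  let ?\<kappa> = "z - of_real lam"
  define h where "h t = f t - z * u t" for t
  define F where "F x = integral {0..x} h" for x
  define wc where "wc x = integral {0..x} (\<lambda>t. - ?\<kappa> * uc t)" for x
  have hi: "integrable ?M h" unfolding h_def using fi ui by auto
  have kuc: "continuous_on {0..1} (\<lambda>t. - ?\<kappa> * uc t)" by (intro continuous_intros ucc)
  have kui: "integrable ?M (\<lambda>t. - ?\<kappa> * uc t)" by (rule integrable_I01_continuous[OF kuc])
  have v_eq: "v x = wc x - F x" if x: "x \<in> {0..1}" for x
  proof -
    have "AE x in ?M. w x = - ?\<kappa> * uc x - h x"
      using fw uuc by eventually_elim (simp add: h_def algebra_simps)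
    then have "integral {0..x} w = integral {0..x} (\<lambda>x. - ?\<kappa> * uc x - h x)"
      by (intro primitive_cong_AE wi Bochner_Integration.integrable_diff kui hi x) auto
    also have "\<dots> = wc x - F x"
      unfolding wc_def F_def
      by (intro Henstock_Kurzweil_Integration.integral_diff
          integrable_on_subinterval[OF integrable_I01_imp_integrable_on[OF kui]]
          integrable_on_subinterval[OF integrable_I01_imp_integrable_on[OF hi]]) (use x in auto)
    finally show ?thesis by (simp add: v_def c20)
  qed
  have wc': "(wc has_vector_derivative - ?\<kappa> * uc t) (at t within {0..1})" if "t \<in> {0..1}" for t
    unfolding wc_def by (rule integral_has_vector_derivative[OF kuc that])
  show thesis
  proof (rule that[of uc wc])
    have "solves a ?\<kappa> F uc wc"
      unfolding solves_def using uc' wc' v_eq by simp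
    then show "solves a ?\<kappa> (\<lambda>x. integral {0..x} (\<lambda>t. f t - z * u t)) uc wc"
      unfolding F_def[abs_def] h_def[abs_def] .
    show "wc 0 = 0" by (simp add: wc_def)
    show "wc 1 = integral {0..1} (\<lambda>t. f t - z * u t)"
      using v_eq[of 1] v1 by (simp add: F_def h_def[abs_def])
  qed (rule uuc)
qed

text \<open>Conversely, solutions of the system lie in the domain of the operator. Membership in \<open>H\<^sup>2\<close>
  requires a weak derivative of \<open>u' = a (w - F)\<close>, a product of the \<open>C\<^sup>1\<close> function \<open>a\<close> and a
  primitive; this is where the derivative of \<open>p\<close> enters.\<close>

lemma solves_imp_graph:
  assumes hL: "h \<in> L2 I01" and s: "solves a (z - of_real lam) (\<lambda>x. integral {0..x} h) u w"
    and w0: "w 0 = 0" and w1: "w 1 = integral {0..1} h"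
  shows "(u, \<lambda>x. h x + z * u x) \<in> graph_A p lam"
proof -
  let ?M = "lebesgue_on I01"
  let ?\<kappa> = "z - of_real lam"
  define F where "F x = integral {0..x} h" for x
  define g where "g x = of_real (a x) * (w x - F x)" for x
  note hi = L2_I01_integrable[OF hL]
  note uc = solves_continuous(1)[OF s] and wc = solves_continuous(2)[OF s]
  have Fc: "continuous_on {0..1} F" unfolding F_def by (rule primitive_continuous[OF hi])
  have gc: "continuous_on {0..1} g" unfolding g_def by (intro continuous_intros a_continuous wc Fc)
  have gi: "integrable ?M g" by (rule integrable_I01_continuous[OF gc])
  have kuc: "continuous_on {0..1} (\<lambda>t. - ?\<kappa> * u t)" by (intro continuous_intros uc)
  have kui: "integrable ?M (\<lambda>t. - ?\<kappa> * u t)" by (rule integrable_I01_continuous[OF kuc])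
  have u_eq: "u x = u 0 + integral {0..x} g" if x: "x \<in> {0..1}" for x
  proof -
    have "(g has_integral (u x - u 0)) {0..x}"
      unfolding g_def F_def using x
      by (intro fundamental_theorem_of_calculus)
        (auto intro: has_vector_derivative_within_subset[OF solvesD(1)[OF s]])
    then show ?thesis by (simp add: integral_unique)
  qed
  define v' where "v' t = - ?\<kappa> * u t - h t" for t
  have v'i: "integrable ?M v'" unfolding v'_def by (intro Bochner_Integration.integrable_diff kui hi)
  have v_eq: "w x - F x = integral {0..x} v'" if x: "x \<in> {0..1}" for x
  proof -
    have "((\<lambda>t. - ?\<kappa> * u t) has_integral (w x - w 0)) {0..x}"
      by (intro fundamental_theorem_of_calculus
          has_vector_derivative_within_subset[OF solvesD(2)[OF s]]) (use x in auto)
    moreover have "(h has_integral F x) {0..x}"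
      unfolding F_def
      by (intro integrable_integral integrable_on_subinterval[OF integrable_I01_imp_integrable_on[OF hi]])
        (use x in auto)
    ultimately have "(v' has_integral (w x - w 0 - F x)) {0..x}"
      unfolding v'_def by (rule has_integral_diff)
    then show ?thesis using w0 by (simp add: integral_unique)
  qed
  have v'L: "v' \<in> L2 I01"
    using L2_add[OF L2_I01_continuous[OF kuc] L2_I01_mult_continuous[OF _ hL, of "\<lambda>_. - 1"]]
    by (simp add: v'_def[abs_def])
  have uL: "u \<in> L2 I01" by (rule L2_I01_continuous[OF uc])
  have gL: "g \<in> L2 I01" by (rule L2_I01_continuous[OF gc])
  have ug: "weak_deriv I01 u g"
    by (rule weak_deriv_cong[OF primitive_weak_deriv[OF gi, of "u 0"]]) (simp_all add: u_eq[symmetric])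
  have pg: "weak_deriv I01 (\<lambda>x. of_real (p x) * g x) v'"
    by (rule weak_deriv_cong[OF primitive_weak_deriv[OF v'i, of 0]])
      (use v_eq p_nz in \<open>auto simp: g_def a_def\<close>)
  define a' where "a' t = - p' t / (p t)\<^sup>2" for t
  have a'c: "continuous_on {0..1} a'"
    unfolding a'_def by (intro continuous_intros p_continuous p'_continuous) (auto simp: p_nz)
  have a': "(a has_real_derivative a' t) (at t within {0..1})" if "t \<in> {0..1}" for t
    unfolding a_def a'_def using p_nz[OF that]
    by (auto intro!: derivative_eq_intros p'[OF that] simp: power2_eq_square)
  have "weak_deriv I01 (\<lambda>x. of_real (a x) * (0 + integral {0..x} v'))
      (\<lambda>x. of_real (a x) * v' x + of_real (a' x) * (0 + integral {0..x} v'))"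
    by (rule weak_deriv_mult_primitive[OF v'i a'c a'])
  then have "weak_deriv I01 g (\<lambda>x. of_real (a x) * v' x + of_real (a' x) * (w x - F x))"
    by (rule weak_deriv_cong) (use v_eq in \<open>auto simp: g_def\<close>)
  moreover have "(\<lambda>x. of_real (a x) * v' x + of_real (a' x) * (w x - F x)) \<in> L2 I01"
    by (intro L2_add L2_I01_mult_continuous v'L L2_I01_continuous continuous_intros
        a_continuous a'c wc Fc)
  ultimately have "g \<in> H1 I01" using gL by (auto simp: H1_def)
  then have uH: "u \<in> H2 I01" using uL ug by (auto simp: H2_def)
  have fL: "(\<lambda>x. h x + z * u x) \<in> L2 I01"
    by (intro L2_add hL L2_I01_mult_continuous uL continuous_intros)
  have g01: "g 0 = 0" "g 1 = 0" using w0 w1 by (auto simp: g_def F_def)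
  have bd: "bdry_value 0 1 g 0 0" "bdry_value 0 1 g 1 0"
    unfolding bdry_value_def ae_eq_def using gc g01 by auto
  have ae: "ae_eq I01 (\<lambda>x. h x + z * u x) (\<lambda>x. - v' x + of_real lam * u x)"
    by (simp add: ae_eq_def v'_def algebra_simps)
  show ?thesis
    unfolding graph_A_def using uH fL gL ug bd v'L pg ae by auto
qed

end

text \<open>Green's formula for two systems with different coefficients. Applied in both orders it
  gives the difference of two eigenvalues; applied to one system it shows that eigenvalues are
  nonnegative.\<close>

lemma solves_green:
  assumes s: "solves a \<kappa> (\<lambda>_. 0) u v" and s2: "solves b \<mu> (\<lambda>_. 0) U V"
    and a: "continuous_on {0..1} a" and b: "continuous_on {0..1} b"
    and v01: "v 0 = 0" "v 1 = 0"
  shows "\<kappa> * integral {0..1} (\<lambda>t. u t * cnj (U t)) = integral {0..1} (\<lambda>t. of_real (b t) * (v t * cnj (V t)))"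
proof -
  note c = solves_continuous[OF s] solves_continuous[OF s2]
  have "((\<lambda>t. v t * cnj (U t)) has_vector_derivative
      of_real (b t) * (v t * cnj (V t)) - \<kappa> * (u t * cnj (U t))) (at t within {0..1})"
    if t: "t \<in> {0..1}" for t
    using has_vector_derivative_mult[OF solvesD(2)[OF s t]
        has_vector_derivative_cnj[OF solvesD(1)[OF s2 t]]]
    by (simp add: algebra_simps)
  then have "((\<lambda>t. of_real (b t) * (v t * cnj (V t)) - \<kappa> * (u t * cnj (U t))) has_integral
      (v 1 * cnj (U 1) - v 0 * cnj (U 0))) {0..1}"
    by (intro fundamental_theorem_of_calculus) auto
  then have "integral {0..1} (\<lambda>t. of_real (b t) * (v t * cnj (V t)) - \<kappa> * (u t * cnj (U t))) = 0"
    using v01 by (simp add: integral_unique)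
  moreover have "(\<lambda>t. of_real (b t) * (v t * cnj (V t))) integrable_on {0..1}"
    "(\<lambda>t. \<kappa> * (u t * cnj (U t))) integrable_on {0..1}"
    by (intro integrable_continuous_real continuous_intros c b)+
  ultimately show ?thesis
    by (simp add: Henstock_Kurzweil_Integration.integral_diff)
qed

text \<open>The solution that satisfies the Neumann condition at 0, normalised by \<open>u 0 = 1\<close>. As a function
  of \<open>\<kappa>\<close>, the final flux \<open>v 1\<close> is the characteristic function of the eigenvalue problem.\<close>

definition shoots :: "(real \<Rightarrow> real) \<Rightarrow> complex \<Rightarrow> (real \<Rightarrow> complex) \<Rightarrow> (real \<Rightarrow> complex) \<Rightarrow> bool" where
  "shoots a \<kappa> u v \<longleftrightarrow> solves a \<kappa> (\<lambda>_. 0) u v \<and> u 0 = 1 \<and> v 0 = 0"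

lemma shootsD:
  assumes "shoots a \<kappa> u v"
  shows "solves a \<kappa> (\<lambda>_. 0) u v" "u 0 = 1" "v 0 = 0"
  using assms by (auto simp: shoots_def)

lemma shoots_integral_pos:
  assumes "shoots a \<kappa> u v"
  shows "0 < integral {0..1} (\<lambda>t. (cmod (u t))\<^sup>2)"
proof -
  note uc = solves_continuous(1)[OF shootsD(1)[OF assms]]
  have c: "continuous_on {0..1} (\<lambda>t. (cmod (u t))\<^sup>2)" by (intro continuous_intros uc)
  have "0 \<le> integral {0..1} (\<lambda>t. (cmod (u t))\<^sup>2)"
    by (intro integral_nonneg integrable_continuous_real c) auto
  moreover have "integral {0..1} (\<lambda>t. (cmod (u t))\<^sup>2) \<noteq> 0"
  proof
    assume "integral {0..1} (\<lambda>t. (cmod (u t))\<^sup>2) = 0"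
    then have "((\<lambda>t. (cmod (u t))\<^sup>2) has_integral 0) (cbox 0 1)"
      using integrable_integral[OF integrable_continuous_real[OF c]] by simp
    from has_integral_0_cbox_imp_0[OF _ _ this, of 0] c shootsD(2)[OF assms]
    show False by simp
  qed
  ultimately show ?thesis by simp
qed

lemma shoots_eigenvalue_nonneg:
  assumes s: "shoots a \<kappa> u v" and v1: "v 1 = 0" and a: "continuous_on {0..1} a"
    and a0: "\<And>t. t \<in> {0..1} \<Longrightarrow> 0 \<le> a t"
  obtains k where "0 \<le> k" "\<kappa> = of_real k"
proof -
  note S = shootsD[OF s]
  note c = solves_continuous[OF S(1)]
  define m where "m = integral {0..1} (\<lambda>t. (cmod (u t))\<^sup>2)"
  define e where "e = integral {0..1} (\<lambda>t. a t * (cmod (v t))\<^sup>2)"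
  have m: "0 < m" unfolding m_def by (rule shoots_integral_pos[OF s])
  have e: "0 \<le> e"
    unfolding e_def
    by (intro integral_nonneg integrable_continuous_real continuous_intros c a mult_nonneg_nonneg a0) auto
  have "integral {0..1} (\<lambda>t. u t * cnj (u t)) = of_real m"
  proof -
    have "((\<lambda>t. of_real ((cmod (u t))\<^sup>2)) has_integral complex_of_real m) {0..1}"
      unfolding m_def
      by (intro has_integral_of_real integrable_integral integrable_continuous_real continuous_intros c)
    then show ?thesis by (simp only: complex_norm_square integral_unique)
  qed
  moreover have "integral {0..1} (\<lambda>t. of_real (a t) * (v t * cnj (v t))) = of_real e"
  proof -
    have "((\<lambda>t. of_real (a t * (cmod (v t))\<^sup>2)) has_integral complex_of_real e) {0..1}"
      unfolding e_def
      by (intro has_integral_of_real integrable_integral integrable_continuous_real continuous_intros c a)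
    then show ?thesis by (simp only: complex_norm_square of_real_mult integral_unique)
  qed
  ultimately have "\<kappa> * of_real m = of_real e"
    using solves_green[OF S(1) S(1) a a S(3) v1] by simp
  then have "\<kappa> = of_real (e / m)" using m by (simp add: field_simps)
  then show thesis using that[of "e / m"] m e by simp
qed

context diffusion_coefficient
begin

lemma shoots_exists: obtains u v where "shoots a \<kappa> u v"
  using solves_exists[OF a_continuous continuous_on_const[of _ 0], of 1 0 \<kappa>]
  unfolding shoots_def by blast

lemma a_solves_bound:
  assumes "solves a \<kappa> F u w" "\<And>t. t \<in> {0..1} \<Longrightarrow> norm (F t) \<le> B" "x \<in> {0..1}"
  shows "norm (u x) \<le> (norm (u 0) + norm (w 0) + 1 / m0 * B) * exp (1 / m0 + norm \<kappa>)"
    "norm (w x) \<le> (norm (u 0) + norm (w 0) + 1 / m0 * B) * exp (1 / m0 + norm \<kappa>)"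
  by (rule solves_bound[OF assms(1) a_bounds order_refl assms(2,3)]; assumption)+

lemma solves_eq_shoots:
  assumes s: "solves a \<kappa> (\<lambda>_. 0) u w" and w0: "w 0 = 0" and sh: "shoots a \<kappa> \<phi> \<eta>"
    and x: "x \<in> {0..1}"
  shows "u x = u 0 * \<phi> x" "w x = u 0 * \<eta> x"
proof -
  have d: "solves a \<kappa> (\<lambda>_. 0) (\<lambda>x. u x + (- u 0) * \<phi> x) (\<lambda>x. w x + (- u 0) * \<eta> x)"
    by (rule solves_cong[OF solves_linear[OF s shootsD(1)[OF sh]]]) simp
  show "u x = u 0 * \<phi> x" "w x = u 0 * \<eta> x"
    using a_solves_bound[OF d, of 0 x] x w0 shootsD(2,3)[OF sh] by auto
qed

text \<open>If the final flux does not vanish, dividing by it determines the multiple of the shooting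
  solution in any solution of the boundary value problem. This gives existence for every right-hand
  side and, together with the Gronwall bound for the rest, an a priori estimate.\<close>

lemma resolvent_of_shoots:
  assumes sh: "shoots a (z - of_real lam) \<phi> \<eta>" and nz: "\<eta> 1 \<noteq> 0"
  shows "z \<in> resolvent_set I01 (L2 I01) (graph_A p lam)"
proof -
  let ?\<kappa> = "z - of_real lam"
  note S = shootsD[OF sh]
  define E where "E = exp (1 / m0 + norm ?\<kappa>)"
  have E: "0 < E" by (simp add: E_def)
  have "\<exists>(u, w)\<in>graph_A p lam. ae_eq I01 (\<lambda>x. w x - z * u x) f" if f: "f \<in> L2 I01" for f
  proof -
    define F where "F x = integral {0..x} f" for x
    have Fc: "continuous_on {0..1} F"
      unfolding F_def by (rule primitive_continuous[OF L2_I01_integrable[OF f]])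
    obtain u w where uw: "u 0 = 0" "w 0 = 0" "solves a ?\<kappa> F u w"
      by (rule solves_exists[OF a_continuous Fc])
    \<comment> \<open>the multiple of the shooting solution that makes the flux vanish at the right end\<close>
    define c where "c = (F 1 - w 1) / \<eta> 1"
    have "solves a ?\<kappa> F (\<lambda>x. u x + c * \<phi> x) (\<lambda>x. w x + c * \<eta> x)"
      by (rule solves_cong[OF solves_linear[OF uw(3) S(1)]]) simp
    then have "(\<lambda>x. u x + c * \<phi> x, \<lambda>x. f x + z * (u x + c * \<phi> x)) \<in> graph_A p lam"
      unfolding F_def[abs_def]
      by (rule solves_imp_graph[OF f]) (use nz uw S in \<open>auto simp: c_def F_def\<close>)
    then show ?thesis by (rule rev_bexI) (simp add: ae_eq_def)
  qed
  moreover have "\<exists>C. \<forall>(u, w)\<in>graph_A p lam. L2norm I01 u \<le> C * L2norm I01 (\<lambda>x. w x - z * u x)"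
  proof (rule exI, safe)
    fix u f assume uf: "(u, f) \<in> graph_A p lam"
    then have uL: "u \<in> L2 I01" and fL: "f \<in> L2 I01" by (auto simp: graph_A_def H2_def)
    define h where "h x = f x - z * u x" for x
    define B where "B = L2norm I01 h"
    have hL: "h \<in> L2 I01"
      using L2_add[OF fL L2_I01_mult_continuous[OF _ uL, of "\<lambda>_. - z"]] by (simp add: h_def[abs_def])
    obtain uc wc where uc: "AE x in lebesgue_on I01. u x = uc x"
      and s: "solves a ?\<kappa> (\<lambda>x. integral {0..x} h) uc wc"
      and wc: "wc 0 = 0" "wc 1 = integral {0..1} h"
      using graph_imp_solves[OF uf, of z] unfolding h_def[symmetric, abs_def] by blast
    define c where "c = uc 0"
    have FB: "norm (integral {0..x} h) \<le> B" if "x \<in> {0..1}" for x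
      unfolding B_def by (rule norm_primitive_le_L2norm[OF hL that])
    have B0: "0 \<le> B" using FB[of 0] by simp
    have d: "solves a ?\<kappa> (\<lambda>x. integral {0..x} h) (\<lambda>x. uc x + (- c) * \<phi> x) (\<lambda>x. wc x + (- c) * \<eta> x)"
      by (rule solves_cong[OF solves_linear[OF s S(1)]]) simp
    have db: "norm (uc x - c * \<phi> x) \<le> B / m0 * E" "norm (wc x - c * \<eta> x) \<le> B / m0 * E"
      if "x \<in> {0..1}" for x
      using a_solves_bound[OF d FB that] S wc by (simp_all add: E_def c_def)
    have "norm c * norm (\<eta> 1) = norm (integral {0..1} h - (wc 1 - c * \<eta> 1))"
      by (simp add: wc norm_mult)
    also have "\<dots> \<le> B + B / m0 * E"
      by (rule order_trans[OF norm_triangle_ineq4 add_mono[OF FB db(2)]]) auto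
    finally have c: "norm c \<le> (B + B / m0 * E) / norm (\<eta> 1)"
      using nz by (simp add: pos_le_divide_eq)
    have ucB: "norm (uc x) \<le> ((1 + 1 / m0 * E) / norm (\<eta> 1) * E + 1 / m0 * E) * B" if x: "x \<in> {0..1}" for x
    proof -
      have "norm (uc x) \<le> norm c * norm (\<phi> x) + norm (uc x - c * \<phi> x)"
        by (metis add.commute norm_mult norm_triangle_sub)
      also have "\<dots> \<le> (B + B / m0 * E) / norm (\<eta> 1) * E + B / m0 * E"
        using a_solves_bound(1)[OF S(1), of 0 x] x S(2,3) db(1)[OF x] B0 m0 E
        by (intro add_mono mult_mono c) (auto simp: E_def)
      also have "\<dots> = ((1 + 1 / m0 * E) / norm (\<eta> 1) * E + 1 / m0 * E) * B"
        by (simp add: algebra_simps add_divide_distrib)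
      finally show ?thesis .
    qed
    have "AE x in lebesgue_on I01. norm (u x) \<le> ((1 + 1 / m0 * E) / norm (\<eta> 1) * E + 1 / m0 * E) * B"
      using uc AE_space by eventually_elim (use ucB in auto)
    then have "L2norm I01 u \<le> ((1 + 1 / m0 * E) / norm (\<eta> 1) * E + 1 / m0 * E) * B"
      by (rule L2norm_le_of_bound[OF uL]) (use B0 E m0 in \<open>auto intro!: mult_nonneg_nonneg add_nonneg_nonneg\<close>)
    then show "L2norm I01 u \<le> ((1 + 1 / m0 * E) / norm (\<eta> 1) * E + 1 / m0 * E) * L2norm I01 (\<lambda>x. f x - z * u x)"
      by (simp only: B_def h_def[abs_def])
  qed
  ultimately show ?thesis by (simp add: resolvent_set_def)
qed

lemma shoots_not_AE_zero:
  assumes "shoots a \<kappa> \<phi> \<eta>"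
  shows "\<not> (AE x in lebesgue_on I01. \<phi> x = 0)"
proof
  assume "AE x in lebesgue_on I01. \<phi> x = 0"
  then have "\<phi> 0 \<in> {0}"
    by (intro continuous_AE_closed[of 0 1 \<phi>] solves_continuous(1)[OF shootsD(1)[OF assms]]) auto
  then show False using shootsD(2)[OF assms] by simp
qed

lemma shoots_in_graph:
  assumes sh: "shoots a (z - of_real lam) \<phi> \<eta>" and z: "\<eta> 1 = 0"
  shows "(\<phi>, \<lambda>x. z * \<phi> x) \<in> graph_A p lam"
proof -
  have "(\<lambda>_. 0) \<in> L2 I01" by (intro L2_I01_continuous continuous_intros)
  from solves_imp_graph[OF this, of z \<phi> \<eta>] show ?thesis
    using shootsD[OF sh] z by simp
qed

lemma not_resolvent_of_shoots:
  assumes sh: "shoots a (z - of_real lam) \<phi> \<eta>" and z: "\<eta> 1 = 0"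
  shows "z \<notin> resolvent_set I01 (L2 I01) (graph_A p lam)"
proof
  assume "z \<in> resolvent_set I01 (L2 I01) (graph_A p lam)"
  then obtain C where "\<forall>(u, w)\<in>graph_A p lam. L2norm I01 u \<le> C * L2norm I01 (\<lambda>x. w x - z * u x)"
    by (auto simp: resolvent_set_def)
  from bspec[OF this shoots_in_graph[OF sh z]]
  have "L2norm I01 \<phi> \<le> 0" by (simp add: L2norm_def)
  then have le: "(\<integral>x. (cmod (\<phi> x))\<^sup>2 \<partial>lebesgue_on I01) \<le> 0"
    by (simp add: L2norm_def)
  have "\<phi> \<in> L2 I01"
    by (intro L2_I01_continuous solves_continuous(1)[OF shootsD(1)[OF sh]])
  then have i: "integrable (lebesgue_on I01) (\<lambda>x. (cmod (\<phi> x))\<^sup>2)" by (simp add: L2_def)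
  have "(\<integral>x. (cmod (\<phi> x))\<^sup>2 \<partial>lebesgue_on I01) = 0"
    by (rule antisym[OF le]) simp
  then have "AE x in lebesgue_on I01. (cmod (\<phi> x))\<^sup>2 = 0"
    using integral_nonneg_eq_0_iff_AE[OF i] by simp
  then show False using shoots_not_AE_zero[OF sh] by simp
qed

lemma spectrum_iff_shoots:
  assumes "shoots a (z - of_real lam) \<phi> \<eta>"
  shows "z \<in> op_spectrum I01 (L2 I01) (graph_A p lam) \<longleftrightarrow> \<eta> 1 = 0"
  using resolvent_of_shoots[OF assms] not_resolvent_of_shoots[OF assms]
  by (auto simp: op_spectrum_def)

text \<open>By uniqueness for the initial value problem, the continuous representative of an eigenfunction
  is its value at 0 times the shooting solution. So the eigenspaces are one-dimensional.\<close>

lemma eigenspace_shoots: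
  assumes sh: "shoots a (z - of_real lam) \<phi> \<eta>" and z: "\<eta> 1 = 0"
  shows "\<phi> \<in> eigenspace I01 (graph_A p lam) z"
    "u \<in> eigenspace I01 (graph_A p lam) z \<Longrightarrow> \<exists>c. AE x in lebesgue_on I01. u x = c * \<phi> x"
proof -
  show "\<phi> \<in> eigenspace I01 (graph_A p lam) z"
    using shoots_in_graph[OF sh z] by (auto simp: eigenspace_def ae_eq_def)
  assume "u \<in> eigenspace I01 (graph_A p lam) z"
  then obtain f where uf: "(u, f) \<in> graph_A p lam" and ae: "AE x in lebesgue_on I01. f x = z * u x"
    by (auto simp: eigenspace_def ae_eq_def)
  then have "u \<in> L2 I01" and "f \<in> L2 I01" by (auto simp: graph_A_def H2_def)
  then have i: "integrable (lebesgue_on I01) (\<lambda>x. f x - z * u x)"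
    using L2_I01_integrable by auto
  obtain uc wc where uc: "AE x in lebesgue_on I01. u x = uc x"
    and s: "solves a (z - of_real lam) (\<lambda>x. integral {0..x} (\<lambda>t. f t - z * u t)) uc wc"
    and w0: "wc 0 = 0"
    by (rule graph_imp_solves[OF uf, of z])
  have "integral {0..x} (\<lambda>t. f t - z * u t) = 0" if "x \<in> {0..1}" for x
    using primitive_cong_AE[OF i _ _ that, of "\<lambda>_. 0"] ae by simp
  then have "solves a (z - of_real lam) (\<lambda>_. 0) uc wc"
    by (rule solves_cong[OF s])
  from solves_eq_shoots(1)[OF this w0 sh] have eq: "uc x = uc 0 * \<phi> x" if "x \<in> {0..1}" for x
    using that .
  have "AE x in lebesgue_on I01. u x = uc 0 * \<phi> x"
    using uc AE_space by eventually_elim (simp add: eq[symmetric])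
  then show "\<exists>c. AE x in lebesgue_on I01. u x = c * \<phi> x" ..
qed

lemma has_dimension_eigenspace_iff:
  assumes sh: "shoots a (z - of_real lam) \<phi> \<eta>" and z: "\<eta> 1 = 0"
  shows "has_dimension I01 (eigenspace I01 (graph_A p lam) z) n \<longleftrightarrow> n = 1"
proof
  note E = eigenspace_shoots[OF sh z]
  note nz = shoots_not_AE_zero[OF sh]
  show "has_dimension I01 (eigenspace I01 (graph_A p lam) z) n" if "n = 1"
    unfolding has_dimension_def ae_eq_def that
  proof (intro exI[of _ "\<lambda>_. \<phi>"] conjI allI impI ballI)
    fix c :: "nat \<Rightarrow> complex" and j :: nat
    assume "AE x in lebesgue_on I01. (\<Sum>j<(1::nat). c j * \<phi> x) = 0" "j < 1"
    then show "c j = 0" using nz by (cases "c 0 = 0") auto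
  next
    fix u assume "u \<in> eigenspace I01 (graph_A p lam) z"
    then obtain c where "AE x in lebesgue_on I01. u x = c * \<phi> x" using E(2) by blast
    then show "\<exists>c. AE x in lebesgue_on I01. u x = (\<Sum>j<(1::nat). c j * \<phi> x)"
      by (intro exI[of _ "\<lambda>_. c"]) (simp add: lessThan_Suc)
  qed (use E(1) in auto)
  assume "has_dimension I01 (eigenspace I01 (graph_A p lam) z) n"
  then obtain e where e: "\<forall>j<n. e j \<in> eigenspace I01 (graph_A p lam) z"
    and ind: "\<forall>c. (AE x in lebesgue_on I01. (\<Sum>j<n. c j * e j x) = 0) \<longrightarrow> (\<forall>j<n. c j = 0)"
    and span: "\<forall>u \<in> eigenspace I01 (graph_A p lam) z.
        \<exists>c. AE x in lebesgue_on I01. u x = (\<Sum>j<n. c j * e j x)"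
    unfolding has_dimension_def ae_eq_def by (elim exE conjE)
  have "n \<noteq> 0"
  proof
    assume "n = 0"
    with bspec[OF span E(1)] show False using nz by simp
  qed
  moreover have "\<not> 2 \<le> n"
  proof
    assume n: "2 \<le> n"
    have "\<forall>j. \<exists>c. j < n \<longrightarrow> (AE x in lebesgue_on I01. e j x = c * \<phi> x)"
    proof
      fix j
      show "\<exists>c. j < n \<longrightarrow> (AE x in lebesgue_on I01. e j x = c * \<phi> x)"
      proof (cases "j < n")
        case True
        from E(2)[OF e[rule_format, OF True]] show ?thesis by (elim exE) (intro exI impI)
      qed auto
    qed
    from choice[OF this] obtain c
      where c: "\<forall>j. j < n \<longrightarrow> (AE x in lebesgue_on I01. e j x = c j * \<phi> x)"
      by (elim exE)
    have dep: "\<forall>j<n. d j = 0" if d: "\<And>x. (\<Sum>j<n. d j * (c j * \<phi> x)) = 0" for d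
    proof (rule mp[OF spec[OF ind]])
      have "AE x in lebesgue_on I01. \<forall>j\<in>{..<n}. e j x = c j * \<phi> x"
        using c by (subst AE_ball_countable) simp_all
      then show "AE x in lebesgue_on I01. (\<Sum>j<n. d j * e j x) = 0"
      proof eventually_elim
        case (elim x)
        then have "(\<Sum>j<n. d j * e j x) = (\<Sum>j<n. d j * (c j * \<phi> x))"
          by (intro sum.cong) auto
        then show ?case using d by simp
      qed
    qed
    have two: "(\<Sum>j<n. (if j = 0 then r else if j = 1 then s else 0) * (c j * \<phi> x))
        = r * (c 0 * \<phi> x) + s * (c 1 * \<phi> x)" for r s x
    proof -
      have "(\<Sum>j<n. (if j = 0 then r else if j = 1 then s else 0) * (c j * \<phi> x))
          = (\<Sum>j\<in>{0, 1}. (if j = 0 then r else if j = 1 then s else 0) * (c j * \<phi> x))"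
        using n by (intro sum.mono_neutral_right) auto
      then show ?thesis by simp
    qed
    have "\<forall>j<n. (if j = 0 then c 1 else if j = 1 then - c 0 else 0) = 0"
      by (rule dep) (simp only: two, simp)
    from this[rule_format, of 1] n have c0: "c 0 = 0" by simp
    have "\<forall>j<n. (if j = 0 then 1 else if j = 1 then 0 else 0) = (0::complex)"
      by (rule dep) (simp only: two, simp add: c0)
    from this[rule_format, of 0] n show False by simp
  qed
  ultimately show "n = 1" by simp
qed

end

section \<open>The Pruefer angle and the enumeration of the spectrum\<close>

context diffusion_coefficient
begin

definition b where "b t = p' t / (4 * p t)"

text \<open>Writing \<open>u = R cos \<theta>\<close> and \<open>p u' = - k sqrt p R sin \<theta>\<close> turns \<open>(p u')' = - k\<^sup>2 u\<close> into this
  equation for \<open>\<theta>\<close> alone. The factor \<open>sqrt p\<close> is chosen so that the coefficient of the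
  nonlinear term does not involve \<open>k\<close>; all bounds below are therefore uniform in \<open>k\<close>.\<close>

definition is_angle :: "real \<Rightarrow> (real \<Rightarrow> real) \<Rightarrow> bool" where
  "is_angle k \<theta> \<longleftrightarrow> \<theta> 0 = 0 \<and> (\<forall>t\<in>{0..1}.
     (\<theta> has_real_derivative k / sqrt (p t) - b t * sin (2 * \<theta> t)) (at t within {0..1}))"

lemma is_angleD:
  assumes "is_angle k \<theta>"
  shows "\<theta> 0 = 0" "t \<in> {0..1} \<Longrightarrow>
     (\<theta> has_real_derivative k / sqrt (p t) - b t * sin (2 * \<theta> t)) (at t within {0..1})"
  using assms by (auto simp: is_angle_def)

lemma is_angle_continuous: "is_angle k \<theta> \<Longrightarrow> continuous_on {0..1} \<theta>"
  by (rule DERIV_continuous_on) (rule is_angleD)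

lemma b_continuous: "continuous_on {0..1} b"
  unfolding b_def by (intro continuous_intros p_continuous p'_continuous) (auto simp: p_nz)

lemma b_bounded: "\<exists>B>0. \<forall>t\<in>{0..1}. \<bar>b t\<bar> \<le> B"
proof -
  have "bounded (b ` {0..1})"
    by (intro compact_imp_bounded compact_continuous_image b_continuous) auto
  then obtain B where B: "\<forall>t\<in>{0..1}. \<bar>b t\<bar> \<le> B"
    unfolding bounded_iff by auto
  have "\<bar>b t\<bar> \<le> \<bar>B\<bar> + 1" if "t \<in> {0..1}" for t
    using B[rule_format, OF that] by linarith
  then show ?thesis by (intro exI[of _ "\<bar>B\<bar> + 1"]) auto
qed

lemma p_upper: "\<exists>P>0. \<forall>t\<in>{0..1}. p t \<le> P"
proof -
  have "bounded (p ` {0..1})"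
    by (intro compact_imp_bounded compact_continuous_image p_continuous) auto
  then obtain B where B: "\<forall>t\<in>{0..1}. \<bar>p t\<bar> \<le> B"
    unfolding bounded_iff by auto
  have "p t \<le> \<bar>B\<bar> + 1" if "t \<in> {0..1}" for t
    using B[rule_format, OF that] by linarith
  then show ?thesis by (intro exI[of _ "\<bar>B\<bar> + 1"]) auto
qed

lemma sqrt_p_continuous: "continuous_on {0..1} (\<lambda>t. k / sqrt (p t))"
  by (intro continuous_intros p_continuous) (auto simp: p_nz)

lemma sin_2_diff: "sin (2 * x) - sin (2 * y) = 2 * sin (x - y) * cos (x + y)" for x y :: real
  using sin_diff_sin[of "2 * x" "2 * y"] by (simp add: diff_divide_distrib add_divide_distrib)

lemma angle_exists: "\<exists>\<theta>. is_angle k \<theta>"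
proof -
  obtain B where B: "0 < B" "\<And>t. t \<in> {0..1} \<Longrightarrow> \<bar>b t\<bar> \<le> B"
    using b_bounded by blast
  define f where "f t y = k / sqrt (p t) - b t * sin (2 * y)" for t y
  have 1: "continuous_on ({0..1} \<times> UNIV) (\<lambda>(t, y). f t y)"
    unfolding f_def split_def
    by (intro continuous_intros continuous_on_compose2[OF sqrt_p_continuous]
        continuous_on_compose2[OF b_continuous]) auto
  have 2: "norm (f t y - f t z) \<le> (2 * B) * norm (y - z)" if t: "t \<in> {0..1}" for t y z
  proof -
    have "f t y - f t z = b t * (sin (2 * z) - sin (2 * y))"
      by (simp add: f_def algebra_simps)
    then have "norm (f t y - f t z) = \<bar>b t\<bar> * \<bar>2 * sin (z - y) * cos (z + y)\<bar>"
      by (simp add: sin_2_diff abs_mult)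
    also have "\<dots> \<le> B * (2 * \<bar>z - y\<bar>)"
    proof (rule mult_mono[OF B(2)[OF t]])
      have "\<bar>sin (z - y)\<bar> * \<bar>cos (z + y)\<bar> \<le> \<bar>z - y\<bar> * 1"
        by (intro mult_mono abs_sin_x_le_abs_x abs_cos_le_one) auto
      then show "\<bar>2 * sin (z - y) * cos (z + y)\<bar> \<le> 2 * \<bar>z - y\<bar>" by (simp add: abs_mult)
    qed (use B in auto)
    finally show ?thesis by (simp add: abs_minus_commute)
  qed
  have 3: "0 < 2 * B" using B by simp
  show ?thesis
  proof (rule lipschitz_ode_exists[OF 1 2 3, of 0])
    fix y :: "real \<Rightarrow> real"
    assume y: "y 0 = 0" "\<And>t. t \<in> {0..1} \<Longrightarrow> (y has_vector_derivative f t (y t)) (at t within {0..1})"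
    then have "is_angle k y"
      by (simp add: is_angle_def f_def has_real_derivative_iff_has_vector_derivative)
    then show ?thesis by (rule exI[of _ y])
  qed
qed

text \<open>The difference \<open>\<psi>\<close> of two angles satisfies the linear equation
  \<open>\<psi>' = (k' - k) / sqrt p - \<beta> \<psi>\<close> with a bounded continuous \<open>\<beta>\<close>, which the integrating factor
  solves. Hence the final angle is bi-Lipschitz in \<open>k\<close>.\<close>

lemma angle_bi_lipschitz:
  obtains c C where "0 < c" "0 < C"
    "\<And>k k' \<theta> \<theta>'. is_angle k \<theta> \<Longrightarrow> is_angle k' \<theta>' \<Longrightarrow> k \<le> k' \<Longrightarrow>
       c * (k' - k) \<le> \<theta>' 1 - \<theta> 1 \<and> \<theta>' 1 - \<theta> 1 \<le> C * (k' - k)"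
proof -
  obtain B where B: "0 < B" "\<And>t. t \<in> {0..1} \<Longrightarrow> \<bar>b t\<bar> \<le> B"
    using b_bounded by blast
  obtain P where P: "0 < P" "\<And>t. t \<in> {0..1} \<Longrightarrow> p t \<le> P"
    using p_upper by blast
  define c C where "c = exp (- (4 * B)) / sqrt P" and "C = exp (4 * B) / sqrt m0"
  have sinc_le: "\<bar>if x = 0 then 1 else sin x / x\<bar> \<le> 1" for x :: real
    using abs_sin_x_le_abs_x[of x] by (auto simp: divide_le_eq)
  have main: "c * (k' - k) \<le> \<theta>' 1 - \<theta> 1 \<and> \<theta>' 1 - \<theta> 1 \<le> C * (k' - k)"
    if th: "is_angle k \<theta>" and th': "is_angle k' \<theta>'" and kk: "k \<le> k'" for k k' \<theta> \<theta>'
  proof -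
    define \<psi> where "\<psi> t = \<theta>' t - \<theta> t" for t
    define \<beta> where "\<beta> t = 2 * b t * cos (\<theta>' t + \<theta> t) * (if \<psi> t = 0 then 1 else sin (\<psi> t) / \<psi> t)" for t
    have \<psi>c: "continuous_on {0..1} \<psi>"
      unfolding \<psi>_def
      by (intro continuous_intros is_angle_continuous[OF th] is_angle_continuous[OF th'])
    have \<beta>c: "continuous_on {0..1} \<beta>"
      unfolding \<beta>_def
      by (intro continuous_intros b_continuous is_angle_continuous[OF th] is_angle_continuous[OF th'] \<psi>c)
    have \<beta>B: "\<bar>\<beta> t\<bar> \<le> 2 * B" if t: "t \<in> {0..1}" for t
    proof -
      have "\<bar>\<beta> t\<bar> = 2 * (\<bar>b t\<bar> * \<bar>cos (\<theta>' t + \<theta> t)\<bar> * \<bar>if \<psi> t = 0 then 1 else sin (\<psi> t) / \<psi> t\<bar>)"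
        by (simp add: \<beta>_def abs_mult)
      also have "\<dots> \<le> 2 * (B * 1 * 1)"
        by (intro mult_left_mono mult_mono B(2)[OF t] sinc_le abs_cos_le_one) (use B in auto)
      finally show ?thesis by simp
    qed
    have \<psi>': "(\<psi> has_real_derivative (k' - k) / sqrt (p t) - \<beta> t * \<psi> t) (at t within {0..1})"
      if t: "t \<in> {0..1}" for t
    proof -
      have "b t * (sin (2 * \<theta>' t) - sin (2 * \<theta> t)) = \<beta> t * \<psi> t"
        by (simp add: \<beta>_def sin_2_diff) (simp add: \<psi>_def)
      then have "(k' / sqrt (p t) - b t * sin (2 * \<theta>' t)) - (k / sqrt (p t) - b t * sin (2 * \<theta> t))
          = (k' - k) / sqrt (p t) - \<beta> t * \<psi> t"
        unfolding right_diff_distrib diff_divide_distrib by linarith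
      then show ?thesis
        using DERIV_cong[OF DERIV_diff[OF is_angleD(2)[OF th' t] is_angleD(2)[OF th t]]]
        unfolding \<psi>_def[abs_def] by blast
    qed
    \<comment> \<open>\<open>exp Q\<close> is the integrating factor; the mean value theorem for \<open>exp Q * \<psi>\<close> gives both bounds\<close>
    define Q where "Q t = integral {0..t} \<beta>" for t
    have Q': "(Q has_real_derivative \<beta> t) (at t within {0..1})" if "t \<in> {0..1}" for t
      unfolding Q_def has_real_derivative_iff_has_vector_derivative
      by (rule integral_has_vector_derivative[OF \<beta>c that])
    have QB: "\<bar>Q t\<bar> \<le> 2 * B" if t: "t \<in> {0..1}" for t
    proof -
      have "norm (Q t) \<le> integral {0..t} (\<lambda>_. 2 * B)"
        unfolding Q_def
        by (rule integral_norm_bound_integral)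
          (use t \<beta>B in \<open>auto intro!: integrable_continuous_real continuous_on_subset[OF \<beta>c]\<close>)
      also have "\<dots> \<le> 2 * B" using t B mult_left_mono[of t 1 "2 * B"] by simp
      finally show ?thesis by simp
    qed
    define Z where "Z t = exp (Q t) * \<psi> t" for t
    have Z': "(Z has_real_derivative exp (Q t) * ((k' - k) / sqrt (p t))) (at t within {0..1})"
      if t: "t \<in> {0..1}" for t
    proof -
      have "((\<lambda>t. exp (Q t)) has_real_derivative exp (Q t) * \<beta> t) (at t within {0..1})"
        by (auto intro!: derivative_eq_intros Q'[OF t])
      from DERIV_mult'[OF this \<psi>'[OF t]] show ?thesis
        by (simp add: Z_def[abs_def] algebra_simps)
    qed
    have "\<exists>z\<in>{0<..<1}. Z 1 - Z 0 = (\<lambda>h. exp (Q z) * ((k' - k) / sqrt (p z)) * h) (1 - 0)"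
    proof (rule mvt_simple)
      fix x :: real assume "0 \<le> x" "x \<le> 1"
      then have "x \<in> {0..1}" by simp
      then show "(Z has_derivative (\<lambda>h. exp (Q x) * ((k' - k) / sqrt (p x)) * h)) (at x within {0..1})"
        by (rule Z'[unfolded has_field_derivative_def])
    qed simp
    then obtain z where "z \<in> {0<..<1}" "Z 1 - Z 0 = exp (Q z) * ((k' - k) / sqrt (p z)) * (1 - 0)"
      by (rule bexE)
    then have z: "z \<in> {0..1}" "Z 1 - Z 0 = exp (Q z) * ((k' - k) / sqrt (p z))" by auto
    have "Z 0 = 0" using is_angleD(1)[OF th] is_angleD(1)[OF th'] by (simp add: Z_def \<psi>_def)
    then have Z1: "exp (Q 1) * \<psi> 1 = exp (Q z) * ((k' - k) / sqrt (p z))"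
      using z(2) by (simp add: Z_def)
    have "\<psi> 1 = exp (Q 1) * \<psi> 1 / exp (Q 1)" by simp
    then have eq: "\<psi> 1 = exp (Q z - Q 1) * ((k' - k) / sqrt (p z))"
      unfolding Z1 by (simp add: exp_diff)
    have Qz: "- (4 * B) \<le> Q z - Q 1" "Q z - Q 1 \<le> 4 * B"
      using QB[OF z(1)] QB[of 1] by auto
    have "\<psi> 1 \<le> exp (4 * B) * ((k' - k) / sqrt m0)"
      unfolding eq using Qz kk p_ge[OF z(1)] m0
      by (intro mult_mono divide_left_mono) (auto intro!: mult_pos_pos)
    moreover have "exp (- (4 * B)) * ((k' - k) / sqrt P) \<le> \<psi> 1"
      unfolding eq using Qz kk P(2)[OF z(1)] P(1) p_pos[OF z(1)]
      by (intro mult_mono divide_left_mono) (auto intro!: mult_pos_pos)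
    ultimately show ?thesis by (simp add: \<psi>_def c_def C_def)
  qed
  show thesis
    by (rule that[of c C]) (use P m0 main in \<open>auto simp: c_def C_def\<close>)
qed

lemma angle_zero: "is_angle 0 (\<lambda>_. 0)"
  by (simp add: is_angle_def)

definition final_angle :: "real \<Rightarrow> real" where
  "final_angle k = (SOME \<theta>. is_angle k \<theta>) 1"

lemma final_angle_bi_lipschitz:
  obtains c C where "0 < c" "0 < C"
    "\<And>k k'. k \<le> k' \<Longrightarrow> c * (k' - k) \<le> final_angle k' - final_angle k"
    "\<And>k k'. k \<le> k' \<Longrightarrow> final_angle k' - final_angle k \<le> C * (k' - k)"
    "\<And>k \<theta>. is_angle k \<theta> \<Longrightarrow> \<theta> 1 = final_angle k"
proof -
  obtain c C where c: "0 < c" "0 < C"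
    "\<And>k k' \<theta> \<theta>'. is_angle k \<theta> \<Longrightarrow> is_angle k' \<theta>' \<Longrightarrow> k \<le> k' \<Longrightarrow>
       c * (k' - k) \<le> \<theta>' 1 - \<theta> 1 \<and> \<theta>' 1 - \<theta> 1 \<le> C * (k' - k)"
    by (rule angle_bi_lipschitz) blast
  have some: "is_angle k (SOME \<theta>. is_angle k \<theta>)" for k
    by (rule someI_ex[OF angle_exists])
  show thesis
    by (rule that[OF c(1,2)])
      (use c(3)[OF some some] c(3)[OF _ some order_refl] in \<open>auto simp: final_angle_def intro: antisym\<close>)
qed

lemma final_angle_0: "final_angle 0 = 0"
  using final_angle_bi_lipschitz angle_zero by metis

lemma final_angle_strict_mono: "k < k' \<Longrightarrow> final_angle k < final_angle k'"
proof -
  obtain c where "0 < c" "\<And>k k'. k \<le> k' \<Longrightarrow> c * (k' - k) \<le> final_angle k' - final_angle k"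
    by (rule final_angle_bi_lipschitz) blast
  then show "k < k' \<Longrightarrow> final_angle k < final_angle k'"
    by (smt (verit) mult_pos_pos)
qed

lemma final_angle_inj: "final_angle k = final_angle k' \<longleftrightarrow> k = k'"
  using final_angle_strict_mono by (metis less_irrefl linorder_neqE)

lemma final_angle_surj:
  assumes "0 \<le> y" obtains k where "0 \<le> k" "final_angle k = y"
proof -
  obtain c C where c: "0 < c" "0 < C"
    "\<And>k k'. k \<le> k' \<Longrightarrow> c * (k' - k) \<le> final_angle k' - final_angle k"
    "\<And>k k'. k \<le> k' \<Longrightarrow> final_angle k' - final_angle k \<le> C * (k' - k)"
    by (rule final_angle_bi_lipschitz) blast
  have "C-lipschitz_on UNIV final_angle"
  proof (rule lipschitz_onI)
    fix x z :: real
    show "dist (final_angle x) (final_angle z) \<le> C * dist x z"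
      using c(4)[of x z] c(4)[of z x] final_angle_strict_mono[of x z] final_angle_strict_mono[of z x]
      by (cases x z rule: linorder_cases) (auto simp: dist_real_def)
  qed (use c in auto)
  then have cont: "continuous_on {0..y / c} final_angle"
    by (meson lipschitz_on_continuous_on continuous_on_subset subset_UNIV)
  have "y \<le> final_angle (y / c)"
    using c(1) c(3)[of 0 "y / c"] assms by (simp add: final_angle_0)
  then have "\<exists>k. 0 \<le> k \<and> k \<le> y / c \<and> final_angle k = y"
    using assms c(1) cont by (intro IVT') (auto simp: final_angle_0)
  then show thesis using that by blast
qed

text \<open>The amplitude \<open>R\<close> is recovered from the angle by one integration.\<close>

lemma angle_imp_shoots:
  assumes th: "is_angle k \<theta>"
  obtains u v where "shoots a (of_real (k\<^sup>2)) u v"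
    "v 1 = 0 \<longleftrightarrow> k = 0 \<or> sin (\<theta> 1) = 0"
proof -
  note \<theta>c = is_angle_continuous[OF th]
  define r where "r t = 2 * b t * (sin (\<theta> t))\<^sup>2" for t
  have rc: "continuous_on {0..1} r" unfolding r_def by (intro continuous_intros b_continuous \<theta>c)
  define R where "R t = exp (- integral {0..t} r)" for t
  have R': "(R has_real_derivative - r t * R t) (at t within {0..1})" if t: "t \<in> {0..1}" for t
  proof -
    have "((\<lambda>t. integral {0..t} r) has_real_derivative r t) (at t within {0..1})"
      unfolding has_real_derivative_iff_has_vector_derivative
      by (rule integral_has_vector_derivative[OF rc t])
    then show ?thesis
      unfolding R_def by (auto intro!: derivative_eq_intros)
  qed
  define x y where "x t = R t * cos (\<theta> t)" and "y t = - k * sqrt (p t) * R t * sin (\<theta> t)" for t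
  have x': "(x has_real_derivative a t * y t) (at t within {0..1})" if t: "t \<in> {0..1}" for t
  proof -
    define s where "s = sqrt (p t)"
    have s: "0 < s" "p t = s * s" using p_pos[OF t] by (auto simp: s_def)
    have "(x has_real_derivative - r t * R t * cos (\<theta> t)
        + R t * (- sin (\<theta> t) * (k / sqrt (p t) - b t * sin (2 * \<theta> t)))) (at t within {0..1})"
      unfolding x_def
      by (rule derivative_eq_intros R'[OF t] is_angleD(2)[OF th t] refl | simp)+
    also have "- r t * R t * cos (\<theta> t)
        + R t * (- sin (\<theta> t) * (k / sqrt (p t) - b t * sin (2 * \<theta> t))) = a t * y t"
    proof -
      define S C m where "S = sin (\<theta> t)" and "C = cos (\<theta> t)" and "m = k / s"
      have "a t * y t = - m * R t * S"
        using s by (simp add: a_def y_def S_def m_def flip: s_def)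
      moreover have "- (2 * b t * S\<^sup>2) * R t * C + R t * (- S * (m - b t * (2 * S * C))) = - m * R t * S"
        by (simp add: power2_eq_square algebra_simps)
      ultimately show ?thesis
        unfolding r_def sin_double S_def C_def m_def s_def by simp
    qed
    finally show ?thesis .
  qed
  have y': "(y has_real_derivative - k\<^sup>2 * x t) (at t within {0..1})" if t: "t \<in> {0..1}" for t
  proof -
    define s where "s = sqrt (p t)"
    have s: "0 < s" "p t = s * s" using p_pos[OF t] by (auto simp: s_def)
    define S C where "S = sin (\<theta> t)" and "C = cos (\<theta> t)"
    have SC: "S * S = 1 - C * C"
      using sin_cos_squared_add[of "\<theta> t"] by (simp add: S_def C_def power2_eq_square)
    have "((\<lambda>t. sqrt (p t)) has_real_derivative p' t / (2 * s)) (at t within {0..1})"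
      using p_pos[OF t] unfolding s_def
      by (auto intro!: derivative_eq_intros p'[OF t] simp: field_simps)
    moreover have "p' t / (2 * s) = 2 * b t * s"
      using s by (simp add: b_def)
    ultimately have s': "((\<lambda>t. sqrt (p t)) has_real_derivative 2 * b t * s) (at t within {0..1})"
      by simp
    have sin': "((\<lambda>t. sin (\<theta> t)) has_real_derivative C * (k / s - b t * (2 * S * C))) (at t within {0..1})"
      unfolding S_def C_def s_def sin_double[symmetric]
      by (auto intro!: derivative_eq_intros is_angleD(2)[OF th t])
    have "(y has_real_derivative - k * (2 * b t * s * R t * S + s * (- r t * R t) * S
        + s * R t * (C * (k / s - b t * (2 * S * C))))) (at t within {0..1})"
      using DERIV_cmult[OF DERIV_mult'[OF DERIV_mult'[OF s' R'[OF t]] sin'], of "- k"]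
      unfolding y_def[abs_def] S_def[symmetric] s_def[symmetric] by (simp only: algebra_simps)
    also have "2 * b t * s * R t * S + s * (- r t * R t) * S
        + s * R t * (C * (k / s - b t * (2 * S * C))) = k * (R t * C)"
    proof -
      have "2 * b t * s * R t * S + s * (- r t * R t) * S + s * R t * (C * (k / s - b t * (2 * S * C)))
        = 2 * b t * s * R t * S * (1 - C * C - S * S) + k * (R t * C)"
        using s by (simp add: r_def field_simps power2_eq_square flip: S_def)
      then show ?thesis by (simp add: SC)
    qed
    finally show ?thesis by (simp add: x_def C_def power2_eq_square mult.assoc)
  qed
  have "(\<lambda>t. complex_of_real (x t)) 0 = 1" "(\<lambda>t. complex_of_real (y t)) 0 = 0"
    by (auto simp: x_def y_def R_def is_angleD(1)[OF th])
  moreover have "solves a (of_real (k\<^sup>2)) (\<lambda>_. 0) (\<lambda>t. of_real (x t)) (\<lambda>t. of_real (y t))"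
    unfolding solves_def
  proof (intro ballI conjI)
    fix t :: real assume t: "t \<in> {0..1}"
    show "((\<lambda>t. complex_of_real (x t)) has_vector_derivative of_real (a t) * (of_real (y t) - 0)) (at t within {0..1})"
      using has_vector_derivative_of_real[OF x'[OF t], where 'a = complex] by simp
    show "((\<lambda>t. complex_of_real (y t)) has_vector_derivative - of_real (k\<^sup>2) * of_real (x t)) (at t within {0..1})"
      using has_vector_derivative_of_real[OF y'[OF t], where 'a = complex] by simp
  qed
  moreover have "y 1 = 0 \<longleftrightarrow> k = 0 \<or> sin (\<theta> 1) = 0"
    using p_nz[of 1] by (simp add: y_def R_def)
  ultimately show thesis
    by (intro that[of "\<lambda>t. of_real (x t)" "\<lambda>t. of_real (y t)"]) (auto simp: shoots_def)
qed

text \<open>The final flux is \<open>- k sqrt p R sin \<theta>\<close> at 1, so for \<open>k > 0\<close> it vanishes exactly when the final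
  angle is a multiple of \<open>pi\<close>; for \<open>k = 0\<close> both the flux and the angle vanish identically.\<close>

lemma angle_in_spectrum_iff:
  assumes k: "0 \<le> k"
  shows "of_real (lam + k\<^sup>2) \<in> op_spectrum I01 (L2 I01) (graph_A p lam) \<longleftrightarrow>
    (\<exists>n::nat. final_angle k = n * pi)"
proof -
  obtain \<theta> where th: "is_angle k \<theta>" using angle_exists by blast
  have th1: "\<theta> 1 = final_angle k" using final_angle_bi_lipschitz th by metis
  obtain u v where uv: "shoots a (of_real (k\<^sup>2)) u v" "v 1 = 0 \<longleftrightarrow> k = 0 \<or> sin (\<theta> 1) = 0"
    by (rule angle_imp_shoots[OF th])
  have "of_real (lam + k\<^sup>2) \<in> op_spectrum I01 (L2 I01) (graph_A p lam) \<longleftrightarrow> v 1 = 0"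
    by (rule spectrum_iff_shoots[where \<phi> = u]) (use uv(1) in simp)
  also have "\<dots> \<longleftrightarrow> sin (final_angle k) = 0"
    using uv(2) th1 final_angle_0 by auto
  also have "\<dots> \<longleftrightarrow> (\<exists>n::nat. final_angle k = n * pi)"
  proof
    assume "sin (final_angle k) = 0"
    then obtain i :: int where i: "final_angle k = of_int i * pi"
      unfolding sin_zero_iff_int2 by blast
    have "0 \<le> final_angle k"
      using k final_angle_strict_mono[of 0 k] final_angle_0 by (cases "k = 0") auto
    then have "0 \<le> i" using i pi_gt_zero by (auto simp: zero_le_mult_iff)
    then show "\<exists>n::nat. final_angle k = n * pi"
      using i by (intro exI[of _ "nat i"]) simp
  qed auto
  finally show ?thesis .
qed

definition freq :: "nat \<Rightarrow> real" where
  "freq n = (SOME k. 0 \<le> k \<and> final_angle k = n * pi)"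

lemma freq: "0 \<le> freq n" "final_angle (freq n) = n * pi"
proof -
  have "\<exists>k. 0 \<le> k \<and> final_angle k = n * pi"
    by (rule final_angle_surj[of "n * pi"]) auto
  from someI_ex[OF this] show "0 \<le> freq n" "final_angle (freq n) = n * pi"
    by (auto simp: freq_def)
qed

lemma freq_strict_mono: "m < n \<Longrightarrow> freq m < freq n"
  using freq(2)[of m] freq(2)[of n] final_angle_strict_mono[of "freq n" "freq m"]
    final_angle_inj[of "freq m" "freq n"]
  by (cases "freq m" "freq n" rule: linorder_cases) (auto simp: mult_less_cancel_right)

text \<open>Different eigenvalues have final angles at least \<open>pi\<close> apart, and the final angle is Lipschitz
  in \<open>k\<close>.\<close>

lemma freq_gap:
  obtains d where "0 < d" "\<And>m n. freq m < freq n \<Longrightarrow> freq m + d \<le> freq n"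
proof -
  obtain C where C: "0 < C" "\<And>k k'. k \<le> k' \<Longrightarrow> final_angle k' - final_angle k \<le> C * (k' - k)"
    by (rule final_angle_bi_lipschitz) blast
  have "freq m + pi / C \<le> freq n" if less: "freq m < freq n" for m n
  proof -
    have "real m * pi < real n * pi"
      using final_angle_strict_mono[OF less] freq(2) by simp
    then have "m + 1 \<le> n" by (simp add: mult_less_cancel_right)
    then have "(real m + 1) * pi \<le> real n * pi"
      by (intro mult_right_mono) auto
    then have "pi \<le> C * (freq n - freq m)"
      using C(2)[of "freq m" "freq n"] less freq(2) by (simp add: algebra_simps)
    then show ?thesis using C(1) by (simp add: field_simps)
  qed
  then show thesis using C(1) by (intro that[of "pi / C"]) auto
qed

lemma spectrum_eq:
  "op_spectrum I01 (L2 I01) (graph_A p lam) = range (\<lambda>n. of_real (lam + (freq n)\<^sup>2))"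
proof (intro equalityI subsetI)
  fix z assume z: "z \<in> op_spectrum I01 (L2 I01) (graph_A p lam)"
  obtain u v where uv: "shoots a (z - of_real lam) u v" by (rule shoots_exists)
  then have "v 1 = 0" using spectrum_iff_shoots z by blast
  then obtain \<kappa> where \<kappa>: "0 \<le> \<kappa>" "z - of_real lam = of_real \<kappa>"
    using shoots_eigenvalue_nonneg[OF uv _ a_continuous a_bounds(1)] by blast
  then have z_eq: "z = of_real (lam + (sqrt \<kappa>)\<^sup>2)" by (simp add: algebra_simps)
  then obtain n :: nat where "final_angle (sqrt \<kappa>) = n * pi"
    using z angle_in_spectrum_iff[of "sqrt \<kappa>"] \<kappa>(1) by auto
  then have "sqrt \<kappa> = freq n"
    using freq(2)[of n] final_angle_inj by metis
  then show "z \<in> range (\<lambda>n. of_real (lam + (freq n)\<^sup>2))" using z_eq by auto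
next
  fix z :: complex assume "z \<in> range (\<lambda>n. of_real (lam + (freq n)\<^sup>2))"
  then show "z \<in> op_spectrum I01 (L2 I01) (graph_A p lam)"
    using angle_in_spectrum_iff[OF freq(1)] freq(2) by auto
qed

lemma has_dimension_spectrum_iff:
  assumes "z \<in> op_spectrum I01 (L2 I01) (graph_A p lam)"
  shows "has_dimension I01 (eigenspace I01 (graph_A p lam) z) n \<longleftrightarrow> n = 1"
proof -
  obtain u v where uv: "shoots a (z - of_real lam) u v" by (rule shoots_exists)
  then show ?thesis
    using spectrum_iff_shoots[OF uv] assms has_dimension_eigenspace_iff[OF uv] by blast
qed

lemma spectrum_enumeration:
  "enumerates_spectrum I01 (L2 I01) (graph_A p lam) (\<lambda>n. lam + (freq n)\<^sup>2)"
proof -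
  have less: "lam + (freq m)\<^sup>2 < lam + (freq n)\<^sup>2" if "m < n" for m n
    using freq_strict_mono[OF that] freq(1)[of m] by (simp add: power_strict_mono)
  have "mono (\<lambda>n. lam + (freq n)\<^sup>2)"
    using less by (intro monoI) (metis order_le_less)
  moreover have "{i. complex_of_real (lam + (freq i)\<^sup>2) = complex_of_real (lam + (freq n)\<^sup>2)} = {n}" for n
  proof -
    have "i = n" if "lam + (freq i)\<^sup>2 = lam + (freq n)\<^sup>2" for i
      using less[of i n] less[of n i] that by (cases i n rule: linorder_cases) auto
    then show ?thesis unfolding of_real_eq_iff by blast
  qed
  ultimately show ?thesis
    unfolding enumerates_spectrum_def
    using has_dimension_spectrum_iff by (auto simp: spectrum_eq simp del: of_real_add of_real_power)
qed

text \<open>Since all multiplicities are 1, any enumeration \<open>\<mu>\<close> is strictly increasing and runs through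
  increasing frequencies \<open>k\<^sub>i\<close> with \<open>k\<^sub>i\<^sub>+\<^sub>1 - k\<^sub>i \<ge> d\<close>. Hence \<open>k\<^sub>i \<ge> i d\<close>, and the gap
  \<open>(k\<^sub>i\<^sub>+\<^sub>1 - k\<^sub>i) (k\<^sub>i\<^sub>+\<^sub>1 + k\<^sub>i)\<close> is at least \<open>i d\<^sup>2\<close>.\<close>

lemma spectrum_gap:
  assumes e: "enumerates_spectrum I01 (L2 I01) (graph_A p lam) \<mu>"
  shows "filterlim (\<lambda>i. \<mu> (Suc i) - \<mu> i) at_top sequentially"
proof -
  obtain d where d: "0 < d" "\<And>m n. freq m < freq n \<Longrightarrow> freq m + d \<le> freq n"
    by (rule freq_gap) blast
  have mono: "mono \<mu>" and sp: "op_spectrum I01 (L2 I01) (graph_A p lam) = range (\<lambda>i. complex_of_real (\<mu> i))"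
    and fin: "\<And>z. z \<in> op_spectrum I01 (L2 I01) (graph_A p lam) \<Longrightarrow>
        card {i. complex_of_real (\<mu> i) = z} = 1"
    using e has_dimension_spectrum_iff unfolding enumerates_spectrum_def by blast+
  have "\<exists>n. \<mu> i = lam + (freq n)\<^sup>2" for i
  proof -
    have "complex_of_real (\<mu> i) \<in> range (\<lambda>n. of_real (lam + (freq n)\<^sup>2))"
      using sp spectrum_eq by blast
    then show ?thesis by (auto simp del: of_real_add of_real_power)
  qed
  then obtain m where m: "\<And>i. \<mu> i = lam + (freq (m i))\<^sup>2" by metis
  have step: "freq (m i) + d \<le> freq (m (Suc i))" for i
  proof (rule d(2))
    have "\<mu> i \<noteq> \<mu> (Suc i)"
    proof
      assume eq: "\<mu> i = \<mu> (Suc i)"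
      have "card {j. complex_of_real (\<mu> j) = of_real (\<mu> i)} = 1"
        by (rule fin) (use sp in auto)
      then obtain j where "{j. complex_of_real (\<mu> j) = of_real (\<mu> i)} = {j}"
        by (auto simp: card_1_singleton_iff)
      then have "i \<in> {j}" "Suc i \<in> {j}" using eq by auto
      then show False by simp
    qed
    then have "\<mu> i < \<mu> (Suc i)"
      using monoD[OF mono, of i "Suc i"] by simp
    then have "(freq (m i))\<^sup>2 < (freq (m (Suc i)))\<^sup>2" by (simp add: m)
    then show "freq (m i) < freq (m (Suc i))" using freq(1) by (rule power2_less_imp_less)
  qed
  have lin: "real i * d \<le> freq (m i)" for i
  proof (induction i)
    case (Suc i)
    then show ?case using step[of i] by (simp add: algebra_simps)
  qed (simp add: freq)
  have "real i * (d * d) \<le> \<mu> (Suc i) - \<mu> i" for i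
  proof -
    have "real i * (d * d) \<le> d * (freq (m (Suc i)) + freq (m i))"
      using mult_left_mono[of "real i * d" "freq (m i)" d] lin[of i] d(1)
        mult_nonneg_nonneg[of d "freq (m (Suc i))"] freq(1)[of "m (Suc i)"]
      by (simp add: algebra_simps add_increasing2)
    also have "\<dots> \<le> (freq (m (Suc i)) - freq (m i)) * (freq (m (Suc i)) + freq (m i))"
      using step[of i] freq(1) by (intro mult_right_mono) (auto intro: add_nonneg_nonneg)
    also have "\<dots> = \<mu> (Suc i) - \<mu> i"
      by (simp add: m power2_eq_square algebra_simps)
    finally show ?thesis .
  qed
  note le = this
  have lim: "filterlim (\<lambda>i. real i * (d * d)) at_top sequentially"
    using filterlim_tendsto_pos_mult_at_top[OF tendsto_const[of "d * d"] _ filterlim_real_sequentially]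
      d(1) by (simp add: mult.commute)
  show ?thesis
    by (rule filterlim_at_top_mono[OF lim]) (intro always_eventually allI le)
qed

end

section \<open>Stability of eigenvalues under perturbation of the coefficient\<close>

lemma shoots_difference_bound:
  assumes s: "shoots a \<kappa> u v" and s2: "shoots b \<mu> U V"
    and a: "continuous_on {0..1} a" and b: "continuous_on {0..1} b"
    and aA: "\<And>t. t \<in> {0..1} \<Longrightarrow> 0 \<le> a t" "\<And>t. t \<in> {0..1} \<Longrightarrow> a t \<le> A"
    and K: "norm \<kappa> \<le> K"
    and M: "\<And>t. t \<in> {0..1} \<Longrightarrow> norm (U t) \<le> M" "\<And>t. t \<in> {0..1} \<Longrightarrow> norm (V t) \<le> M"
    and x: "x \<in> {0..1}"
  shows "norm (u x - U x) \<le> M * (integral {0..1} (\<lambda>t. \<bar>a t - b t\<bar>) + norm (\<kappa> - \<mu>)) * exp (A + K)"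
proof -
  note S = shootsD[OF s] and S2 = shootsD[OF s2]
  have A0: "0 \<le> A" using aA[of 0] by simp
  have K0: "0 \<le> K" using K norm_ge_zero[of \<kappa>] by linarith
  have M0: "0 \<le> M" by (rule order_trans[OF norm_ge_zero M(1)[of 0]]) simp
  define r where "r t = M * (\<bar>a t - b t\<bar> + norm (\<kappa> - \<mu>))" for t
  have abc: "continuous_on {0..1} (\<lambda>t. \<bar>a t - b t\<bar>)" by (intro continuous_intros a b)
  have ri: "(r has_integral M * (integral {0..1} (\<lambda>t. \<bar>a t - b t\<bar>) + norm (\<kappa> - \<mu>))) {0..1}"
    unfolding r_def
    using has_integral_add[OF integrable_integral[OF integrable_continuous_real[OF abc]]
        has_integral_const_real[of "norm (\<kappa> - \<mu>)" 0 1]]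
    by (intro has_integral_mult_right) simp
  define d where "d t = (u t - U t, v t - V t)" for t
  define d' where "d' t = (of_real (a t) * (v t - 0) - of_real (b t) * (V t - 0), - \<kappa> * u t - - \<mu> * U t)" for t
  have "norm (d x) \<le> (norm (d 0) + integral {0..1} r) * exp (A + K)"
  proof (rule gronwall)
    fix t :: real assume t: "t \<in> {0..1}"
    show "(d has_vector_derivative d' t) (at t within {0..1})"
      unfolding d_def d'_def
      by (intro has_vector_derivative_Pair has_vector_derivative_diff
          solvesD[OF S(1) t] solvesD[OF S2(1) t])
    have "d' t = (of_real (a t) * (v t - V t), - \<kappa> * (u t - U t))
        + (of_real (a t - b t) * V t, - (\<kappa> - \<mu>) * U t)"
      by (simp add: d'_def algebra_simps)
    then have "norm (d' t) \<le> norm (of_real (a t) * (v t - V t), - \<kappa> * (u t - U t))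
        + norm (of_real (a t - b t) * V t, - (\<kappa> - \<mu>) * U t)"
      by (simp only: norm_triangle_ineq)
    also have "\<dots> \<le> (A + K) * norm (d t) + (norm (of_real (a t - b t) * V t) + norm (- (\<kappa> - \<mu>) * U t))"
      unfolding d_def by (intro add_mono norm_system_le aA t K norm_Pair_le)
    also have "norm (of_real (a t - b t) * V t) + norm (- (\<kappa> - \<mu>) * U t) \<le> r t"
    proof -
      have "norm (of_real (a t - b t) * V t) \<le> \<bar>a t - b t\<bar> * M"
        unfolding norm_mult norm_of_real by (intro mult_left_mono M t) auto
      moreover have "norm (- (\<kappa> - \<mu>) * U t) \<le> norm (\<kappa> - \<mu>) * M"
        unfolding norm_mult norm_minus_cancel by (intro mult_left_mono M t) auto
      ultimately show ?thesis by (simp add: r_def algebra_simps)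
    qed
    finally show "norm (d' t) \<le> (A + K) * norm (d t) + r t" by simp
  next
    fix t :: real
    show "0 \<le> r t" unfolding r_def by (intro mult_nonneg_nonneg M0) auto
  qed (use x A0 K0 ri in auto)
  moreover have "norm (u x - U x) \<le> norm (d x)" unfolding d_def by (rule norm_fst_le)
  ultimately show ?thesis
    using S S2 integral_unique[OF ri] by (simp add: d_def)
qed

text \<open>Since \<open>u 0 = 1\<close> and \<open>\<bar>u'\<bar> \<le> A M\<close>, the solution keeps absolute value at least \<open>1/2\<close> up to the
  point \<open>\<tau> = 1 / (2 (A M + 1))\<close>, which contributes \<open>\<tau> / 4\<close> to the integral.\<close>

lemma shoots_mass_lower_bound:
  assumes s: "shoots a \<kappa> u v" and A: "0 < A" and M: "0 < M"
    and aA: "\<And>t. t \<in> {0..1} \<Longrightarrow> 0 \<le> a t" "\<And>t. t \<in> {0..1} \<Longrightarrow> a t \<le> A"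
    and vM: "\<And>t. t \<in> {0..1} \<Longrightarrow> norm (v t) \<le> M"
  shows "1 / (8 * (A * M + 1)) \<le> integral {0..1} (\<lambda>t. (cmod (u t))\<^sup>2)"
proof -
  note S = shootsD[OF s]
  define \<tau> where "\<tau> = 1 / (2 * (A * M + 1))"
  have AM: "0 < A * M" using A M by simp
  have \<tau>: "0 < \<tau>" "\<tau> \<le> 1" "A * M * \<tau> \<le> 1 / 2" using AM by (auto simp: \<tau>_def field_simps)
  have uc: "continuous_on {0..1} (\<lambda>t. (cmod (u t))\<^sup>2)"
    by (intro continuous_intros solves_continuous(1)[OF S(1)])
  have half: "1 / 2 \<le> norm (u t)" if t: "t \<in> {0..\<tau>}" for t
  proof -
    have "norm (u t - u 0) \<le> integral {0..t} (\<lambda>_. A * M)"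
    proof (rule norm_increment_le_integral[OF solvesD(1)[OF S(1)]])
      fix x :: real assume x: "x \<in> {0..1}"
      show "norm (of_real (a x) * (v x - 0)) \<le> A * M"
        using aA[OF x] vM[OF x] A by (auto simp: norm_mult intro!: mult_mono)
    qed (use t \<tau> in auto)
    also have "\<dots> = t * (A * M)" using t by simp
    also have "\<dots> \<le> \<tau> * (A * M)" using t AM by (intro mult_right_mono) auto
    also have "\<dots> \<le> 1 / 2" using \<tau>(3) by (simp add: mult.commute)
    finally have "norm (u t - 1) \<le> 1 / 2" using S(2) by simp
    then show ?thesis using norm_triangle_ineq2[of 1 "1 - u t"] by (simp add: norm_minus_commute)
  qed
  have "1 / (8 * (A * M + 1)) = integral {0..\<tau>} (\<lambda>_. 1 / 4)"
    using \<tau> by (simp add: \<tau>_def)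
  also have "\<dots> \<le> integral {0..\<tau>} (\<lambda>t. (cmod (u t))\<^sup>2)"
  proof (rule integral_le)
    fix t assume "t \<in> {0..\<tau>}"
    from power_mono[OF half[OF this], of 2] show "1 / 4 \<le> (cmod (u t))\<^sup>2"
      by (simp add: power2_eq_square)
  qed (use \<tau> in \<open>auto intro!: integrable_continuous_real continuous_on_subset[OF uc]\<close>)
  also have "\<dots> \<le> integral {0..1} (\<lambda>t. (cmod (u t))\<^sup>2)"
    by (rule integral_subset_le)
      (use \<tau> in \<open>auto intro!: integrable_continuous_real continuous_on_subset[OF uc]\<close>)
  finally show ?thesis .
qed

text \<open>Green's formula expresses \<open>(\<kappa> - \<mu>) \<integral> u cnj U\<close> through \<open>a - b\<close> and the fluxes. The integral
  stays away from zero since both eigenfunctions start at 1 and are close to each other. All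
  constants depend on the coefficients only through the bound \<open>A\<close> for their reciprocals, which
  makes the estimate uniform for coefficients that become arbitrarily large.\<close>

lemma eigenvalue_stability:
  assumes A: "0 < A" and K: "0 \<le> K"
  obtains \<rho> C where "0 < \<rho>" "0 < C"
    "\<And>a b \<kappa> \<mu> u v U V. \<lbrakk>continuous_on {0..1} a; continuous_on {0..1} b;
      \<forall>t\<in>{0..1}. 0 \<le> a t \<and> a t \<le> A; \<forall>t\<in>{0..1}. 0 \<le> b t \<and> b t \<le> A;
      0 \<le> \<kappa>; \<kappa> \<le> K; 0 \<le> \<mu>; \<mu> \<le> K;
      shoots a (of_real \<kappa>) u v; v 1 = 0; shoots b (of_real \<mu>) U V; V 1 = 0;
      integral {0..1} (\<lambda>t. \<bar>a t - b t\<bar>) + \<bar>\<kappa> - \<mu>\<bar> \<le> \<rho>\<rbrakk>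
      \<Longrightarrow> \<bar>\<kappa> - \<mu>\<bar> \<le> C * integral {0..1} (\<lambda>t. \<bar>a t - b t\<bar>)"
proof -
  define M where "M = exp (A + K)"
  have M: "0 < M" by (simp add: M_def)
  define c where "c = 1 / (8 * (A * M + 1))"
  have c: "0 < c" unfolding c_def using A M by (intro divide_pos_pos mult_pos_pos add_pos_pos) auto
  have \<rho>: "0 < c / (2 * M ^ 3)" and C: "0 < 2 * M\<^sup>2 / c" using c M by auto
  show thesis
  proof (rule that[OF \<rho> C])
    fix a b :: "real \<Rightarrow> real" and \<kappa> \<mu> :: real and u v U V
    assume ac: "continuous_on {0..1} a" and bc: "continuous_on {0..1} b"
      and aA: "\<forall>t\<in>{0..1}. 0 \<le> a t \<and> a t \<le> A" and bA: "\<forall>t\<in>{0..1}. 0 \<le> b t \<and> b t \<le> A"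
      and k: "0 \<le> \<kappa>" "\<kappa> \<le> K" and m: "0 \<le> \<mu>" "\<mu> \<le> K"
      and s: "shoots a (of_real \<kappa>) u v" and v1: "v 1 = 0"
      and s2: "shoots b (of_real \<mu>) U V" and V1: "V 1 = 0"
      and close: "integral {0..1} (\<lambda>t. \<bar>a t - b t\<bar>) + \<bar>\<kappa> - \<mu>\<bar> \<le> c / (2 * M ^ 3)"
    note S = shootsD[OF s] and S2 = shootsD[OF s2]
    note cont = solves_continuous[OF S(1)] solves_continuous[OF S2(1)]
    define \<delta> where "\<delta> = integral {0..1} (\<lambda>t. \<bar>a t - b t\<bar>)"
    have uM: "norm (u t) \<le> M" "norm (v t) \<le> M" if "t \<in> {0..1}" for t
      using solves_bound[OF S(1), of A K 0 t] aA that k S by (auto simp: M_def)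
    have UM: "norm (U t) \<le> M" "norm (V t) \<le> M" if "t \<in> {0..1}" for t
      using solves_bound[OF S2(1), of A K 0 t] bA that m S2 by (auto simp: M_def)
    have diff: "norm (u t - U t) \<le> c / (2 * M)" if t: "t \<in> {0..1}" for t
    proof -
      have "norm (u t - U t) \<le> M * (\<delta> + norm (complex_of_real \<kappa> - of_real \<mu>)) * exp (A + K)"
        unfolding \<delta>_def
        by (rule shoots_difference_bound[OF s s2 ac bc]) (use aA k UM t in auto)
      also have "norm (complex_of_real \<kappa> - of_real \<mu>) = \<bar>\<kappa> - \<mu>\<bar>"
        by (metis norm_of_real of_real_diff)
      also have "M * (\<delta> + \<bar>\<kappa> - \<mu>\<bar>) * exp (A + K) \<le> M * (c / (2 * M ^ 3)) * M"
        using close M unfolding \<delta>_def M_def[symmetric] by (intro mult_right_mono mult_left_mono) auto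
      also have "\<dots> = c / (2 * M)" using M by (simp add: power3_eq_cube)
      finally show ?thesis .
    qed
    define J where "J = integral {0..1} (\<lambda>t. u t * cnj (U t))"
    have J: "c / 2 \<le> norm J"
    proof -
      define m where "m = integral {0..1} (\<lambda>t. (cmod (u t))\<^sup>2)"
      have "c \<le> m" unfolding c_def m_def
        by (rule shoots_mass_lower_bound[OF s A M]) (use aA uM in auto)
      have "((\<lambda>t. of_real ((cmod (u t))\<^sup>2)) has_integral complex_of_real m) {0..1}"
        unfolding m_def
        by (intro has_integral_of_real integrable_integral integrable_continuous_real continuous_intros cont)
      moreover have "((\<lambda>t. u t * cnj (U t)) has_integral J) {0..1}"
        unfolding J_def
        by (intro integrable_integral integrable_continuous_real continuous_intros cont)
      ultimately have "((\<lambda>t. of_real ((cmod (u t))\<^sup>2) - u t * cnj (U t)) has_integral (of_real m - J)) {0..1}"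
        by (rule has_integral_diff)
      then have i: "((\<lambda>t. u t * cnj (u t - U t)) has_integral (of_real m - J)) {0..1}"
        unfolding complex_norm_square by (simp add: algebra_simps)
      have "norm (of_real m - J) \<le> M * (c / (2 * M)) * measure lborel (cbox 0 (1::real))"
      proof (rule has_integral_bound)
        fix t :: real assume "t \<in> cbox 0 1"
        then have t: "t \<in> {0..1}" by simp
        show "norm (u t * cnj (u t - U t)) \<le> M * (c / (2 * M))"
          unfolding norm_mult complex_mod_cnj using uM[OF t] diff[OF t] M by (intro mult_mono) auto
      qed (use i M c in auto)
      also have "\<dots> = c / 2" using M by simp
      finally have "norm (of_real m - J) \<le> c / 2" .
      moreover have "m \<le> norm J + norm (of_real m - J)"
        using norm_triangle_ineq[of J "of_real m - J"] by simp
      ultimately show ?thesis using \<open>c \<le> m\<close> by linarith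
    qed
    have 1: "of_real \<kappa> * J = integral {0..1} (\<lambda>t. of_real (b t) * (v t * cnj (V t)))"
      unfolding J_def by (rule solves_green[OF S(1) S2(1) ac bc S(3) v1])
    have 2: "of_real \<mu> * J = integral {0..1} (\<lambda>t. of_real (a t) * (v t * cnj (V t)))"
    proof -
      have "cnj (of_real \<mu> * integral {0..1} (\<lambda>t. U t * cnj (u t)))
          = cnj (integral {0..1} (\<lambda>t. of_real (a t) * (V t * cnj (v t))))"
        using solves_green[OF S2(1) S(1) bc ac S2(3) V1] by simp
      then show ?thesis by (simp add: J_def integral_cnj mult.commute)
    qed
    have ib: "((\<lambda>t. of_real (b t) * (v t * cnj (V t))) has_integral (of_real \<kappa> * J)) {0..1}"
      unfolding 1 by (intro integrable_integral integrable_continuous_real continuous_intros cont bc)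
    have ia: "((\<lambda>t. of_real (a t) * (v t * cnj (V t))) has_integral (of_real \<mu> * J)) {0..1}"
      unfolding 2 by (intro integrable_integral integrable_continuous_real continuous_intros cont ac)
    have i: "((\<lambda>t. of_real (b t - a t) * (v t * cnj (V t))) has_integral (of_real (\<kappa> - \<mu>) * J)) {0..1}"
      using has_integral_diff[OF ib ia] by (simp add: algebra_simps)
    have "norm (of_real (\<kappa> - \<mu>) * J) \<le> integral {0..1} (\<lambda>t. \<bar>a t - b t\<bar> * M\<^sup>2)"
      unfolding integral_unique[OF i, symmetric]
    proof (rule integral_norm_bound_integral)
      fix t :: real assume t: "t \<in> {0..1}"
      show "norm (of_real (b t - a t) * (v t * cnj (V t))) \<le> \<bar>a t - b t\<bar> * M\<^sup>2"
        unfolding norm_mult norm_of_real complex_mod_cnj power2_eq_square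
        using uM[OF t] UM[OF t] M by (intro mult_mono) auto
    next
      show "(\<lambda>t. of_real (b t - a t) * (v t * cnj (V t))) integrable_on {0..1}" using i by blast
      show "(\<lambda>t. \<bar>a t - b t\<bar> * M\<^sup>2) integrable_on {0..1}"
        by (intro integrable_continuous_real continuous_intros ac bc)
    qed
    then have "\<bar>\<kappa> - \<mu>\<bar> * norm J \<le> \<delta> * M\<^sup>2"
      by (simp add: norm_mult \<delta>_def del: of_real_diff)
    moreover have "\<bar>\<kappa> - \<mu>\<bar> * (c / 2) \<le> \<bar>\<kappa> - \<mu>\<bar> * norm J"
      by (intro mult_left_mono J) auto
    ultimately have "\<bar>\<kappa> - \<mu>\<bar> * (c / 2) \<le> \<delta> * M\<^sup>2" by linarith
    then show "\<bar>\<kappa> - \<mu>\<bar> \<le> 2 * M\<^sup>2 / c * integral {0..1} (\<lambda>t. \<bar>a t - b t\<bar>)"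
      using c unfolding \<delta>_def[symmetric] by (simp add: field_simps)
  qed
qed

section \<open>The coefficients with large diffusion\<close>

lemma C2_on_imp_coefficient:
  assumes C2: "C2_on {0..1} q" and m0: "0 < m0" and q: "\<And>x. x \<in> {0<..<1} \<Longrightarrow> m0 \<le> q x"
  obtains q' where "diffusion_coefficient q q' m0"
proof -
  obtain q' q'' where q': "\<forall>x\<in>{0..1}. (q has_real_derivative q' x) (at x within {0..1})"
    and q'': "\<forall>x\<in>{0..1}. (q' has_real_derivative q'' x) (at x within {0..1})"
    using C2 unfolding C2_on_def by blast
  note q' = bspec[OF q'] and q'' = bspec[OF q'']
  have "q x \<in> {m0..}" if "x \<in> {0..1}" for x
    by (rule continuous_AE_closed[OF DERIV_continuous_on[OF q'] _ _ _ that])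
      (use q in \<open>auto intro!: AE_I2\<close>)
  then have "diffusion_coefficient q q' m0"
    by unfold_locales (use q' m0 DERIV_continuous_on[OF q''] in auto)
  then show thesis by (rule that)
qed

lemma (in diffusion_coefficient) spectrum_imp_shoots:
  assumes "z \<in> op_spectrum I01 (L2 I01) (graph_A p lam)"
  obtains k u v where "0 \<le> k" "z = of_real lam + of_real k" "shoots (\<lambda>t. 1 / p t) (of_real k) u v" "v 1 = 0"
proof -
  obtain u v where uv: "shoots a (z - of_real lam) u v" by (rule shoots_exists)
  then have v1: "v 1 = 0" using spectrum_iff_shoots assms by blast
  obtain k where k: "0 \<le> k" "z - of_real lam = of_real k"
    by (rule shoots_eigenvalue_nonneg[OF uv v1 a_continuous a_bounds(1)])
  have "a = (\<lambda>t. 1 / p t)" by (simp add: a_def fun_eq_iff)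
  then show thesis
    using uv v1 k by (intro that[of k u v]) (auto simp: algebra_simps)
qed

text \<open>The two transition layers of width \<open>\<epsilon>\<close> next to \<open>x1\<close> and \<open>x2\<close> and the interior, where the
  coefficient is at most \<open>\<epsilon>\<close>, all contribute a multiple of \<open>\<epsilon>\<close>.\<close>

lemma integral_transition_layers:
  fixes a :: "real \<Rightarrow> real"
  assumes a: "continuous_on {x1..x2} a" and A: "\<And>t. t \<in> {x1..x2} \<Longrightarrow> a t \<le> A"
    and e: "\<And>t. t \<in> {x1 + e..x2 - e} \<Longrightarrow> a t \<le> e" and e0: "0 < e" "2 * e \<le> x2 - x1" "x2 - x1 \<le> 1"
  shows "integral {x1..x2} a \<le> (2 * A + 1) * e"
proof -
  have i: "a integrable_on {s..t}" if "x1 \<le> s" "t \<le> x2" for s t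
    by (rule integrable_continuous_real, rule continuous_on_subset[OF a]) (use that in auto)
  have b: "integral {s..t} a \<le> (t - s) * B" if "x1 \<le> s" "s \<le> t" "t \<le> x2" "\<And>r. r \<in> {s..t} \<Longrightarrow> a r \<le> B" for s t B
  proof -
    have "integral {s..t} a \<le> integral {s..t} (\<lambda>_. B)"
      by (rule integral_le) (use that i in auto)
    then show ?thesis using that by simp
  qed
  have "integral {x1..x2} a = integral {x1..x1 + e} a + integral {x1 + e..x2} a"
    using e0 i by (intro Henstock_Kurzweil_Integration.integral_combine[symmetric]) auto
  also have "integral {x1 + e..x2} a = integral {x1 + e..x2 - e} a + integral {x2 - e..x2} a"
    using e0 i by (intro Henstock_Kurzweil_Integration.integral_combine[symmetric]) auto
  finally have eq: "integral {x1..x2} a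
      = integral {x1..x1 + e} a + (integral {x1 + e..x2 - e} a + integral {x2 - e..x2} a)" .
  have "integral {x1..x1 + e} a \<le> (x1 + e - x1) * A"
    "integral {x1 + e..x2 - e} a \<le> (x2 - e - (x1 + e)) * e"
    "integral {x2 - e..x2} a \<le> (x2 - (x2 - e)) * A"
    by (rule b; use e0 A e in auto)+
  moreover have "(x2 - e - (x1 + e)) * e \<le> 1 * e" using e0 by (intro mult_right_mono) auto
  ultimately show ?thesis unfolding eq by (simp add: algebra_simps)
qed

text \<open>For a continuous function on \<open>\<Omega>\<^sub>1\<close>, which has no isolated points, the essential supremum
  bounds all values, not just almost all, and it is finite by compactness.\<close>

lemma Linf_norm_continuous:
  assumes f: "continuous_on (Omega1 x1 x2) f" and x12: "0 < x1" "x1 < x2" "x2 < 1"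
  shows "x \<in> Omega1 x1 x2 \<Longrightarrow> \<bar>f x\<bar> \<le> Linf_norm (Omega1 x1 x2) f"
    "(\<And>x. x \<in> Omega1 x1 x2 \<Longrightarrow> \<bar>f x\<bar> \<le> c) \<Longrightarrow> Linf_norm (Omega1 x1 x2) f \<le> c"
proof -
  let ?O = "Omega1 x1 x2"
  define E where "E = esssup (lebesgue_on ?O) (\<lambda>x. ereal \<bar>f x\<bar>)"
  have O: "?O \<in> sets lebesgue" "compact ?O" by (auto simp: Omega1_def)
  have ec: "continuous_on ?O (\<lambda>x. ereal \<bar>f x\<bar>)"
    by (intro continuous_on_ereal continuous_intros f)
  have m: "(\<lambda>x. ereal \<bar>f x\<bar>) \<in> borel_measurable (lebesgue_on ?O)"
    by (intro borel_measurable_ereal continuous_imp_measurable_on_sets_lebesgue continuous_intros f O)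
  have upper: "E \<le> ereal c" if "\<And>x. x \<in> ?O \<Longrightarrow> \<bar>f x\<bar> \<le> c" for c
    unfolding E_def by (rule esssup_I[OF m]) (use that in \<open>auto intro!: AE_I2\<close>)
  have sub: "ereal \<bar>f x\<bar> \<in> {..E}" if ab: "a < b" "{a..b} \<subseteq> ?O" "x \<in> {a..b}" for a b x
  proof (rule continuous_AE_closed[OF continuous_on_subset[OF ec ab(2)] _ ab(1) _ ab(3)])
    have "AE x in lebesgue. x \<in> ?O \<longrightarrow> ereal \<bar>f x\<bar> \<le> E"
      using esssup_AE[of "\<lambda>x. ereal \<bar>f x\<bar>" "lebesgue_on ?O"] O unfolding E_def
      by (subst (asm) AE_restrict_space_iff) auto
    moreover have "x \<in> ?O" if "x \<in> {a<..<b}" for x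
      using that ab(2) by (meson atLeastAtMost_iff greaterThanLessThan_iff less_imp_le subsetD)
    ultimately have "AE x in lebesgue. x \<in> {a<..<b} \<longrightarrow> ereal \<bar>f x\<bar> \<in> {..E}"
      by (auto elim!: eventually_mono)
    then show "AE x in lebesgue_on {a<..<b}. ereal \<bar>f x\<bar> \<in> {..E}"
      by (subst AE_restrict_space_iff) auto
  qed auto
  have le: "ereal \<bar>f x\<bar> \<le> E" if "x \<in> ?O" for x
    using that sub[of 0 x1 x] sub[of x2 1 x] x12 by (auto simp: Omega1_def)
  have "bounded (f ` ?O)" by (intro compact_imp_bounded compact_continuous_image f O)
  then obtain B where "\<forall>x\<in>?O. \<bar>f x\<bar> \<le> B" unfolding bounded_iff by auto
  then have "E \<le> ereal B" by (intro upper) auto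
  moreover have "ereal \<bar>f 0\<bar> \<le> E" by (rule le) (use x12 in \<open>auto simp: Omega1_def\<close>)
  ultimately obtain e where e: "E = ereal e" by (cases E) auto
  then have N: "Linf_norm ?O f = e" by (simp add: Linf_norm_def flip: E_def)
  show "\<bar>f x\<bar> \<le> Linf_norm ?O f" if "x \<in> ?O" using le[OF that] by (simp add: N e)
  show "Linf_norm ?O f \<le> c" if "\<And>x. x \<in> ?O \<Longrightarrow> \<bar>f x\<bar> \<le> c" using upper[of c] that by (simp add: N e)
qed

text \<open>On \<open>\<Omega>\<^sub>1\<close> both coefficients are close to \<open>p\<^sub>0\<close>; on \<open>\<Omega>\<^sub>0\<close> both reciprocals have small integral,
  so their difference does not matter there.\<close>

lemma integral_reciprocal_difference:
  fixes q r p0 :: "real \<Rightarrow> real"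
  assumes x12: "0 < x1" "x1 < x2" "x2 < 1" and m0: "0 < m0"
    and q: "continuous_on {0..1} q" "\<And>t. t \<in> {0..1} \<Longrightarrow> m0 \<le> q t"
    and r: "continuous_on {0..1} r" "\<And>t. t \<in> {0..1} \<Longrightarrow> m0 \<le> r t"
    and qN: "\<And>t. t \<in> Omega1 x1 x2 \<Longrightarrow> \<bar>q t - p0 t\<bar> \<le> N" and rN: "\<And>t. t \<in> Omega1 x1 x2 \<Longrightarrow> \<bar>r t - p0 t\<bar> \<le> N'"
    and e: "0 < e" "2 * e \<le> x2 - x1" "\<And>t. t \<in> {x1 + e..x2 - e} \<Longrightarrow> 1 / e \<le> q t"
    and e': "0 < e'" "2 * e' \<le> x2 - x1" "\<And>t. t \<in> {x1 + e'..x2 - e'} \<Longrightarrow> 1 / e' \<le> r t"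
  shows "integral {0..1} (\<lambda>t. \<bar>1 / q t - 1 / r t\<bar>)
     \<le> (2 / m0\<^sup>2 + 2 / m0 + 1) * ((N + e) + (N' + e'))"
proof -
  let ?f = "\<lambda>t. \<bar>1 / q t - 1 / r t\<bar>"
  have qr: "0 < q t" "0 < r t" if "t \<in> {0..1}" for t using q(2)[OF that] r(2)[OF that] m0 by auto
  have qc: "continuous_on {0..1} (\<lambda>t. 1 / q t)" and rc: "continuous_on {0..1} (\<lambda>t. 1 / r t)"
    using qr by (auto intro!: continuous_intros q r simp: less_imp_neq[symmetric])
  have fc: "continuous_on {0..1} ?f" by (intro continuous_intros qc rc)
  have i: "?f integrable_on {s..t}" if "0 \<le> s" "t \<le> 1" for s t
    by (rule integrable_continuous_real, rule continuous_on_subset[OF fc]) (use that in auto)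
  have "0 \<in> Omega1 x1 x2" using x12 by (auto simp: Omega1_def)
  from qN[OF this] rN[OF this] have N0: "0 \<le> N" "0 \<le> N'" by linarith+
  have outer: "integral {s..t} ?f \<le> (N + N') / m0\<^sup>2" if st: "0 \<le> s" "s \<le> t" "t \<le> 1" "{s..t} \<subseteq> Omega1 x1 x2" for s t
  proof -
    have "integral {s..t} ?f \<le> integral {s..t} (\<lambda>_. (N + N') / m0\<^sup>2)"
    proof (rule integral_le)
      fix y assume y: "y \<in> {s..t}"
      then have y01: "y \<in> {0..1}" and yO: "y \<in> Omega1 x1 x2" using st by auto
      have "1 / q y - 1 / r y = (r y - q y) / (q y * r y)"
        using qr[OF y01] by (simp add: field_simps)
      then have "?f y = \<bar>r y - q y\<bar> / (q y * r y)"
        using qr[OF y01] by (simp add: abs_mult)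
      also have "\<dots> \<le> (N + N') / (m0 * m0)"
        using qN[OF yO] rN[OF yO] q(2)[OF y01] r(2)[OF y01] m0 N0
        by (intro frac_le mult_mono) auto
      finally show "?f y \<le> (N + N') / m0\<^sup>2" by (simp add: power2_eq_square)
    qed (use st i in auto)
    also have "\<dots> = (t - s) * ((N + N') / m0\<^sup>2)" using st by simp
    also have "\<dots> \<le> 1 * ((N + N') / m0\<^sup>2)"
      using st N0 by (intro mult_right_mono) auto
    finally show ?thesis by simp
  qed
  \<comment> \<open>no cancellation on \<open>\<Omega>\<^sub>0\<close>: both reciprocals are small in the mean\<close>
  have inner: "integral {x1..x2} ?f \<le> (2 * (1 / m0) + 1) * e + (2 * (1 / m0) + 1) * e'"
  proof -
    have s: "{x1..x2} \<subseteq> {0..1}" using x12 by auto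
    note qc' = continuous_on_subset[OF qc s] and rc' = continuous_on_subset[OF rc s]
    have "integral {x1..x2} ?f \<le> integral {x1..x2} (\<lambda>t. 1 / q t + 1 / r t)"
    proof (rule integral_le)
      fix y assume "y \<in> {x1..x2}"
      then have "0 < 1 / q y" "0 < 1 / r y" using qr[of y] x12 by auto
      then show "?f y \<le> 1 / q y + 1 / r y" by linarith
    qed (use x12 i in \<open>auto intro!: integrable_continuous_real continuous_on_add qc' rc'\<close>)
    also have "\<dots> = integral {x1..x2} (\<lambda>t. 1 / q t) + integral {x1..x2} (\<lambda>t. 1 / r t)"
      by (intro Henstock_Kurzweil_Integration.integral_add integrable_continuous_real qc' rc')
    also have "integral {x1..x2} (\<lambda>t. 1 / q t) \<le> (2 * (1 / m0) + 1) * e"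
    proof (rule integral_transition_layers[OF qc' _ _ e(1,2)])
      fix t assume "t \<in> {x1..x2}"
      then show "1 / q t \<le> 1 / m0" using q(2)[of t] m0 x12 by (intro divide_left_mono) (auto intro!: mult_pos_pos)
    next
      fix t assume "t \<in> {x1 + e..x2 - e}"
      from e(3)[OF this] show "1 / q t \<le> e"
        using e(1) by (smt (verit) divide_pos_pos le_divide_eq_1 mult.commute pos_divide_le_eq)
    qed (use x12 in auto)
    also have "integral {x1..x2} (\<lambda>t. 1 / r t) \<le> (2 * (1 / m0) + 1) * e'"
    proof (rule integral_transition_layers[OF rc' _ _ e'(1,2)])
      fix t assume "t \<in> {x1..x2}"
      then show "1 / r t \<le> 1 / m0" using r(2)[of t] m0 x12 by (intro divide_left_mono) (auto intro!: mult_pos_pos)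
    next
      fix t assume "t \<in> {x1 + e'..x2 - e'}"
      from e'(3)[OF this] show "1 / r t \<le> e'"
        using e'(1) by (smt (verit) divide_pos_pos le_divide_eq_1 mult.commute pos_divide_le_eq)
    qed (use x12 in auto)
    finally show ?thesis by simp
  qed
  have "integral {0..1} ?f = integral {0..x1} ?f + integral {x1..1} ?f"
    using x12 i by (intro Henstock_Kurzweil_Integration.integral_combine[symmetric]) auto
  also have "integral {x1..1} ?f = integral {x1..x2} ?f + integral {x2..1} ?f"
    using x12 i by (intro Henstock_Kurzweil_Integration.integral_combine[symmetric]) auto
  finally have eq: "integral {0..1} ?f = integral {0..x1} ?f + (integral {x1..x2} ?f + integral {x2..1} ?f)" .
  have "integral {0..1} ?f \<le> (N + N') / m0\<^sup>2 +
      (((2 * (1 / m0) + 1) * e + (2 * (1 / m0) + 1) * e') + (N + N') / m0\<^sup>2)"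
    unfolding eq by (intro add_mono outer inner) (use x12 in \<open>auto simp: Omega1_def\<close>)
  also have "\<dots> = 2 / m0\<^sup>2 * (N + N') + (2 / m0 + 1) * (e + e')"
    by (simp add: algebra_simps add_divide_distrib)
  also have "\<dots> \<le> (2 / m0\<^sup>2 + 2 / m0 + 1) * (N + N') + (2 / m0\<^sup>2 + 2 / m0 + 1) * (e + e')"
    using m0 N0 e(1) e'(1) by (intro add_mono mult_right_mono) auto
  also have "\<dots> = (2 / m0\<^sup>2 + 2 / m0 + 1) * ((N + e) + (N' + e'))"
    by (subst distrib_left[symmetric]) (simp only: add_ac)
  finally show ?thesis .
qed

section \<open>The rate of convergence\<close>

lemma le_powr_half: "0 \<le> x \<Longrightarrow> x \<le> 1 \<Longrightarrow> x \<le> x powr (1 / 2)" for x :: real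
  using powr_mono'[of "1/2" 1 x] by simp

lemma tendsto_Linf_norm_uniform_limit:
  assumes x12: "0 < x1" "x1 < x2" "x2 < 1"
    and lim: "uniform_limit (Omega1 x1 x2) p (p 0) (at_right 0)"
    and cont: "\<forall>\<^sub>F \<epsilon> in at_right 0. continuous_on (Omega1 x1 x2) (\<lambda>x. p \<epsilon> x - p 0 x)"
  shows "((\<lambda>\<epsilon>. Linf_norm (Omega1 x1 x2) (\<lambda>x. p \<epsilon> x - p 0 x)) \<longlongrightarrow> 0) (at_right 0)"
proof (rule tendstoI)
  fix e :: real assume e: "0 < e"
  have "\<forall>\<^sub>F \<epsilon> in at_right 0. \<forall>x\<in>Omega1 x1 x2. dist (p \<epsilon> x) (p 0 x) < e / 2"
    using lim e by (intro uniform_limitD) auto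
  with cont show "\<forall>\<^sub>F \<epsilon> in at_right 0. dist (Linf_norm (Omega1 x1 x2) (\<lambda>x. p \<epsilon> x - p 0 x)) 0 < e"
  proof eventually_elim
    case (elim \<epsilon>)
    have "0 \<in> Omega1 x1 x2" using x12 by (auto simp: Omega1_def)
    then have "0 \<le> Linf_norm (Omega1 x1 x2) (\<lambda>x. p \<epsilon> x - p 0 x)"
      using Linf_norm_continuous(1)[OF elim(1) x12] abs_ge_zero order_trans by blast
    moreover have "Linf_norm (Omega1 x1 x2) (\<lambda>x. p \<epsilon> x - p 0 x) \<le> e / 2"
      by (rule Linf_norm_continuous(2)[OF elim(1) x12])
        (use elim(2) in \<open>auto simp: dist_real_def intro: less_imp_le\<close>)
    ultimately show ?case using e by (simp add: dist_real_def)
  qed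
qed

theorem lemma3p1:
  fixes \<epsilon>0 lam m0 x1 x2 :: real and p :: "real \<Rightarrow> real \<Rightarrow> real"
  assumes "0 < \<epsilon>0" "\<epsilon>0 \<le> 1" and "0 < lam" and "0 < m0"
    and "0 < x1" "x1 < x2" "x2 < 1"
    and "\<And>\<epsilon>. \<epsilon> \<in> {0<..\<epsilon>0} \<Longrightarrow> C2_on {0..1} (p \<epsilon>)"
    and "C2_on (Omega1 x1 x2) (p 0)"
    and "uniform_limit (Omega1 x1 x2) p (p 0) (at_right 0)"
    and "\<And>\<epsilon> x. \<epsilon> \<in> {0<..\<epsilon>0} \<Longrightarrow> x \<in> {x1 + \<epsilon>..x2 - \<epsilon>} \<Longrightarrow> p \<epsilon> x \<ge> 1 / \<epsilon>"
    and "\<And>\<epsilon> x. \<epsilon> \<in> {0<..\<epsilon>0} \<Longrightarrow> x \<in> {0<..<1} \<Longrightarrow> p \<epsilon> x \<ge> m0"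
  shows "(\<forall>l :: real \<Rightarrow> complex.
            (\<forall>\<epsilon>\<in>{0..\<epsilon>0}. l \<epsilon> \<in> sigma_A x1 x2 p lam \<epsilon>) \<longrightarrow>
            (l \<longlongrightarrow> l 0) (at_right 0) \<longrightarrow>
            (\<exists>C>0. \<forall>\<^sub>F \<epsilon> in at_right 0.
               cmod (l \<epsilon> - l 0)
                 \<le> C * (Linf_norm (Omega1 x1 x2) (\<lambda>x. p \<epsilon> x - p 0 x) + \<epsilon>) powr (1 / 2))) \<and>
         (\<forall>\<epsilon>\<in>{0<..\<epsilon>0}.
            (\<exists>\<mu>. enumerates_spectrum I01 (L2 I01) (graph_A (p \<epsilon>) lam) \<mu>) \<and>
            (\<forall>\<mu>. enumerates_spectrum I01 (L2 I01) (graph_A (p \<epsilon>) lam) \<mu> \<longrightarrow>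
               filterlim (\<lambda>i. \<mu> (Suc i) - \<mu> i) at_top sequentially))"
proof (intro conjI allI impI ballI)
  note x12 = assms(5-7)
  have coeff: "\<exists>q'. diffusion_coefficient (p \<epsilon>) q' m0" if e: "\<epsilon> \<in> {0<..\<epsilon>0}" for \<epsilon>
    by (rule C2_on_imp_coefficient[OF assms(8)[OF e] assms(4) assms(12)[OF e]]) auto
  {
    fix \<epsilon> assume e: "\<epsilon> \<in> {0<..\<epsilon>0}"
    obtain q' where "diffusion_coefficient (p \<epsilon>) q' m0" using coeff[OF e] by blast
    then interpret diffusion_coefficient "p \<epsilon>" q' m0 lam .
    show "\<exists>\<mu>. enumerates_spectrum I01 (L2 I01) (graph_A (p \<epsilon>) lam) \<mu>"
      using spectrum_enumeration by blast
    show "filterlim (\<lambda>i. \<mu> (Suc i) - \<mu> i) at_top sequentially"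
      if "enumerates_spectrum I01 (L2 I01) (graph_A (p \<epsilon>) lam) \<mu>" for \<mu>
      by (rule spectrum_gap[OF that])
  }
  fix l :: "real \<Rightarrow> complex"
  assume mem: "\<forall>\<epsilon>\<in>{0..\<epsilon>0}. l \<epsilon> \<in> sigma_A x1 x2 p lam \<epsilon>" and lim: "(l \<longlongrightarrow> l 0) (at_right 0)"
  have pc: "continuous_on {0..1} (p \<epsilon>)" and pm: "t \<in> {0..1} \<Longrightarrow> m0 \<le> p \<epsilon> t"
    if "\<epsilon> \<in> {0<..\<epsilon>0}" for \<epsilon> t
    using coeff[OF that] diffusion_coefficient.p_continuous diffusion_coefficient.p_ge by blast+
  have shoot: "\<exists>k u v. 0 \<le> k \<and> l \<epsilon> = of_real lam + of_real k \<and>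
      shoots (\<lambda>t. 1 / p \<epsilon> t) (of_real k) u v \<and> v 1 = 0" if e: "\<epsilon> \<in> {0<..\<epsilon>0}" for \<epsilon>
  proof -
    obtain q' where "diffusion_coefficient (p \<epsilon>) q' m0" using coeff[OF e] by blast
    then interpret diffusion_coefficient "p \<epsilon>" q' m0 lam .
    have "l \<epsilon> \<in> op_spectrum I01 (L2 I01) (graph_A (p \<epsilon>) lam)"
      using bspec[OF mem, of \<epsilon>] e by (simp add: sigma_A_def)
    then show ?thesis by (rule spectrum_imp_shoots) blast
  qed
  define N where "N \<epsilon> = Linf_norm (Omega1 x1 x2) (\<lambda>x. p \<epsilon> x - p 0 x)" for \<epsilon>
  define E where "E \<epsilon> = N \<epsilon> + \<epsilon>" for \<epsilon>
  have O: "Omega1 x1 x2 \<subseteq> {0..1}" using x12 by (auto simp: Omega1_def)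
  have p0c: "continuous_on (Omega1 x1 x2) (p 0)"
    using assms(9) unfolding C2_on_def by (meson DERIV_continuous_on)
  have dc: "continuous_on (Omega1 x1 x2) (\<lambda>x. p \<epsilon> x - p 0 x)" if "\<epsilon> \<in> {0<..\<epsilon>0}" for \<epsilon>
    by (intro continuous_intros p0c continuous_on_subset[OF pc[OF that] O])
  have ev0: "\<forall>\<^sub>F \<epsilon> in at_right 0. \<epsilon> \<in> {0<..\<epsilon>0}"
    using assms(1) by (auto simp: eventually_at_right_field intro!: exI[of _ \<epsilon>0])
  have "(N \<longlongrightarrow> 0) (at_right 0)"
    unfolding N_def[abs_def]
    by (rule tendsto_Linf_norm_uniform_limit[OF x12 assms(10)])
      (rule eventually_mono[OF ev0 dc])
  then have E0: "(E \<longlongrightarrow> 0) (at_right 0)"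
    unfolding E_def[abs_def] by (auto intro!: tendsto_eq_intros)
  have NN: "\<bar>p \<epsilon> t - p 0 t\<bar> \<le> N \<epsilon>" if "\<epsilon> \<in> {0<..\<epsilon>0}" "t \<in> Omega1 x1 x2" for \<epsilon> t
    unfolding N_def by (rule Linf_norm_continuous(1)[OF dc[OF that(1)] x12 that(2)])
  have Epos: "0 \<le> E \<epsilon>" if e: "\<epsilon> \<in> {0<..\<epsilon>0}" for \<epsilon>
    using NN[OF e, of 0] x12 e by (auto simp: E_def Omega1_def)
  define K where "K = cmod (l 0 - of_real lam) + 1"
  have K: "0 \<le> K" by (simp add: K_def)
  have A: "0 < 1 / m0" using assms(4) by simp
  show "\<exists>C>0. \<forall>\<^sub>F \<epsilon> in at_right 0. cmod (l \<epsilon> - l 0)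
      \<le> C * (Linf_norm (Omega1 x1 x2) (\<lambda>x. p \<epsilon> x - p 0 x) + \<epsilon>) powr (1 / 2)"
  proof (rule eigenvalue_stability[OF A K])
    fix \<rho> C :: real
    assume \<rho>: "0 < \<rho>" and C: "0 < C"
      and stab: "\<And>a b \<kappa> \<mu> u v U V. \<lbrakk>continuous_on {0..1} a; continuous_on {0..1} b;
        \<forall>t\<in>{0..1}. 0 \<le> a t \<and> a t \<le> 1 / m0; \<forall>t\<in>{0..1}. 0 \<le> b t \<and> b t \<le> 1 / m0;
        0 \<le> \<kappa>; \<kappa> \<le> K; 0 \<le> \<mu>; \<mu> \<le> K;
        shoots a (of_real \<kappa>) u v; v 1 = 0; shoots b (of_real \<mu>) U V; V 1 = 0;
        integral {0..1} (\<lambda>t. \<bar>a t - b t\<bar>) + \<bar>\<kappa> - \<mu>\<bar> \<le> \<rho>\<rbrakk>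
        \<Longrightarrow> \<bar>\<kappa> - \<mu>\<bar> \<le> C * integral {0..1} (\<lambda>t. \<bar>a t - b t\<bar>)"
    define C1 where "C1 = 2 / m0\<^sup>2 + 2 / m0 + 1"
    have C1: "0 < C1" unfolding C1_def using assms(4) by (intro add_pos_pos divide_pos_pos) auto
    \<comment> \<open>\<open>C1 * E \<epsilon>\<close> and \<open>cmod (l \<epsilon> - l 0)\<close> are below \<open>\<rho> / 4\<close>, so two good parameters together
      satisfy the smallness condition of \<open>stab\<close>\<close>
    define good where "good \<epsilon> \<longleftrightarrow> \<epsilon> \<in> {0<..\<epsilon>0} \<and> 2 * \<epsilon> \<le> x2 - x1 \<and> cmod (l \<epsilon> - l 0) < min 1 (\<rho> / 4) \<and>
        E \<epsilon> < min 1 (\<rho> / (4 * C1))" for \<epsilon>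
    have ev_good: "\<forall>\<^sub>F \<epsilon> in at_right 0. good \<epsilon>"
    proof -
      have 1: "\<forall>\<^sub>F \<epsilon> in at_right 0. 2 * \<epsilon> \<le> x2 - x1"
        using x12 by (auto simp: eventually_at_right_field field_simps intro!: exI[of _ "(x2 - x1) / 2"])
      have 2: "\<forall>\<^sub>F \<epsilon> in at_right 0. cmod (l \<epsilon> - l 0) < min 1 (\<rho> / 4)"
        using tendstoD[OF lim, of "min 1 (\<rho> / 4)"] \<rho> by (simp add: dist_norm)
      have 3: "\<forall>\<^sub>F \<epsilon> in at_right 0. E \<epsilon> < min 1 (\<rho> / (4 * C1))"
        using order_tendstoD(2)[OF E0, of "min 1 (\<rho> / (4 * C1))"] \<rho> C1 by simp
      show ?thesis
        unfolding good_def using ev0 1 2 3 by eventually_elim blast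
    qed
    have cauchy: "cmod (l \<epsilon> - l \<epsilon>') \<le> C * C1 * (E \<epsilon> + E \<epsilon>')" if g: "good \<epsilon>" and g': "good \<epsilon>'" for \<epsilon> \<epsilon>'
    proof -
      have e: "\<epsilon> \<in> {0<..\<epsilon>0}" and e': "\<epsilon>' \<in> {0<..\<epsilon>0}" using g g' by (auto simp: good_def)
      obtain k u v where k: "0 \<le> k" "l \<epsilon> = of_real lam + of_real k"
        "shoots (\<lambda>t. 1 / p \<epsilon> t) (of_real k) u v" "v 1 = 0" using shoot[OF e] by blast
      obtain k' U V where k': "0 \<le> k'" "l \<epsilon>' = of_real lam + of_real k'"
        "shoots (\<lambda>t. 1 / p \<epsilon>' t) (of_real k') U V" "V 1 = 0" using shoot[OF e'] by blast
      have kK: "r \<le> K" if "l \<eta> = of_real lam + of_real r" "good \<eta>" for r \<eta>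
      proof -
        have "r \<le> cmod (of_real r)" by simp
        also have "complex_of_real r = (l 0 - of_real lam) + (l \<eta> - l 0)" using that(1) by simp
        also have "cmod \<dots> \<le> cmod (l 0 - of_real lam) + cmod (l \<eta> - l 0)" by (rule norm_triangle_ineq)
        also have "\<dots> \<le> K" using that(2) by (auto simp: K_def good_def)
        finally show ?thesis .
      qed
      have ll: "cmod (l \<epsilon> - l \<epsilon>') = \<bar>k - k'\<bar>"
      proof -
        have "l \<epsilon> - l \<epsilon>' = of_real (k - k')" by (simp add: k k')
        then show ?thesis by (simp only: norm_of_real)
      qed
      have b: "continuous_on {0..1} (\<lambda>t. 1 / p \<eta> t)" "\<forall>t\<in>{0..1}. 0 \<le> 1 / p \<eta> t \<and> 1 / p \<eta> t \<le> 1 / m0"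
        if "\<eta> \<in> {0<..\<epsilon>0}" for \<eta>
      proof -
        have pos: "0 < p \<eta> t" if "t \<in> {0..1}" for t using pm[OF \<open>\<eta> \<in> {0<..\<epsilon>0}\<close> that] assms(4) by linarith
        show "continuous_on {0..1} (\<lambda>t. 1 / p \<eta> t)"
          by (intro continuous_intros pc that) (use pos in force)
        show "\<forall>t\<in>{0..1}. 0 \<le> 1 / p \<eta> t \<and> 1 / p \<eta> t \<le> 1 / m0"
          using pos pm[OF that] assms(4) by (auto intro!: divide_left_mono mult_pos_pos intro: less_imp_le)
      qed
      have d: "integral {0..1} (\<lambda>t. \<bar>1 / p \<epsilon> t - 1 / p \<epsilon>' t\<bar>) \<le> C1 * (E \<epsilon> + E \<epsilon>')"
        unfolding C1_def E_def
        by (rule integral_reciprocal_difference[where ?p0.0 = "p 0", OF x12 assms(4)])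
          (use pc pm NN e e' g g' assms(11) in \<open>auto simp: good_def\<close>)
      have "cmod (l \<epsilon> - l \<epsilon>') \<le> cmod (l \<epsilon> - l 0) + cmod (l \<epsilon>' - l 0)"
        by (metis norm_triangle_sub norm_minus_commute dist_norm dist_triangle2)
      also have "\<dots> \<le> \<rho> / 2" using g g' by (simp add: good_def)
      finally have "\<bar>k - k'\<bar> \<le> \<rho> / 2" unfolding ll .
      moreover have "C1 * (E \<epsilon> + E \<epsilon>') \<le> C1 * (\<rho> / (4 * C1) + \<rho> / (4 * C1))"
        using g g' C1 by (intro mult_left_mono add_mono) (auto simp: good_def)
      then have "C1 * (E \<epsilon> + E \<epsilon>') \<le> \<rho> / 2" using C1 by (simp add: field_simps)
      ultimately have "integral {0..1} (\<lambda>t. \<bar>1 / p \<epsilon> t - 1 / p \<epsilon>' t\<bar>) + \<bar>k - k'\<bar> \<le> \<rho>"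
        using d by linarith
      then have "\<bar>k - k'\<bar> \<le> C * integral {0..1} (\<lambda>t. \<bar>1 / p \<epsilon> t - 1 / p \<epsilon>' t\<bar>)"
        by (rule stab[OF b(1)[OF e] b(1)[OF e'] b(2)[OF e] b(2)[OF e'] k(1) kK[OF k(2) g]
              k'(1) kK[OF k'(2) g'] k(3,4) k'(3,4)])
      also have "\<dots> \<le> C * (C1 * (E \<epsilon> + E \<epsilon>'))"
        using d C by (intro mult_left_mono) auto
      finally show ?thesis by (simp add: ll mult.assoc)
    qed
    \<comment> \<open>let \<open>\<epsilon>'\<close> tend to 0\<close>
    have "cmod (l \<epsilon> - l 0) \<le> C * C1 * E \<epsilon>" if g: "good \<epsilon>" for \<epsilon>
    proof (rule tendsto_le)
      show "((\<lambda>\<epsilon>'. C * C1 * (E \<epsilon> + E \<epsilon>')) \<longlongrightarrow> C * C1 * E \<epsilon>) (at_right 0)"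
        by (auto intro!: tendsto_eq_intros E0)
      show "((\<lambda>\<epsilon>'. cmod (l \<epsilon> - l \<epsilon>')) \<longlongrightarrow> cmod (l \<epsilon> - l 0)) (at_right 0)"
        by (intro tendsto_intros lim)
      show "\<forall>\<^sub>F \<epsilon>' in at_right 0. cmod (l \<epsilon> - l \<epsilon>') \<le> C * C1 * (E \<epsilon> + E \<epsilon>')"
        using ev_good by eventually_elim (rule cauchy[OF g])
    qed simp
    note rate = this
    show "\<exists>C>0. \<forall>\<^sub>F \<epsilon> in at_right 0. cmod (l \<epsilon> - l 0)
        \<le> C * (Linf_norm (Omega1 x1 x2) (\<lambda>x. p \<epsilon> x - p 0 x) + \<epsilon>) powr (1 / 2)"
    proof (intro exI[of _ "C * C1"] conjI)
      show "0 < C * C1" using C C1 by simp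
      show "\<forall>\<^sub>F \<epsilon> in at_right 0. cmod (l \<epsilon> - l 0)
          \<le> C * C1 * (Linf_norm (Omega1 x1 x2) (\<lambda>x. p \<epsilon> x - p 0 x) + \<epsilon>) powr (1 / 2)"
        using ev_good
      proof eventually_elim
        case (elim \<epsilon>)
        have "E \<epsilon> \<le> E \<epsilon> powr (1 / 2)"
          using elim Epos[of \<epsilon>] by (intro le_powr_half) (auto simp: good_def)
        then have "C * C1 * E \<epsilon> \<le> C * C1 * E \<epsilon> powr (1 / 2)"
          using C C1 by (intro mult_left_mono) auto
        with rate[OF elim] show ?case by (simp add: E_def N_def)
      qed
    qed
  qed
qed

end
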